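(* Let $\{\mathcal{D}_l\}_{l\ge 1}$ be a real-valued, centered, stationary and ergodic process such that for every $n$ the vector $D^n=(\mathcal{D}_1,\ldots,\mathcal{D}_n)$ has a density $f^n$ on $\mathbb{R}^n$ with finite differential entropy, and such that the differential entropy rate $h(\mathcal{D})=\lim_{n\to\infty}\frac1n h(D^n)$ exists and is finite. Let $c(\mathcal{D})=-h(\mathcal{D})$. For each $n$ let $\mu^n$ be a homogeneous Poisson point process on $\mathbb{R}^n$ of intensity $\lambda_n=e^{nR_n}$. For any subsequence $n_k\to\infty$ such that $\limsup_{k\to\infty}R_{n_k}<c(\mathcal{D})$, it is possible to choose decoding regions $\{\mathcal{C}_k^n\}_k$ that are subsets of $\mathbb{R}^n$ jointly stationary with the points and the displacements, forming a decomposition of $\mathbb{R}^n$, such that $\lim_{k\to\infty}p_e(n_k)=0$.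
   Context: All logarithms are natural. Write $\mu^n=\sum_k\epsilon_{T_k^n}$ and let $\mathbb{P}_0^n$ denote the Palm probability of $\mu^n$, under which $T_0^n=0$. Each point $T_k^n$ carries a displacement vector $D_k^n\in\mathbb{R}^n$; the $D_k^n$ are i.i.d. in $k$, distributed as $D^n$, and independent of the points and of the decoding regions (so the decoder does not see the displacements). Decoding regions: to each point $T_k^n$ is attached, as a mark (jointly stationary with the points under translations of $\mathbb{R}^n$), a measurable set $\mathcal{C}_k^n\subset\mathbb{R}^n$; forming a decomposition of $\mathbb{R}^n$ means that the regions are pairwise disjoint and cover $\mathbb{R}^n$ up to boundaries (a Lebesgue-null set). The probability of error is $p_e(n)=\mathbb{P}_0^n(D_0^n\notin\mathcal{C}_0^n)$. *)

theory Defs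
  imports "HOL-Probability.Probability"
begin

subsection \<open>Stationary ergodic processes indexed by l = 1, 2, ...\<close>

text \<open>Processes are functions of a natural number; the value at index 0 is never used.\<close>

definition path_law :: "'a measure \<Rightarrow> (nat \<Rightarrow> 'a \<Rightarrow> real) \<Rightarrow> (nat \<Rightarrow> real) measure" where
  "path_law P X = distr P (PiM {1..} (\<lambda>_. borel)) (\<lambda>\<omega>. \<lambda>l\<in>{1..}. X l \<omega>)"

definition path_shift :: "(nat \<Rightarrow> real) \<Rightarrow> (nat \<Rightarrow> real)" where
  "path_shift x = (\<lambda>l\<in>{1..}. x (Suc l))"

definition stationary_process :: "'a measure \<Rightarrow> (nat \<Rightarrow> 'a \<Rightarrow> real) \<Rightarrow> bool" where
  "stationary_process P X \<longleftrightarrow>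
     (\<forall>l\<ge>1. X l \<in> borel_measurable P) \<and> path_law P (\<lambda>l. X (Suc l)) = path_law P X"

definition ergodic_process :: "'a measure \<Rightarrow> (nat \<Rightarrow> 'a \<Rightarrow> real) \<Rightarrow> bool" where
  "ergodic_process P X \<longleftrightarrow>
     (\<forall>A\<in>sets (path_law P X). path_shift -` A \<inter> space (path_law P X) = A \<longrightarrow>
        measure (path_law P X) A = 0 \<or> measure (path_law P X) A = 1)"

definition centered_process :: "'a measure \<Rightarrow> (nat \<Rightarrow> 'a \<Rightarrow> real) \<Rightarrow> bool" where
  "centered_process P X \<longleftrightarrow> (\<forall>l\<ge>1. integrable P (X l) \<and> integral\<^sup>L P (X l) = 0)"


subsection \<open>The space \<open>\<real>\<^sup>n\<close> for varying n\<close>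

text \<open>Vectors are extensional functions on \<open>{1..n}\<close>, with Lebesgue measure on the Borel sets.\<close>

abbreviation Rn :: "nat \<Rightarrow> (nat \<Rightarrow> real) measure" where
  "Rn n \<equiv> PiM {1..n} (\<lambda>_. lborel)"

definition first_n :: "nat \<Rightarrow> (nat \<Rightarrow> 'a \<Rightarrow> real) \<Rightarrow> 'a \<Rightarrow> nat \<Rightarrow> real" where
  "first_n n X \<omega> = (\<lambda>l\<in>{1..n}. X l \<omega>)"

definition vadd :: "nat \<Rightarrow> (nat \<Rightarrow> real) \<Rightarrow> (nat \<Rightarrow> real) \<Rightarrow> (nat \<Rightarrow> real)" where
  "vadd n x y = (\<lambda>l\<in>{1..n}. x l + y l)"

text \<open>The set \<open>A - t\<close>, i.e. A seen from the point t.\<close>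

definition seen_from :: "nat \<Rightarrow> (nat \<Rightarrow> real) \<Rightarrow> (nat \<Rightarrow> real) set \<Rightarrow> (nat \<Rightarrow> real) set" where
  "seen_from n t A = {x \<in> space (Rn n). vadd n t x \<in> A}"

definition unit_cube :: "nat \<Rightarrow> (nat \<Rightarrow> real) set" where
  "unit_cube n = (\<Pi>\<^sub>E l\<in>{1..n}. {0..<1})"


subsection \<open>Point processes\<close>

text \<open>A point process is given by a measurable enumeration of its points \<open>T 0, T 1, ...\<close>; counts are
  in \<open>ennreal\<close>, so that an infinite count is not confused with 0.\<close>

definition point_count ::
  "(nat \<Rightarrow> 'w \<Rightarrow> nat \<Rightarrow> real) \<Rightarrow> (nat \<Rightarrow> real) set \<Rightarrow> 'w \<Rightarrow> ennreal" where
  "point_count T B \<omega> = (\<Sum>k. indicator B (T k \<omega>))"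

definition poisson_process ::
  "nat \<Rightarrow> 'w measure \<Rightarrow> real \<Rightarrow> (nat \<Rightarrow> 'w \<Rightarrow> nat \<Rightarrow> real) \<Rightarrow> bool" where
  "poisson_process n M lam T \<longleftrightarrow>
     (\<forall>k. T k \<in> M \<rightarrow>\<^sub>M Rn n) \<and>
     (\<forall>B\<in>sets (Rn n). emeasure (Rn n) B < \<infinity> \<longrightarrow>
        (\<forall>j::nat. measure M {\<omega> \<in> space M. point_count T B \<omega> = of_nat j} =
           (lam * measure (Rn n) B) ^ j / fact j * exp (- (lam * measure (Rn n) B)))) \<and>
     (\<forall>(m::nat) B. (\<forall>i<m. B i \<in> sets (Rn n) \<and> emeasure (Rn n) (B i) < \<infinity>) \<longrightarrow>
        disjoint_family_on B {..<m} \<longrightarrow>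
        prob_space.indep_vars M (\<lambda>_. borel) (\<lambda>i. point_count T (B i)) {..<m})"

definition iid_displacements ::
  "nat \<Rightarrow> 'w measure \<Rightarrow> (nat \<Rightarrow> real) measure \<Rightarrow> (nat \<Rightarrow> 'w \<Rightarrow> nat \<Rightarrow> real) \<Rightarrow> bool" where
  "iid_displacements n M law D \<longleftrightarrow>
     prob_space.indep_vars M (\<lambda>_. Rn n) D UNIV \<and> (\<forall>k. distr M (Rn n) (D k) = law)"

definition displacements_indep_points ::
  "nat \<Rightarrow> 'w measure \<Rightarrow> (nat \<Rightarrow> 'w \<Rightarrow> nat \<Rightarrow> real) \<Rightarrow> (nat \<Rightarrow> 'w \<Rightarrow> nat \<Rightarrow> real) \<Rightarrow> bool" where
  "displacements_indep_points n M T D \<longleftrightarrow>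
     prob_space.indep_var M (PiM UNIV (\<lambda>_. Rn n)) (\<lambda>\<omega> k. D k \<omega>) (PiM UNIV (\<lambda>_. Rn n)) (\<lambda>\<omega> k. T k \<omega>)"

text \<open>Stationarity of a marked point process with marks in a measurable space K: the law of the
  random counting measure with an atom at each \<open>(T k, Z k)\<close> does not change when all points
  are translated by y and keep their marks.  The law of a random measure is the joint law of its
  values on sequences of measurable sets, so it does not depend on the enumeration.\<close>

definition mark_count ::
  "(nat \<Rightarrow> 'w \<Rightarrow> nat \<Rightarrow> real) \<Rightarrow> (nat \<Rightarrow> 'w \<Rightarrow> 'k) \<Rightarrow> ((nat \<Rightarrow> real) \<times> 'k) set \<Rightarrow> 'w \<Rightarrow> ennreal" where
  "mark_count T Z E \<omega> = (\<Sum>k. indicator E (T k \<omega>, Z k \<omega>))"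

definition stationary_marked ::
  "nat \<Rightarrow> 'k measure \<Rightarrow> 'w measure \<Rightarrow> (nat \<Rightarrow> 'w \<Rightarrow> nat \<Rightarrow> real) \<Rightarrow> (nat \<Rightarrow> 'w \<Rightarrow> 'k) \<Rightarrow> bool" where
  "stationary_marked n K M T Z \<longleftrightarrow>
     (\<forall>k. T k \<in> M \<rightarrow>\<^sub>M Rn n) \<and> (\<forall>k. Z k \<in> M \<rightarrow>\<^sub>M K) \<and>
     (\<forall>y\<in>space (Rn n). \<forall>E::nat \<Rightarrow> _. (\<forall>i. E i \<in> sets (Rn n \<Otimes>\<^sub>M K)) \<longrightarrow>
        distr M (PiM UNIV (\<lambda>_. borel)) (\<lambda>\<omega> i. mark_count (\<lambda>k \<omega>. vadd n y (T k \<omega>)) Z (E i) \<omega>) =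
        distr M (PiM UNIV (\<lambda>_. borel)) (\<lambda>\<omega> i. mark_count T Z (E i) \<omega>))"

text \<open>Palm probability.  For points of intensity lam, the Palm probability of an event A is
  \<open>E (card {k. T k \<in> B \<and> the configuration seen from T k is in A}) / (lam * vol B)\<close>,
  which by stationarity does not depend on B; here B is the unit cube.  It is realised on pairs
  \<open>(\<omega>, k)\<close>: k is the typical point, placed at the origin, so that the Palm law is the law under this
  measure of the configuration with points \<open>T j \<omega> - T k \<omega>\<close>, displacements \<open>D j \<omega>\<close> and regions
  \<open>C j \<omega> - T k \<omega>\<close>; the point with index 0 in the Palm notation is the point j = k.\<close>

definition palm ::
  "nat \<Rightarrow> 'w measure \<Rightarrow> real \<Rightarrow> (nat \<Rightarrow> 'w \<Rightarrow> nat \<Rightarrow> real) \<Rightarrow> ('w \<times> nat) measure" where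
  "palm n M lam T =
     density (M \<Otimes>\<^sub>M count_space UNIV) (\<lambda>(\<omega>, k). ennreal (1 / lam) * indicator (unit_cube n) (T k \<omega>))"


subsection \<open>Decoding regions\<close>

text \<open>Borel sets as marks, with the evaluations \<open>A \<mapsto> (x \<in> A)\<close> measurable.\<close>

definition region_space :: "nat \<Rightarrow> (nat \<Rightarrow> real) set measure" where
  "region_space n = sigma (sets (Rn n)) ((\<lambda>x. {A \<in> sets (Rn n). x \<in> A}) ` space (Rn n))"

text \<open>Points and regions are carried by a sub-sigma-algebra G independent of the displacements.
  Independence of all events \<open>x \<in> C k\<close> for fixed x would not be enough: adding the received point
  \<open>T k + D k\<close> to \<open>C k\<close> does not change the probability of any such event.  Joint measurability of
  the graph with respect to G excludes this.\<close>

definition regions_indep_displacements ::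
  "nat \<Rightarrow> 'w measure \<Rightarrow> (nat \<Rightarrow> 'w \<Rightarrow> nat \<Rightarrow> real) \<Rightarrow> (nat \<Rightarrow> 'w \<Rightarrow> nat \<Rightarrow> real) \<Rightarrow>
    (nat \<Rightarrow> 'w \<Rightarrow> (nat \<Rightarrow> real) set) \<Rightarrow> bool" where
  "regions_indep_displacements n M T D C \<longleftrightarrow>
     (\<exists>G. subalgebra M G \<and>
        (\<forall>k. T k \<in> G \<rightarrow>\<^sub>M Rn n) \<and>
        (\<forall>k. {(\<omega>, x). \<omega> \<in> space M \<and> x \<in> C k \<omega>} \<in> sets (G \<Otimes>\<^sub>M Rn n)) \<and>
        prob_space.indep_set M
          (sets (vimage_algebra (space M) (\<lambda>\<omega> k. D k \<omega>) (PiM UNIV (\<lambda>_. Rn n)))) (sets G))"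

definition decomposition ::
  "nat \<Rightarrow> 'w measure \<Rightarrow> (nat \<Rightarrow> 'w \<Rightarrow> (nat \<Rightarrow> real) set) \<Rightarrow> bool" where
  "decomposition n M C \<longleftrightarrow>
     (AE \<omega> in M. disjoint_family (\<lambda>k. C k \<omega>) \<and> space (Rn n) - (\<Union>k. C k \<omega>) \<in> null_sets (Rn n))"

text \<open>Under a translation of space both \<open>T k\<close> and \<open>C k\<close> move, so the translation invariant mark
  that carries the region is \<open>C k - T k\<close>.\<close>

definition decoding_regions ::
  "nat \<Rightarrow> 'w measure \<Rightarrow> (nat \<Rightarrow> 'w \<Rightarrow> nat \<Rightarrow> real) \<Rightarrow> (nat \<Rightarrow> 'w \<Rightarrow> nat \<Rightarrow> real) \<Rightarrow>
    (nat \<Rightarrow> 'w \<Rightarrow> (nat \<Rightarrow> real) set) \<Rightarrow> bool" where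
  "decoding_regions n M T D C \<longleftrightarrow>
     regions_indep_displacements n M T D C \<and>
     stationary_marked n (Rn n \<Otimes>\<^sub>M region_space n) M T
       (\<lambda>k \<omega>. (D k \<omega>, seen_from n (T k \<omega>) (C k \<omega>))) \<and>
     decomposition n M C"

definition error_probability ::
  "nat \<Rightarrow> 'w measure \<Rightarrow> real \<Rightarrow> (nat \<Rightarrow> 'w \<Rightarrow> nat \<Rightarrow> real) \<Rightarrow> (nat \<Rightarrow> 'w \<Rightarrow> nat \<Rightarrow> real) \<Rightarrow>
    (nat \<Rightarrow> 'w \<Rightarrow> (nat \<Rightarrow> real) set) \<Rightarrow> real" where
  "error_probability n M lam T D C =
     measure (palm n M lam T)
       {(\<omega>, k). \<omega> \<in> space M \<and> D k \<omega> \<notin> seen_from n (T k \<omega>) (C k \<omega>)}"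

end

theory Submission
  imports Defs
begin

text \<open>A location is decoded to the point from which it is a typical displacement, where a displacement
  is typical if its density is at least \<open>exp (- n (h + d))\<close>.  Typical sets have volume at most
  \<open>exp (n (h + d))\<close>, so by the second factorial moment of the Poisson process the expected number of other
  points that could be confused with the typical point is at most \<open>lam n * exp (n (h + d))\<close>, which tends
  to 0 when the rate stays below \<open>- h - 2 d\<close>.

  That displacements are typical with probability tending to 1 is the easy half of the
  Shannon-McMillan-Breiman theorem: the density of a Markov approximation exceeds the true density by an
  exponential factor only with exponentially small probability (Markov's inequality), and its logarithm is
  a Birkhoff sum.  Only the upper bound of the ergodic theorem is needed.

  Locations typical for no point or for several are given to the point with the least value of an injective
  measurable key of the relative position.  Regions thus commute with translations and, up to
  ties between equal points, do not depend on the enumeration.  Stationarity of the marked process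
  follows by sorting the points by their key: the sorted sequence is a function of the counts, and sorting
  permutes the independent displacements by a permutation that depends on the points only.\<close>

text \<open>The Poisson hypotheses speak only of counts, so the law of \<open>T\<close> as a
  sequence is unknown, and the translated sequence need not have the same law as the original one.
  This obstacle forces a canonical enumeration. Independence, moreover, is given only for counts of
  disjoint sets. A real-valued key meets both needs: its sublevel sets form a chain, the counts
  along the chain are partial sums of counts of disjoint shells, and the fractional digits of the
  key code the position, so nothing is lost by looking at keys only.

  For the entropy part one Markov order \<open>k\<close>, fixed once, is enough. Minus the logarithm
  of the Markov density averages to the increment
  \<open>diff_entropy (Suc k) - diff_entropy k\<close>, and convergence of
  \<open>diff_entropy n / n\<close> alone yields some increment below \<open>h + e\<close>; neither
  monotonicity of conditional entropies nor martingale convergence enters.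

  A lower bound on the density of likely displacements is what decoding needs, since it bounds the
  volume of the typical set. The reverse half of the equipartition property would only bound that
  volume from below.\<close>

declare One_nat_def [simp del]

section \<open>The upper half of the ergodic theorem\<close>

locale ergodic_map = prob_space +
  fixes th :: "'a \<Rightarrow> 'a"
  assumes th_measurable [measurable]: "th \<in> M \<rightarrow>\<^sub>M M"
    and th_preserves: "distr M M th = M"
    and th_ergodic: "\<And>A. A \<in> sets M \<Longrightarrow> th -` A \<inter> space M = A \<Longrightarrow> prob A = 0 \<or> prob A = 1"
begin

lemma funpow_th_measurable [measurable]: "(th ^^ n) \<in> M \<rightarrow>\<^sub>M M"
  by (induction n) (auto intro: measurable_comp th_measurable measurable_ident)

lemma funpow_th_preserves: "distr M M (th ^^ n) = M"
proof (induction n)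
  case 0 then show ?case by (simp add: distr_id id_def)
next
  case (Suc n)
  have "distr M M (th ^^ Suc n) = distr (distr M M (th ^^ n)) M th"
    by (subst distr_distr) (auto simp: comp_def)
  then show ?case using Suc th_preserves by (simp add: comp_def)
qed

lemma AE_funpow_th: 
  assumes "AE x in M. Q x" shows "AE x in M. Q ((th ^^ n) x)"
  by (rule AE_distrD[of "th ^^ n" M M], measurable) (subst funpow_th_preserves, fact)

text \<open>This is the maximum over \<open>m \<le> n\<close> of the sums of the first
  \<open>m + 1\<close> terms along the orbit. In this recursive form
  \<open>max_sum g (Suc n) x - max_sum g n (th x)\<close> is visibly
  \<open>g x - min 0 (max_sum g n (th x))\<close>.\<close>

primrec max_sum :: "('a \<Rightarrow> real) \<Rightarrow> nat \<Rightarrow> 'a \<Rightarrow> real" where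
  "max_sum g 0 x = g x"
| "max_sum g (Suc n) x = g x + max 0 (max_sum g n (th x))"

lemma max_sum_measurable [measurable]:
  assumes [measurable]: "g \<in> borel_measurable M"
  shows "max_sum g n \<in> borel_measurable M"
  by (induction n) (auto intro!: measurable_compose[OF th_measurable] borel_measurable_add borel_measurable_max assms)

lemma integrable_comp_th:
  fixes g :: "'a \<Rightarrow> real"
  assumes "integrable M g" 
  shows "integrable M (\<lambda>x. g (th x))"
  using integrable_distr[of th M M g] assms by (simp add: th_preserves)

lemma max_sum_integrable:
  assumes "integrable M g" 
  shows "integrable M (max_sum g n)"
  by (induction n) (auto intro!: integrable_comp_th assms simp: max_def[symmetric] intro: integrable_comp_th)

lemma max_sum_Suc_ge: "max_sum g n x \<le> max_sum g (Suc n) x"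
proof (induction n arbitrary: x)
  case (Suc n)
  show ?case unfolding max_sum.simps(2)[of g "Suc n"] max_sum.simps(2)[of g n x] using Suc[of "th x"] by (auto simp: max_def simp del: max_sum.simps)
qed simp

lemma max_sum_mono: "m \<le> n \<Longrightarrow> max_sum g m x \<le> max_sum g n x"
  by (rule lift_Suc_mono_le[of "\<lambda>n. max_sum g n x"]) (rule max_sum_Suc_ge)

lemma sum_le_max_sum: "(\<Sum>i\<le>n. g ((th ^^ i) x)) \<le> max_sum g n x"
proof (induction n arbitrary: x)
  case (Suc n)
  have "(\<Sum>i\<le>Suc n. g ((th ^^ i) x)) = g x + (\<Sum>i\<le>n. g ((th ^^ i) (th x)))"
    by (subst sum.atMost_Suc_shift) (simp add: funpow_swap1 del: funpow.simps(2) add: funpow_Suc_right)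
  with Suc[of "th x"] show ?case by simp
qed simp

text \<open>Garsia's argument: \<open>max_sum g (Suc n) x - max_sum g n (th x)\<close> has nonnegative integral and
  decreases to \<open>g x\<close> where the sums are unbounded above, an invariant event.\<close>

lemma birkhoff_sums_bounded_above:
  fixes g :: "'a \<Rightarrow> real"
  assumes g: "integrable M g" and neg: "(\<integral>x. g x \<partial>M) < 0"
  shows "AE x in M. \<exists>B. \<forall>n. (\<Sum>i<n. g ((th ^^ i) x)) \<le> B"
proof -
  have [measurable]: "g \<in> borel_measurable M" using g by auto
  define A where "A = {x\<in>space M. \<forall>m::nat. \<exists>n. max_sum g n x > real m}"
  have A[measurable]: "A \<in> sets M" unfolding A_def by measurable
  \<comment> \<open>One application of \<open>th\<close> changes the supremum by the finite number
    \<open>g x\<close> only. Hence \<open>A\<close> is invariant exactly, not merely up to a null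
    set, as \<open>th_ergodic\<close> requires.\<close>
  have unb: "(\<forall>m::nat. \<exists>n. max_sum g n (th x) > real m) \<longleftrightarrow> (\<forall>m::nat. \<exists>n. max_sum g n x > real m)" for x
  proof safe
    fix m assume a: "\<forall>m::nat. \<exists>n. max_sum g n (th x) > real m"
    obtain k::nat where "real k > real m + \<bar>g x\<bar>" using reals_Archimedean2 by blast
    with a obtain n where "max_sum g n (th x) > real m + \<bar>g x\<bar>" by (meson order_less_trans)
    then have "max_sum g (Suc n) x > m" by (auto simp: max_def)
    then show "\<exists>n. max_sum g n x > real m" by blast
  next
    fix m assume a: "\<forall>m::nat. \<exists>n. max_sum g n x > real m"
    obtain k::nat where "real k > real m + \<bar>g x\<bar>" using reals_Archimedean2 by blast
    with a obtain n where "max_sum g n x > real m + \<bar>g x\<bar>" by (meson order_less_trans)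
    then have "max_sum g (Suc n) x > real m + \<bar>g x\<bar>" using max_sum_Suc_ge[of g n x] by linarith
    then show "\<exists>n. max_sum g n (th x) > real m" by (auto simp: max_def split: if_splits intro!: exI[of _ n])
  qed
  have inv: "th -` A \<inter> space M = A"
    using unb measurable_space[OF th_measurable] by (auto simp: A_def)
  from th_ergodic[OF A inv] show ?thesis
  proof
    assume "prob A = 0"
    then have "AE x in M. x \<notin> A"
      using A by (simp add: emeasure_eq_measure AE_iff_null[symmetric] null_sets_def AE_not_in)
    with AE_space show ?thesis
    proof eventually_elim
      case (elim x)
      then obtain m :: nat where m: "\<And>n. max_sum g n x \<le> real m" unfolding A_def by (auto simp: not_less)
      have "(\<Sum>i<n. g ((th ^^ i) x)) \<le> real m" for n
        using sum_le_max_sum[where g=g and n="n-1" and x=x] m[of "n-1"] by (cases n) (auto simp: lessThan_Suc_atMost)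
      then show ?case by blast
    qed
  next
    assume pA: "prob A = 1"
    then have AA: "AE x in M. x \<in> A" using AE_prob_1 by blast
    define d where "d n x = max_sum g (Suc n) x - max_sum g n (th x)" for n x
    have d_eq: "d n x = g x - min 0 (max_sum g n (th x))" for n x by (auto simp: d_def max_def min_def)
    have int: "(\<integral>x. max_sum g n (th x) \<partial>M) = (\<integral>x. max_sum g n x \<partial>M)" for n
      using integral_distr[of th M M "max_sum g n"] by (simp add: th_preserves)
    \<comment> \<open>Since \<open>th\<close> preserves the measure, this integral is a difference
      of integrals of consecutive maxima, which increase.\<close>
    have d0: "0 \<le> (\<integral>x. d n x \<partial>M)" for n
    proof -
      have "(\<integral>x. d n x \<partial>M) = (\<integral>x. max_sum g (Suc n) x \<partial>M) - (\<integral>x. max_sum g n x \<partial>M)"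
        unfolding d_def int[of n, symmetric] by (intro Bochner_Integration.integral_diff max_sum_integrable integrable_comp_th g)
      moreover have "(\<integral>x. max_sum g n x \<partial>M) \<le> (\<integral>x. max_sum g (Suc n) x \<partial>M)"
        by (intro integral_mono max_sum_integrable g max_sum_Suc_ge)
      ultimately show ?thesis by simp
    qed
    have "(\<lambda>n. \<integral>x. d n x \<partial>M) \<longlonglongrightarrow> (\<integral>x. g x \<partial>M)"
    \<comment> \<open>The maxima increase from \<open>max_sum g 0\<close>, so the negative part of
      \<open>max_sum g n (th x)\<close> is bounded by that first term, uniformly in
      \<open>n\<close>.\<close>
    proof (rule integral_dominated_convergence[where w="\<lambda>x. \<bar>g x\<bar> + \<bar>max_sum g 0 (th x)\<bar>"])
      show "integrable M (\<lambda>x. \<bar>g x\<bar> + \<bar>max_sum g 0 (th x)\<bar>)"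
        using integrable_comp_th[OF max_sum_integrable[OF g, of 0]] g by auto
      show "AE x in M. (\<lambda>n. d n x) \<longlonglongrightarrow> g x"
        using AA
      proof eventually_elim
        case (elim x)
        then have "\<forall>m::nat. \<exists>n. max_sum g n (th x) > real m" using unb by (auto simp: A_def)
        then obtain k where "max_sum g k (th x) > 0" by (metis of_nat_0)
        then have "d n x = g x" if "n \<ge> k" for n using max_sum_mono[OF that, of g "th x"] by (auto simp: d_eq)
        then show ?case by (intro tendsto_eventually) (auto simp: eventually_sequentially)
      qed
      show "AE x in M. norm (d n x) \<le> \<bar>g x\<bar> + \<bar>max_sum g 0 (th x)\<bar>" for n
        using max_sum_mono[of 0 n g] by (intro AE_I2) (auto simp: d_eq min_def, smt)
      show "d n \<in> borel_measurable M" for n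
        unfolding d_def[abs_def] by (intro borel_measurable_diff max_sum_measurable measurable_compose[OF th_measurable]) auto
    qed auto
    then have "0 \<le> (\<integral>x. g x \<partial>M)" by (rule LIMSEQ_le_const) (use d0 in auto)
    with neg show ?thesis by simp
  qed
qed

text \<open>With \<open>e\<close> half the gap, \<open>g - (a - e)\<close> has negative mean, so its
  sums stay below some \<open>B\<close> along almost every orbit; the remaining \<open>n * e\<close>
  eventually exceeds \<open>B\<close>.\<close>

lemma birkhoff_upper:
  fixes g :: "'a \<Rightarrow> real"
  assumes g: "integrable M g" and less: "(\<integral>x. g x \<partial>M) < a"
  shows "AE x in M. eventually (\<lambda>n. (\<Sum>i<n. g ((th ^^ i) x)) \<le> real n * a) sequentially"
proof -
  define e where "e = (a - (\<integral>x. g x \<partial>M)) / 2"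
  have e: "e > 0" "expectation g < a - e" using less by (simp_all add: e_def field_simps)
  have "AE x in M. \<exists>B. \<forall>n. (\<Sum>i<n. g ((th ^^ i) x) - (a - e)) \<le> B"
    using e by (intro birkhoff_sums_bounded_above[where g="\<lambda>x. g x - (a - e)"]) (auto simp: g prob_space)
  then show ?thesis
  proof eventually_elim
    case (elim x)
    then obtain B where B: "\<And>n. (\<Sum>i<n. g ((th ^^ i) x) - (a - e)) \<le> B" by blast
    have "eventually (\<lambda>n::nat. B / e \<le> real n) sequentially"
      using eventually_ge_at_top[of "nat \<lceil>B/e\<rceil>"] by eventually_elim linarith
    then show ?case
    proof eventually_elim
      case (elim n)
      then have "B \<le> real n * e" using e by (simp add: field_simps)
      moreover have "(\<Sum>i<n. g ((th ^^ i) x)) - real n * (a - e) \<le> B" using B[of n] by (simp add: sum_subtractf)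
      ultimately show ?case by (simp add: algebra_simps)
    qed
  qed
qed

end

section \<open>Densities of long prefixes\<close>

lemma (in prob_space) prob_tendsto_0_of_AE:
  assumes [measurable]: "\<And>n. A n \<in> sets M"
    and AE: "AE x in M. eventually (\<lambda>n. x \<notin> A n) sequentially"
  shows "(\<lambda>n. prob (A n)) \<longlonglongrightarrow> 0"
proof -
  have "(\<lambda>n. \<integral>x. indicator (A n) x \<partial>M) \<longlonglongrightarrow> (\<integral>x. (0::real) \<partial>M)"
  proof (rule integral_dominated_convergence[where w="\<lambda>_. 1"])
    show "AE x in M. (\<lambda>n. indicator (A n) x :: real) \<longlonglongrightarrow> 0"
      using AE
    proof eventually_elim
      case (elim x)
      then show ?case by (intro tendsto_eventually) (auto elim!: eventually_mono)
    qed
  qed auto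
  then show ?thesis by simp
qed

text \<open>Otherwise \<open>H\<close> would grow at least linearly with slope \<open>h + e\<close>.
  Applied to the entropies of prefixes, it selects the order of the Markov approximation.\<close>

lemma increment_less_of_average_limit:
  fixes H :: "nat \<Rightarrow> real"
  assumes lim: "(\<lambda>n. H n / real n) \<longlonglongrightarrow> h" and e: "e > 0"
  shows "\<exists>k\<ge>1. H (Suc k) - H k < h + e"
proof (rule ccontr)
  assume "\<not> ?thesis"
  then have ge: "H (Suc k) - H k \<ge> h + e" if "k \<ge> 1" for k using that by auto
  have lin: "H (Suc n) \<ge> H 1 + real n * (h + e)" for n
    unfolding One_nat_def
  proof (induction n)
    case (Suc n) then show ?case using ge[of "Suc n"] by (simp add: algebra_simps)
  qed simp
  have "(\<lambda>n. (H 1 + real n * (h + e)) / real (Suc n)) \<longlonglongrightarrow> h + e"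
  proof -
    have "(\<lambda>n. (H 1 - (h + e)) * inverse (real (Suc n)) + (h + e)) \<longlonglongrightarrow> (H 1 - (h + e)) * 0 + (h + e)"
      by (intro tendsto_intros LIMSEQ_inverse_real_of_nat)
    moreover have "(H 1 - (h + e)) * inverse (real (Suc n)) + (h + e) = (H 1 + real n * (h + e)) / real (Suc n)" for n
      by (simp add: field_simps)
    ultimately show ?thesis by simp
  qed
  moreover have "(\<lambda>n. H (Suc n) / real (Suc n)) \<longlonglongrightarrow> h" using lim by (rule LIMSEQ_Suc)
  ultimately have "h + e \<le> h"
    by (rule LIMSEQ_le) (auto intro!: divide_right_mono lin)
  with e show False by simp
qed

lemma Rn_Suc: "Rn (Suc k) = PiM (insert (Suc k) {1..k}) (\<lambda>_. lborel)"
  by (simp add: atLeastAtMostSuc_conv)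

interpretation lborel_prod: product_sigma_finite "\<lambda>_::nat. lborel :: real measure"
  by standard

text \<open>On path space the process becomes the iteration of one measure-preserving map, and
  \<open>f n\<close> is the density of a restriction map.\<close>

locale stationary_densities = ergodic_map M path_shift for M :: "(nat \<Rightarrow> real) measure" +
  fixes f :: "nat \<Rightarrow> (nat \<Rightarrow> real) \<Rightarrow> real"
  assumes sets_paths: "sets M = sets (PiM {1..} (\<lambda>_. borel))"
    and density: "\<And>n. n \<ge> 1 \<Longrightarrow> distributed M (Rn n) (\<lambda>x. restrict x {1..n}) (\<lambda>x. ennreal (f n x))"
    and density_nonneg: "\<And>n x. n \<ge> 1 \<Longrightarrow> x \<in> space (Rn n) \<Longrightarrow> 0 \<le> f n x"
    and density_entropy: "\<And>n. n \<ge> 1 \<Longrightarrow> integrable (Rn n) (\<lambda>x. f n x * ln (f n x))"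
begin

lemma prefix_measurable [measurable]: "(\<lambda>x. restrict x {1..n}) \<in> M \<rightarrow>\<^sub>M Rn n"
proof -
  have "(\<lambda>x. restrict x {1..n}) \<in> PiM {1..} (\<lambda>_. borel) \<rightarrow>\<^sub>M PiM {1..n} (\<lambda>_. borel)"
    by (rule measurable_restrict_subset) auto
  also have "\<dots> = M \<rightarrow>\<^sub>M Rn n"
    by (intro measurable_cong_sets sets_paths[symmetric] sets_PiM_cong) auto
  finally show ?thesis .
qed

lemma density_measurable [measurable]: "f (Suc k) \<in> borel_measurable (Rn (Suc k))"
  by (rule distributed_real_measurable[OF density_nonneg density]) auto

lemma density_measurable': "k \<ge> 1 \<Longrightarrow> f k \<in> borel_measurable (Rn k)"
  by (rule distributed_real_measurable[OF density_nonneg density]) auto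

text \<open>It agrees with \<open>f k\<close> only almost everywhere. Dividing by it, and not by
  \<open>f k\<close>, makes \<open>step_density\<close> integrate to at most 1 for every past,
  without exceptional sets.\<close>

definition marginal :: "nat \<Rightarrow> (nat \<Rightarrow> real) \<Rightarrow> ennreal" where
  "marginal k u = (\<integral>\<^sup>+y. ennreal (f (Suc k) (u(Suc k := y))) \<partial>lborel)"

definition step_density :: "nat \<Rightarrow> (nat \<Rightarrow> real) \<Rightarrow> ennreal" where
  "step_density k z = ennreal (f (Suc k) z) / marginal k (restrict z {1..k})"

definition window :: "nat \<Rightarrow> nat \<Rightarrow> (nat \<Rightarrow> real) \<Rightarrow> (nat \<Rightarrow> real)" where
  "window k i x = (\<lambda>l\<in>{1..k}. x (i + l))"

text \<open>The density of the k-th order Markov process with the same (k+1)-dimensional law, on \<open>k + m\<close>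
  coordinates.  With a/0 = 0 in \<open>ennreal\<close> it is always a subprobability density.\<close>

definition markov_density :: "nat \<Rightarrow> nat \<Rightarrow> (nat \<Rightarrow> real) \<Rightarrow> ennreal" where
  "markov_density k m x = ennreal (f k (restrict x {1..k})) * (\<Prod>i<m. step_density k (window (Suc k) i x))"

section \<open>Markov approximations are subprobability densities\<close>

lemma extend_measurable [measurable]: "(\<lambda>(u, y). u(Suc k := y)) \<in> Rn k \<Otimes>\<^sub>M lborel \<rightarrow>\<^sub>M Rn (Suc k)"
  unfolding Rn_Suc by (rule measurable_add_dim)

lemma marginal_measurable [measurable]: "marginal k \<in> borel_measurable (Rn k)"
proof -
  have "(\<lambda>p. ennreal (f (Suc k) (case p of (u, y) \<Rightarrow> u(Suc k := y)))) \<in> borel_measurable (Rn k \<Otimes>\<^sub>M lborel)"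
    by (rule measurable_compose[OF extend_measurable]) measurable
  then have [measurable]: "(\<lambda>(u, y). ennreal (f (Suc k) (u(Suc k := y)))) \<in> borel_measurable (Rn k \<Otimes>\<^sub>M lborel)"
    by (simp only: case_prod_unfold)
  have "(\<lambda>u. \<integral>\<^sup>+y. (case (u, y) of (u, y) \<Rightarrow> ennreal (f (Suc k) (u(Suc k := y)))) \<partial>lborel) \<in> borel_measurable (Rn k)"
    by (rule sigma_finite_measure.borel_measurable_nn_integral_fst[OF sigma_finite_lborel]) measurable
  then show ?thesis by (simp add: marginal_def[abs_def])
qed

lemma restrict_measurable [measurable]: "(\<lambda>x. restrict x {1..k}) \<in> Rn (Suc k) \<rightarrow>\<^sub>M Rn k"
  by (rule measurable_restrict_subset) auto

lemma restrict_le_measurable: "k \<le> n \<Longrightarrow> (\<lambda>x. restrict x {1..k}) \<in> Rn n \<rightarrow>\<^sub>M Rn k"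
  by (rule measurable_restrict_subset) auto

lemma window_measurable: "i + k \<le> n \<Longrightarrow> window k i \<in> Rn n \<rightarrow>\<^sub>M Rn k"
  unfolding window_def[abs_def] by (rule measurable_restrict) (auto intro!: measurable_component_singleton)

lemma step_density_measurable [measurable]: "step_density k \<in> borel_measurable (Rn (Suc k))"
  unfolding step_density_def[abs_def] by measurable

lemma markov_density_measurable [measurable]: 
  assumes "k \<ge> 1"
  shows "markov_density k m \<in> borel_measurable (Rn (k + m))"
  unfolding markov_density_def[abs_def]
  by (intro borel_measurable_times_ennreal borel_measurable_prod_ennreal measurable_compose[OF window_measurable step_density_measurable]
    measurable_compose[OF measurable_compose[OF restrict_le_measurable density_measurable'[OF assms]] measurable_ennreal]) auto

lemma markov_density_prefix: "markov_density k m (restrict x {1..k + m}) = markov_density k m x"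
proof -
  have "window (Suc k) i (restrict x {1..k + m}) = window (Suc k) i x" if "i < m" for i
    using that by (auto simp: window_def fun_eq_iff)
  moreover have "restrict (restrict x {1..k + m}) {1..k} = restrict x {1..k}" by (auto simp: restrict_def)
  ultimately show ?thesis by (simp add: markov_density_def)
qed

lemma restrict_extend: "u \<in> space (Rn k) \<Longrightarrow> restrict (u(Suc k := y)) {1..k} = u"
  by (auto simp: space_PiM PiE_def extensional_def restrict_def fun_eq_iff)

text \<open>The integral is the marginal divided by itself: 1 in general, and 0 in the degenerate
  cases where the marginal is 0 or infinite.\<close>

lemma nn_integral_step_density_le_1:
  assumes u: "u \<in> space (Rn k)"
  shows "(\<integral>\<^sup>+y. step_density k (u(Suc k := y)) \<partial>lborel) \<le> 1"
proof -
  have [measurable]: "(\<lambda>y. u(Suc k := y)) \<in> lborel \<rightarrow>\<^sub>M Rn (Suc k)"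
    using measurable_compose[OF measurable_Pair1'[OF u] extend_measurable] by simp
  have "(\<integral>\<^sup>+y. step_density k (u(Suc k := y)) \<partial>lborel) = (\<integral>\<^sup>+y. ennreal (f (Suc k) (u(Suc k := y))) / marginal k u \<partial>lborel)"
    unfolding step_density_def restrict_extend[OF u] ..
  also have "\<dots> = marginal k u / marginal k u"
    unfolding marginal_def by (rule nn_integral_divide) measurable
  also have "\<dots> \<le> 1"
    by (cases "marginal k u = 0 \<or> marginal k u = \<infinity>") (auto simp: ennreal_divide_self less_top)
  finally show ?thesis .
qed

text \<open>Only the last window contains the last coordinate, so integrating that coordinate out
  removes one factor at the cost of a constant at most 1.\<close>

lemma nn_integral_markov_density_le_1:
  assumes k: "k \<ge> 1"
  shows "(\<integral>\<^sup>+x. markov_density k m x \<partial>Rn (k + m)) \<le> 1"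
proof (induction m)
  case 0
  have "(\<integral>\<^sup>+x. markov_density k 0 x \<partial>Rn (k + 0)) = (\<integral>\<^sup>+x. ennreal (f k x) * indicator (space (Rn k)) x \<partial>Rn k)"
    unfolding add_0_right by (intro nn_integral_cong) (auto simp: markov_density_def space_PiM PiE_restrict)
  also have "\<dots> = 1"
  proof -
    have "(\<lambda>x. restrict x {1..k}) -` space (Rn k) \<inter> space M = space M" by (auto simp: space_PiM)
    then show ?thesis using distributed_emeasure[OF density[OF k] sets.top] by (simp add: emeasure_space_1)
  qed
  finally show ?case by simp
next
  case (Suc m)
  let ?n = "k + m"
  have "(\<integral>\<^sup>+x. markov_density k (Suc m) x \<partial>Rn (k + Suc m)) = 
    (\<integral>\<^sup>+x. (\<integral>\<^sup>+y. markov_density k (Suc m) (x(Suc ?n := y)) \<partial>lborel) \<partial>Rn ?n)"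
    unfolding add_Suc_right Rn_Suc
    by (rule lborel_prod.product_nn_integral_insert)
       (use markov_density_measurable[OF k, of "Suc m"] in \<open>auto simp: Rn_Suc[symmetric]\<close>)
  also have "\<dots> \<le> (\<integral>\<^sup>+x. markov_density k m x \<partial>Rn ?n)"
  proof (rule nn_integral_mono)
    fix x assume x: "x \<in> space (Rn ?n)"
    let ?u = "window k m x"
    have u: "?u \<in> space (Rn k)" by (auto simp: window_def space_PiM)
    have [measurable]: "(\<lambda>y. ?u(Suc k := y)) \<in> lborel \<rightarrow>\<^sub>M Rn (Suc k)"
      using measurable_compose[OF measurable_Pair1'[OF u] extend_measurable] by simp
    have w: "window (Suc k) m (x(Suc ?n := y)) = ?u(Suc k := y)" for y
      by (auto simp: window_def fun_eq_iff)
    have w': "window (Suc k) i (x(Suc ?n := y)) = window (Suc k) i x" if "i < m" for i y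
      using that by (auto simp: window_def fun_eq_iff)
    have r: "restrict (x(Suc ?n := y)) {1..k} = restrict x {1..k}" for y
      by (auto simp: restrict_def)
    have "(\<integral>\<^sup>+y. markov_density k (Suc m) (x(Suc ?n := y)) \<partial>lborel) =
      (\<integral>\<^sup>+y. markov_density k m x * step_density k (?u(Suc k := y)) \<partial>lborel)"
      by (simp add: markov_density_def w w' r mult.assoc)
    also have "\<dots> = markov_density k m x * (\<integral>\<^sup>+y. step_density k (?u(Suc k := y)) \<partial>lborel)"
      by (rule nn_integral_cmult) measurable
    also have "\<dots> \<le> markov_density k m x * 1"
      by (intro mult_left_mono nn_integral_step_density_le_1 u) auto
    finally show "(\<integral>\<^sup>+y. markov_density k (Suc m) (x(Suc ?n := y)) \<partial>lborel) \<le> markov_density k m x" by simp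
  qed
  finally show ?case using Suc by simp
qed

text \<open>The prefix of length \<open>k\<close> is a prefix of the prefix of length
  \<open>Suc k\<close>, so both functions are densities of the same law.\<close>

lemma marginal_eq_density:
  assumes k: "k \<ge> 1"
  shows "AE x in Rn k. marginal k x = ennreal (f k x)"
proof (rule distributed_unique[OF _ density[OF k]])
  have "distr M (Rn k) (\<lambda>x. restrict x {1..k}) = density (Rn k) (marginal k)"
  proof (rule measure_eqI)
    fix B assume "B \<in> sets (distr M (Rn k) (\<lambda>x. restrict x {1..k}))"
    then have B[measurable]: "B \<in> sets (Rn k)" by simp
    let ?B = "(\<lambda>x. restrict x {1..k}) -` B \<inter> space (Rn (Suc k))"
    have B': "?B \<in> sets (Rn (Suc k))" by measurable
    have "emeasure (distr M (Rn k) (\<lambda>x. restrict x {1..k})) B = emeasure M ((\<lambda>x. restrict x {1..Suc k}) -` ?B \<inter> space M)"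
      using measurable_space[OF prefix_measurable[of "Suc k"]]
      by (subst emeasure_distr) (auto intro!: arg_cong[where f="emeasure M"] simp: restrict_restrict Int_absorb1)
    also have "\<dots> = (\<integral>\<^sup>+x. ennreal (f (Suc k) x) * indicator ?B x \<partial>Rn (Suc k))"
      by (rule distributed_emeasure[OF density B']) simp
    also have "\<dots> = (\<integral>\<^sup>+x. (\<integral>\<^sup>+y. ennreal (f (Suc k) (x(Suc k := y))) * indicator ?B (x(Suc k := y)) \<partial>lborel) \<partial>Rn k)"
      unfolding Rn_Suc
      by (rule lborel_prod.product_nn_integral_insert) (use B' in \<open>auto simp: Rn_Suc[symmetric] simp del: vimage_Int\<close>)
    also have "\<dots> = (\<integral>\<^sup>+x. marginal k x * indicator B x \<partial>Rn k)"
    proof (rule nn_integral_cong)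
      fix x assume x: "x \<in> space (Rn k)"
      have [measurable]: "(\<lambda>y. x(Suc k := y)) \<in> lborel \<rightarrow>\<^sub>M Rn (Suc k)"
        using measurable_compose[OF measurable_Pair1'[OF x] extend_measurable] by simp
      have "indicator ?B (x(Suc k := y)) = (indicator B x :: ennreal)" for y
        using restrict_extend[OF x, of y] measurable_space[OF \<open>(\<lambda>y. x(Suc k := y)) \<in> lborel \<rightarrow>\<^sub>M Rn (Suc k)\<close>, of y]
        by (auto simp: indicator_def)
      then show "(\<integral>\<^sup>+y. ennreal (f (Suc k) (x(Suc k := y))) * indicator ?B (x(Suc k := y)) \<partial>lborel) = marginal k x * indicator B x"
        by (simp add: marginal_def nn_integral_multc)
    qed
    also have "\<dots> = emeasure (density (Rn k) (marginal k)) B" by (simp add: emeasure_density)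
    finally show "emeasure (distr M (Rn k) (\<lambda>x. restrict x {1..k})) B = emeasure (density (Rn k) (marginal k)) B" .
  qed simp
  then show "distributed M (Rn k) (\<lambda>x. restrict x {1..k}) (marginal k)"
    by (simp add: distributed_def)
qed

section \<open>Logarithms of the densities along a path\<close>

lemma AE_prefix:
  assumes k: "k \<ge> 1" and AE: "AE x in Rn k. Q x"
  shows "AE x in M. Q (restrict x {1..k})"
proof -
  have "AE x in distr M (Rn k) (\<lambda>x. restrict x {1..k}). Q x"
    unfolding distributed_distr_eq_density[OF density[OF k]]
    using AE by (subst AE_density) (auto intro: distributed_borel_measurable[OF density[OF k]] simp del: measurable_ennreal)
  then show ?thesis by (rule AE_distrD[rotated]) measurable
qed

text \<open>The zero set of a density has no mass under its own law; the logarithms below are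
  therefore taken of positive numbers almost surely.\<close>

lemma AE_density_pos:
  assumes k: "k \<ge> 1" 
  shows "AE x in M. 0 < f k (restrict x {1..k})"
proof -
  have "AE x in distr M (Rn k) (\<lambda>x. restrict x {1..k}). 0 < f k x"
    unfolding distributed_distr_eq_density[OF density[OF k]]
    by (subst AE_density) (auto intro: distributed_borel_measurable[OF density[OF k]] simp del: measurable_ennreal)
  then show ?thesis by (rule AE_distrD[rotated]) measurable
qed

text \<open>Almost surely this is minus the logarithm of the conditional density of coordinate
  \<open>Suc k\<close> given the first \<open>k\<close>; its mean is a conditional entropy.\<close>

definition log_ratio :: "nat \<Rightarrow> (nat \<Rightarrow> real) \<Rightarrow> real" where
  "log_ratio k x = ln (f k (restrict x {1..k})) - ln (f (Suc k) (restrict x {1..Suc k}))"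

definition diff_entropy :: "nat \<Rightarrow> real" where
  "diff_entropy n = - (\<integral>x. f n x * ln (f n x) \<partial>Rn n)"

lemma integrable_log_density: 
  assumes "k \<ge> 1" shows "integrable M (\<lambda>x. ln (f k (restrict x {1..k})))"
  using density_entropy[OF assms] density_measurable'[OF assms]
  by (subst distributed_integrable[OF density[OF assms], of "\<lambda>x. ln (f k x)", symmetric]) (auto intro: density_nonneg assms)

lemma integral_log_density: 
  assumes "k \<ge> 1" shows "(\<integral>x. ln (f k (restrict x {1..k})) \<partial>M) = - diff_entropy k"
  unfolding diff_entropy_def using density_measurable'[OF assms]
  by (subst distributed_integral[OF density[OF assms], of "\<lambda>x. ln (f k x)", symmetric]) (auto intro: density_nonneg assms)

lemma integrable_log_ratio: "k \<ge> 1 \<Longrightarrow> integrable M (log_ratio k)"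
  unfolding log_ratio_def[abs_def] by (intro Bochner_Integration.integrable_diff integrable_log_density) auto

lemma integral_log_ratio: "k \<ge> 1 \<Longrightarrow> (\<integral>x. log_ratio k x \<partial>M) = diff_entropy (Suc k) - diff_entropy k"
  unfolding log_ratio_def by (subst Bochner_Integration.integral_diff) (auto intro!: integrable_log_density simp: integral_log_density)

lemma step_density_eq_exp:
  assumes k: "k \<ge> 1"
  shows "AE x in M. step_density k (restrict x {1..Suc k}) = ennreal (exp (- log_ratio k x))"
  using AE_density_pos[OF k] AE_density_pos[of "Suc k", simplified] AE_prefix[OF k marginal_eq_density[OF k]]
proof eventually_elim
  case (elim x)
  have "restrict (restrict x {1..Suc k}) {1..k} = restrict x {1..k}" by (auto simp: restrict_def)
  with elim show ?case by (simp add: step_density_def log_ratio_def divide_ennreal exp_diff)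
qed

lemma window_eq_shift:
  assumes "x \<in> space M"
  shows "window k i x = restrict ((path_shift ^^ i) x) {1..k}"
proof -
  have "(path_shift ^^ i) x l = x (i + l)" if "l \<ge> 1" for l
    using that by (induction i arbitrary: l) (auto simp: path_shift_def)
  then show ?thesis by (auto simp: window_def fun_eq_iff)
qed

text \<open>The window starting at \<open>i\<close> is a prefix of the \<open>i\<close>-th shift, so
  the product of conditional densities turns into a Birkhoff sum of \<open>log_ratio k\<close>. One
  null set serves all \<open>m\<close>, because the ergodic bound holds eventually along each single
  path.\<close>

lemma markov_density_eq_exp:
  assumes k: "k \<ge> 1"
  shows "AE x in M. \<forall>m. markov_density k m x = 
    ennreal (exp (ln (f k (restrict x {1..k})) - (\<Sum>i<m. log_ratio k ((path_shift ^^ i) x))))"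
proof -
  have "AE x in M. \<forall>i. step_density k (restrict ((path_shift ^^ i) x) {1..Suc k}) = ennreal (exp (- log_ratio k ((path_shift ^^ i) x)))"
    by (subst AE_all_countable) (intro allI AE_funpow_th step_density_eq_exp k)
  then show ?thesis using AE_density_pos[OF k] AE_space
  proof eventually_elim
    case (elim x)
    show ?case
    proof
      fix m
      have "(\<Prod>i<m. step_density k (window (Suc k) i x)) = ennreal (\<Prod>i<m. exp (- log_ratio k ((path_shift ^^ i) x)))"
        using elim(1,3) by (subst prod_ennreal[symmetric]) (simp_all add: window_eq_shift)
      also have "(\<Prod>i<m. exp (- log_ratio k ((path_shift ^^ i) x))) = exp (- (\<Sum>i<m. log_ratio k ((path_shift ^^ i) x)))"
        by (simp add: exp_sum[symmetric] sum_negf)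
      finally show "markov_density k m x = ennreal (exp (ln (f k (restrict x {1..k})) - (\<Sum>i<m. log_ratio k ((path_shift ^^ i) x))))"
        using elim(2) unfolding markov_density_def
        by (simp add: ennreal_mult[symmetric] exp_diff exp_minus divide_inverse)
    qed
  qed
qed

text \<open>This is Markov's inequality for the ratio of the Markov density to the true one, whose
  mean under the true law is at most 1. The ratio itself is avoided: on the event, \<open>f\<close>
  is dominated by \<open>exp (- a)\<close> times the Markov density.\<close>

lemma prob_markov_density_gt:
  assumes k: "k \<ge> 1"
  shows "prob {x \<in> space M. ennreal (exp a * f (k + m) (restrict x {1..k + m})) < markov_density k m x} \<le> exp (- a)"
proof -
  let ?n = "k + m"
  have n: "?n \<ge> 1" using k by simp
  have [measurable]: "f ?n \<in> borel_measurable (Rn ?n)" by (rule density_measurable'[OF n])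
  have [measurable]: "markov_density k m \<in> borel_measurable (Rn ?n)" by (rule markov_density_measurable[OF k])
  let ?B = "{x \<in> space (Rn ?n). ennreal (exp a * f ?n x) < markov_density k m x}"
  have B: "?B \<in> sets (Rn ?n)" by measurable
  have "emeasure M {x \<in> space M. ennreal (exp a * f ?n (restrict x {1..?n})) < markov_density k m x}
     = emeasure M ((\<lambda>x. restrict x {1..?n}) -` ?B \<inter> space M)"
    using measurable_space[OF prefix_measurable[of ?n]] by (intro arg_cong[where f="emeasure M"]) (auto simp: markov_density_prefix)
  also have "\<dots> = (\<integral>\<^sup>+x. ennreal (f ?n x) * indicator ?B x \<partial>Rn ?n)"
    by (rule distributed_emeasure[OF density[OF n] B])
  also have "\<dots> \<le> (\<integral>\<^sup>+x. ennreal (exp (- a)) * markov_density k m x \<partial>Rn ?n)"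
  proof (rule nn_integral_mono)
    fix x assume x: "x \<in> space (Rn ?n)"
    have "ennreal (f ?n x) = ennreal (exp (- a)) * ennreal (exp a * f ?n x)"
      using density_nonneg[OF n x] by (simp add: ennreal_mult[symmetric] mult.assoc[symmetric] exp_add[symmetric])
    also have "\<dots> \<le> ennreal (exp (- a)) * markov_density k m x" if "x \<in> ?B"
      using that by (intro mult_left_mono) auto
    finally show "ennreal (f ?n x) * indicator ?B x \<le> ennreal (exp (- a)) * markov_density k m x"
      by (auto simp: indicator_def)
  qed
  also have "\<dots> = ennreal (exp (- a)) * (\<integral>\<^sup>+x. markov_density k m x \<partial>Rn ?n)"
    by (rule nn_integral_cmult) measurable
  also have "\<dots> \<le> ennreal (exp (- a)) * 1"
    by (intro mult_left_mono nn_integral_markov_density_le_1 k) auto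
  finally show ?thesis by (simp add: emeasure_eq_measure)
qed

text \<open>If the true density is too small, then either the Markov density exceeds it by the
  factor \<open>exp (n * e)\<close>, which is exponentially unlikely, or the Markov density is too
  small as well, which the ergodic bound excludes eventually.\<close>

theorem prob_density_small_tendsto_0:
  assumes lim: "(\<lambda>n. diff_entropy n / real n) \<longlonglongrightarrow> h" and d: "d > 0"
  shows "(\<lambda>n. prob {x \<in> space M. f n (restrict x {1..n}) < exp (- (real n * (h + d)))}) \<longlonglongrightarrow> 0"
proof -
  \<comment> \<open>Of the slack \<open>d = 4 * e\<close>, one \<open>e\<close> is spent on the
    entropy increment and one on Markov's inequality. The remaining \<open>2 * e\<close> per step
    overcomes the fixed cost of the first \<open>k\<close> coordinates.\<close>
  define e where "e = d / 4"
  have e: "e > 0" using d by (simp add: e_def)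
  obtain k where k: "k \<ge> 1" and inc: "diff_entropy (Suc k) - diff_entropy k < h + e"
    using increment_less_of_average_limit[OF lim e] by blast
  have [measurable]: "(\<lambda>x. f (k+m) (restrict x {1..k+m})) \<in> borel_measurable M" for m
    by (rule measurable_compose[OF prefix_measurable density_measurable']) (use k in simp)
  have [measurable]: "markov_density k m \<in> borel_measurable M" for m
    using measurable_compose[OF prefix_measurable markov_density_measurable[OF k], of m] by (simp only: markov_density_prefix)
  let ?a = "\<lambda>m. real (k + m) * e"
  define big where "big m = {x \<in> space M. ennreal (exp (?a m) * f (k + m) (restrict x {1..k + m})) < markov_density k m x}" for m
  define small where "small m = {x \<in> space M. f (k + m) (restrict x {1..k + m}) < exp (- (real (k + m) * (h + d)))}" for m
  have [measurable]: "big m \<in> sets M" "small m \<in> sets M" for m unfolding big_def small_def by measurable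
  have "(\<lambda>m. prob (small m - big m)) \<longlonglongrightarrow> 0"
  proof (rule prob_tendsto_0_of_AE)
    have "AE x in M. eventually (\<lambda>m. (\<Sum>i<m. log_ratio k ((path_shift ^^ i) x)) \<le> real m * (h + e)) sequentially"
      by (rule birkhoff_upper[OF integrable_log_ratio[OF k]]) (simp add: integral_log_ratio k inc)
    then show "AE x in M. eventually (\<lambda>m. x \<notin> small m - big m) sequentially"
      using markov_density_eq_exp[OF k] AE_space
    proof eventually_elim
      case (elim x)
      let ?l = "ln (f k (restrict x {1..k}))"
      have "eventually (\<lambda>m::nat. - (?l + real k * (h + 3 * e)) < real m * (2 * e)) sequentially"
      proof -
        have "eventually (\<lambda>m::nat. - (?l + real k * (h + 3 * e)) / (2 * e) < real m) sequentially"
          using filterlim_real_sequentially unfolding filterlim_at_top_dense by blast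
        then show ?thesis by eventually_elim (rule iffD1[OF pos_divide_less_eq], use e in auto)
      qed
      with elim(1) show ?case
      proof eventually_elim
        case (elim m)
        show ?case
        proof
          assume x: "x \<in> small m - big m"
          let ?S = "\<Sum>i<m. log_ratio k ((path_shift ^^ i) x)"
          have "ennreal (exp (?l - ?S)) = markov_density k m x"
            using \<open>\<forall>m. markov_density k m x = _ m\<close> by metis
          also have "\<dots> \<le> ennreal (exp (?a m) * f (k + m) (restrict x {1..k + m}))"
            using x by (auto simp: big_def small_def not_less)
          also have "\<dots> \<le> ennreal (exp (?a m) * exp (- (real (k + m) * (h + d))))"
            using x by (intro ennreal_leI mult_left_mono) (auto simp: small_def)
          also have "\<dots> = ennreal (exp (?a m - real (k + m) * (h + d)))"
            by (simp add: exp_diff exp_minus divide_inverse)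
          finally have "?l - ?S \<le> ?a m - real (k + m) * (h + d)"
            by (simp only: ennreal_le_iff[OF exp_ge_zero] exp_le_cancel_iff)
          moreover have d4: "d = 4 * e" by (simp add: e_def)
          ultimately have "?l + real k * (h + 3 * e) + real m * (2 * e) \<le> 0"
            using \<open>?S \<le> real m * (h + e)\<close> unfolding d4 by (simp add: algebra_simps)
          with elim show False by simp
        qed
      qed
    qed
  qed measurable
  moreover have "(\<lambda>m. exp (- ?a m)) \<longlonglongrightarrow> 0"
    using e k by real_asymp
  ultimately have lim': "(\<lambda>m. prob (small m - big m) + exp (- ?a m)) \<longlonglongrightarrow> 0"
    using tendsto_add[of _ 0 _ _ 0] by force
  have "prob (small m) \<le> prob (small m - big m) + exp (- ?a m)" for m
  proof -
    have "prob (small m) \<le> prob ((small m - big m) \<union> big m)" by (intro finite_measure_mono) auto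
    also have "\<dots> \<le> prob (small m - big m) + prob (big m)" by (rule measure_Un_le) auto
    also have "prob (big m) \<le> exp (- ?a m)" unfolding big_def by (rule prob_markov_density_gt[OF k])
    finally show ?thesis by simp
  qed
  then have "(\<lambda>m. prob (small m)) \<longlonglongrightarrow> 0"
    by (intro tendsto_sandwich[OF _ _ tendsto_const lim']) auto
  then have "(\<lambda>m. prob {x \<in> space M. f (m + k) (restrict x {1..m + k}) < exp (- (real (m + k) * (h + d)))}) \<longlonglongrightarrow> 0"
    unfolding small_def by (simp add: add.commute)
  then show ?thesis by (rule LIMSEQ_offset)
qed

end

section \<open>Counts of a Poisson process\<close>

definition big_cube :: "nat \<Rightarrow> nat \<Rightarrow> (nat \<Rightarrow> real) set" where
  "big_cube n m = (\<Pi>\<^sub>E l\<in>{1..n}. {- real m..real m})"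

lemma sets_Rn: "sets (Rn n) = sets (PiM {1..n} (\<lambda>_. borel))"
  by (intro sets_PiM_cong) auto

lemma big_cube_sets [measurable]: "big_cube n m \<in> sets (Rn n)"
  unfolding big_cube_def by (intro sets_PiM_I_finite) auto

lemma unit_cube_sets [measurable]: "unit_cube n \<in> sets (Rn n)"
  unfolding unit_cube_def by (intro sets_PiM_I_finite) auto

lemma emeasure_big_cube: "emeasure (Rn n) (big_cube n m) < \<infinity>"
  unfolding big_cube_def by (subst lborel_prod.emeasure_PiM) (auto simp: ennreal_power less_top[symmetric])

lemma emeasure_unit_cube: "emeasure (Rn n) (unit_cube n) = 1"
  unfolding unit_cube_def by (subst lborel_prod.emeasure_PiM) auto

lemma big_cube_mono: "m \<le> m' \<Longrightarrow> big_cube n m \<subseteq> big_cube n m'"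
  unfolding big_cube_def by (intro PiE_mono) auto

lemma UN_big_cube: "(\<Union>m. big_cube n m) = space (Rn n)"
proof
  show "space (Rn n) \<subseteq> (\<Union>m. big_cube n m)"
  proof
    fix x assume x: "x \<in> space (Rn n)"
    obtain m :: nat where m: "(\<Sum>l\<in>{1..n}. \<bar>x l\<bar>) \<le> real m" using real_arch_simple by blast
    have "\<bar>x l\<bar> \<le> real m" if "l \<in> {1..n}" for l
      using member_le_sum[of l "{1..n}" "\<lambda>l. \<bar>x l\<bar>"] that m by auto
    then have "x \<in> big_cube n m" using x by (auto simp: big_cube_def space_PiM PiE_iff abs_le_iff minus_le_iff)
    then show "x \<in> (\<Union>m. big_cube n m)" by blast
  qed
qed (auto simp: big_cube_def space_PiM PiE_iff)

text \<open>With \<open>q j\<close> the Poisson weights, all three come from \<open>exp\<close> and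
  from \<open>(j + 1) * q (j + 1) = v * q j\<close>, used once for the mean and twice for the second
  moment.\<close>

lemma poisson_weight_sums:
  fixes v :: real
  shows "(\<lambda>j. v ^ j / fact j * exp (- v)) sums 1"
    and "(\<lambda>j. real j * (v ^ j / fact j * exp (- v))) sums v"
    and "(\<lambda>j. real j * real j * (v ^ j / fact j * exp (- v))) sums (v * v + v)"
proof -
  let ?q = "\<lambda>j. v ^ j / fact j * exp (- v)"
  show s0: "?q sums 1"
    using sums_mult2[OF exp_converges[of v], of "exp (- v)"] by (simp add: divide_inverse mult.commute exp_minus)
  have shift: "real (Suc j) * ?q (Suc j) = v * ?q j" for j
    by (simp add: field_simps del: of_nat_Suc)
  have "(\<lambda>j. real (Suc j) * ?q (Suc j)) sums (v * 1)"
    unfolding shift by (rule sums_mult[OF s0])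
  from sums_Suc[OF this] show s1: "(\<lambda>j. real j * ?q j) sums v" by simp
  have "(\<lambda>j. real (Suc j) * (real (Suc j) * ?q (Suc j))) sums (v * v + v * 1)"
  proof -
    have "(\<lambda>j. v * (real j * ?q j) + v * ?q j) sums (v * v + v * 1)"
      by (intro sums_add sums_mult s0 s1)
    moreover have "real (Suc j) * (real (Suc j) * ?q (Suc j)) = v * (real j * ?q j) + v * ?q j" for j
      unfolding shift by (simp add: algebra_simps add_divide_distrib)
    ultimately show ?thesis by simp
  qed
  from sums_Suc[OF this] show "(\<lambda>j. real j * real j * ?q j) sums (v * v + v)" by (simp add: mult.assoc)
qed

section \<open>Moments and joint laws of counts\<close>

lemma point_count_measurable [measurable]:
  assumes [measurable]: "\<And>k. T k \<in> M \<rightarrow>\<^sub>M Rn n" "B \<in> sets (Rn n)"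
  shows "point_count T B \<in> borel_measurable M"
  unfolding point_count_def[abs_def] by measurable

lemma point_count_Un: "A \<inter> B = {} \<Longrightarrow> point_count T (A \<union> B) \<omega> = point_count T A \<omega> + point_count T B \<omega>"
  unfolding point_count_def by (subst suminf_add) (auto simp: indicator_def intro!: suminf_cong)

locale poisson_points = prob_space M for M :: "'w measure" +
  fixes n :: nat and lam :: real and T :: "nat \<Rightarrow> 'w \<Rightarrow> nat \<Rightarrow> real"
  assumes poisson: "poisson_process n M lam T" and lam_pos: "0 < lam"
begin

lemma T_measurable [measurable]: "T k \<in> M \<rightarrow>\<^sub>M Rn n"
  using poisson by (simp add: poisson_process_def)

lemma count_measurable [measurable]: "B \<in> sets (Rn n) \<Longrightarrow> point_count T B \<in> borel_measurable M"
  by (rule point_count_measurable[OF T_measurable])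

lemma indep_counts:
  fixes m :: nat
  assumes "\<And>i. i < m \<Longrightarrow> B i \<in> sets (Rn n)" and "\<And>i. i < m \<Longrightarrow> emeasure (Rn n) (B i) < \<infinity>"
    and "disjoint_family_on B {..<m}"
  shows "indep_vars (\<lambda>_. borel) (\<lambda>i. point_count T (B i)) {..<m}"
  by (rule poisson[unfolded poisson_process_def, THEN conjunct2, THEN conjunct2, rule_format]) (use assms in auto)

text \<open>The hypothesis gives probabilities of finite counts only. As these sum to 1, an infinite
  count is a null event, and the expectation is a series over finite values.\<close>

lemma nn_integral_count:
  fixes g :: "ennreal \<Rightarrow> ennreal"
  assumes B[measurable]: "B \<in> sets (Rn n)" and fin: "emeasure (Rn n) B < \<infinity>" and g[measurable]: "g \<in> borel_measurable borel"
  defines "v \<equiv> lam * measure (Rn n) B"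
  shows "(\<integral>\<^sup>+\<omega>. g (point_count T B \<omega>) \<partial>M) = (\<Sum>j. g (of_nat j) * ennreal (v ^ j / fact j * exp (- v)))"
proof -
  let ?N = "\<lambda>j::nat. {\<omega> \<in> space M. point_count T B \<omega> = of_nat j}"
  have p: "emeasure M (?N j) = ennreal (v ^ j / fact j * exp (- v))" for j
    using poisson fin B by (simp add: poisson_process_def v_def emeasure_eq_measure)
  have v: "v \<ge> 0" using lam_pos by (simp add: v_def)
  have disj: "disjoint_family ?N" by (auto simp: disjoint_family_on_def)
  have "emeasure M (\<Union>j. ?N j) = (\<Sum>j. emeasure M (?N j))"
    by (rule suminf_emeasure[symmetric]) (auto simp: disj)
  also have "\<dots> = ennreal 1"
    unfolding p by (rule suminf_ennreal_eq[OF _ poisson_weight_sums(1)]) (use v in auto)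
  finally have "prob (\<Union>j. ?N j) = 1" by (simp add: emeasure_eq_measure)
  then have "AE \<omega> in M. \<omega> \<in> (\<Union>j. ?N j)" by (rule AE_prob_1)
  then have "(\<integral>\<^sup>+\<omega>. g (point_count T B \<omega>) \<partial>M) = (\<integral>\<^sup>+\<omega>. (\<Sum>j. g (of_nat j) * indicator (?N j) \<omega>) \<partial>M)"
  proof (intro nn_integral_cong_AE, eventually_elim)
    case (elim \<omega>)
    then obtain i where i: "\<omega> \<in> ?N i" by auto
    have "(\<Sum>j. g (of_nat j) * indicator (?N j) \<omega>) = (\<Sum>j\<in>{i}. g (of_nat j) * indicator (?N j) \<omega>)"
      by (rule suminf_finite) (use i in auto)
    also have "\<dots> = g (point_count T B \<omega>)" using i by (simp del: of_nat_eq_iff)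
    finally show ?case by (rule sym)
  qed
  also have "\<dots> = (\<Sum>j. \<integral>\<^sup>+\<omega>. g (of_nat j) * indicator (?N j) \<omega> \<partial>M)"
    by (rule nn_integral_suminf) measurable
  also have "\<dots> = (\<Sum>j. g (of_nat j) * ennreal (v ^ j / fact j * exp (- v)))"
    by (intro suminf_cong) (subst nn_integral_cmult_indicator, auto simp: p)
  finally show ?thesis .
qed

lemma nn_integral_count_mean:
  assumes B[measurable]: "B \<in> sets (Rn n)" and fin: "emeasure (Rn n) B < \<infinity>"
  shows "(\<integral>\<^sup>+\<omega>. point_count T B \<omega> \<partial>M) = ennreal lam * emeasure (Rn n) B"
proof -
  let ?v = "lam * measure (Rn n) B"
  have "(\<integral>\<^sup>+\<omega>. point_count T B \<omega> \<partial>M) = (\<Sum>j. ennreal (real j * (?v ^ j / fact j * exp (- ?v))))"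
    using lam_pos by (subst nn_integral_count[OF B fin, of "\<lambda>x. x"]) (auto intro!: suminf_cong simp: ennreal_of_nat_eq_real_of_nat ennreal_mult[symmetric])
  also have "\<dots> = ennreal ?v"
    by (rule suminf_ennreal_eq[OF _ poisson_weight_sums(2)]) (use lam_pos in auto)
  finally show ?thesis using lam_pos fin by (simp add: ennreal_mult emeasure_eq_ennreal_measure top.not_eq_extremum)
qed

lemma nn_integral_count_square:
  assumes B[measurable]: "B \<in> sets (Rn n)" and fin: "emeasure (Rn n) B < \<infinity>"
  shows "(\<integral>\<^sup>+\<omega>. point_count T B \<omega> * point_count T B \<omega> \<partial>M) =
    ennreal lam * emeasure (Rn n) B * (ennreal lam * emeasure (Rn n) B) + ennreal lam * emeasure (Rn n) B"
proof -
  let ?v = "lam * measure (Rn n) B"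
  have "(\<integral>\<^sup>+\<omega>. point_count T B \<omega> * point_count T B \<omega> \<partial>M) = (\<Sum>j. ennreal (real j * real j * (?v ^ j / fact j * exp (- ?v))))"
    using lam_pos by (subst nn_integral_count[OF B fin, of "\<lambda>x. x * x"]) (auto intro!: suminf_cong simp: ennreal_of_nat_eq_real_of_nat ennreal_mult[symmetric] mult.assoc)
  also have "\<dots> = ennreal (?v * ?v + ?v)"
    by (rule suminf_ennreal_eq[OF _ poisson_weight_sums(3)]) (use lam_pos in auto)
  also have "\<dots> = ennreal ?v * ennreal ?v + ennreal ?v"
    using lam_pos by (simp add: ennreal_plus ennreal_mult)
  finally show ?thesis using lam_pos fin by (simp add: ennreal_mult emeasure_eq_ennreal_measure top.not_eq_extremum)
qed

lemma nn_integral_count_mult_disjoint: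
  assumes A[measurable]: "A \<in> sets (Rn n)" and finA: "emeasure (Rn n) A < \<infinity>"
    and B[measurable]: "B \<in> sets (Rn n)" and finB: "emeasure (Rn n) B < \<infinity>" and disj: "A \<inter> B = {}"
  shows "(\<integral>\<^sup>+\<omega>. point_count T A \<omega> * point_count T B \<omega> \<partial>M) = 
    ennreal lam * emeasure (Rn n) A * (ennreal lam * emeasure (Rn n) B)"
proof -
  let ?B = "\<lambda>i::nat. if i = 0 then A else B"
  have "disjoint_family_on ?B {..<2}" using disj by (auto simp: disjoint_family_on_def)
  then have ind: "indep_vars (\<lambda>_. borel) (\<lambda>i. point_count T (?B i)) {..<2}"
    using finA finB A B by (intro indep_counts) auto
  have [simp]: "{..<2::nat} = {0, 1}" by auto
  have "(\<integral>\<^sup>+\<omega>. (\<Prod>i\<in>{..<2}. point_count T (?B i) \<omega>) \<partial>M) = (\<Prod>i\<in>{..<2}. \<integral>\<^sup>+\<omega>. point_count T (?B i) \<omega> \<partial>M)"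
    by (rule indep_vars_nn_integral[OF _ ind]) auto
  then show ?thesis by (simp add: nn_integral_count_mean[OF A finA] nn_integral_count_mean[OF B finB])
qed

lemma AE_count_finite:
  assumes B[measurable]: "B \<in> sets (Rn n)" and fin: "emeasure (Rn n) B < \<infinity>"
  shows "AE \<omega> in M. point_count T B \<omega> \<noteq> \<infinity>"
  by (rule nn_integral_PInf_AE) (use fin in \<open>auto simp: nn_integral_count_mean[OF B fin] ennreal_mult_eq_top_iff\<close>)

lemma finite_points_iff: "finite {k. T k \<omega> \<in> B} \<longleftrightarrow> point_count T B \<omega> \<noteq> \<infinity>"
proof -
  have "point_count T B \<omega> = (\<integral>\<^sup>+k. indicator {k. T k \<omega> \<in> B} k \<partial>count_space UNIV)"
    by (simp add: point_count_def nn_integral_count_space_nat indicator_def)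
  also have "\<dots> = emeasure (count_space UNIV) {k. T k \<omega> \<in> B}" by (rule nn_integral_indicator) simp
  finally show ?thesis by (simp add: emeasure_count_space)
qed

lemma AE_locally_finite: "AE \<omega> in M. \<forall>m. finite {k. T k \<omega> \<in> big_cube n m}"
  unfolding finite_points_iff AE_all_countable by (intro allI AE_count_finite emeasure_big_cube) measurable

lemma distr_count:
  assumes "poisson_points M' n lam T'"
  assumes B[measurable]: "B \<in> sets (Rn n)" and fin: "emeasure (Rn n) B < \<infinity>"
  shows "distr M borel (point_count T B) = distr M' borel (point_count T' B)"
proof (rule measure_eqI)
  interpret M': poisson_points M' n lam T' by fact
  fix S assume "S \<in> sets (distr M borel (point_count T B))"
  then have [measurable]: "S \<in> sets borel" by simp
  have "emeasure (distr M borel (point_count T B)) S = (\<integral>\<^sup>+x. indicator S x \<partial>distr M borel (point_count T B))" by simp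
  also have "\<dots> = (\<integral>\<^sup>+\<omega>. indicator S (point_count T B \<omega>) \<partial>M)" by (rule nn_integral_distr) measurable
  also have "\<dots> = (\<integral>\<^sup>+\<omega>. indicator S (point_count T' B \<omega>) \<partial>M')"
    by (simp add: nn_integral_count[OF B fin] M'.nn_integral_count[OF B fin])
  also have "\<dots> = (\<integral>\<^sup>+x. indicator S x \<partial>distr M' borel (point_count T' B))" by (rule nn_integral_distr[symmetric]) measurable
  also have "\<dots> = emeasure (distr M' borel (point_count T' B)) S" by simp
  finally show "emeasure (distr M borel (point_count T B)) S = emeasure (distr M' borel (point_count T' B)) S" .
qed simp

lemma distr_counts_disjoint:
  fixes m :: nat
  assumes P': "poisson_points M' n lam T'"
  assumes B: "\<And>i. i < m \<Longrightarrow> B i \<in> sets (Rn n)" and fin: "\<And>i. i < m \<Longrightarrow> emeasure (Rn n) (B i) < \<infinity>"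
    and disj: "disjoint_family_on B {..<m}" and m: "m > 0"
  shows "distr M (PiM {..<m} (\<lambda>_. borel)) (\<lambda>\<omega>. \<lambda>i\<in>{..<m}. point_count T (B i) \<omega>) =
    distr M' (PiM {..<m} (\<lambda>_. borel)) (\<lambda>\<omega>. \<lambda>i\<in>{..<m}. point_count T' (B i) \<omega>)"
proof -
  interpret M': poisson_points M' n lam T' by fact
  have ne: "{..<m} \<noteq> {}" using m by auto
  have "distr M (PiM {..<m} (\<lambda>_. borel)) (\<lambda>\<omega>. \<lambda>i\<in>{..<m}. point_count T (B i) \<omega>) = (\<Pi>\<^sub>M i\<in>{..<m}. distr M borel (point_count T (B i)))"
  proof (rule iffD1[OF indep_vars_iff_distr_eq_PiM'[OF ne]])
    show "indep_vars (\<lambda>_. borel) (\<lambda>i. point_count T (B i)) {..<m}"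
      by (rule indep_counts[OF B fin disj])
  qed (use B in \<open>auto intro: count_measurable\<close>)
  also have "\<dots> = (\<Pi>\<^sub>M i\<in>{..<m}. distr M' borel (point_count T' (B i)))"
    by (intro PiM_cong refl distr_count[OF P'] B fin) auto
  also have "\<dots> = distr M' (PiM {..<m} (\<lambda>_. borel)) (\<lambda>\<omega>. \<lambda>i\<in>{..<m}. point_count T' (B i) \<omega>)"
  proof (rule sym, rule iffD1[OF M'.indep_vars_iff_distr_eq_PiM'[OF ne]])
    show "M'.indep_vars (\<lambda>_. borel) (\<lambda>i. point_count T' (B i)) {..<m}"
      by (rule M'.indep_counts[OF B fin disj])
  qed (use B in \<open>auto intro: M'.count_measurable\<close>)
  finally show ?thesis .
qed

text \<open>Counts of nested sets are not independent, but cutting a finite part of the chain into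
  successive differences gives disjoint sets, and the counts along the chain are the partial sums of
  theirs.\<close>

lemma emeasure_counts_chain:
  fixes L :: "'i::linorder \<Rightarrow> (nat \<Rightarrow> real) set"
  assumes P': "poisson_points M' n lam T'"
  assumes L[measurable]: "\<And>q. L q \<in> sets (Rn n)" and fin: "\<And>q. emeasure (Rn n) (L q) < \<infinity>" and mono: "\<And>q r. q \<le> r \<Longrightarrow> L q \<subseteq> L r"
  assumes J: "finite J" and A[measurable]: "\<And>q. q \<in> J \<Longrightarrow> A q \<in> sets borel"
  shows "emeasure M {\<omega> \<in> space M. \<forall>q\<in>J. point_count T (L q) \<omega> \<in> A q} = emeasure M' {\<omega> \<in> space M'. \<forall>q\<in>J. point_count T' (L q) \<omega> \<in> A q}"
proof (cases "J = {}")
  case True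
  interpret M': poisson_points M' n lam T' by fact
  show ?thesis using True by (simp add: emeasure_space_1 M'.emeasure_space_1)
next
  case False
  interpret M': poisson_points M' n lam T' by fact
  define xs where "xs = sorted_list_of_set J"
  define m where "m = length xs"
  have set_xs: "set xs = J" and sorted: "sorted xs" and "distinct xs" using J by (auto simp: xs_def)
  have m: "m > 0" using False set_xs by (cases xs) (auto simp: m_def)
  define B where "B i = L (xs ! i) - (if i = 0 then {} else L (xs ! (i - 1)))" for i
  have mono_xs: "L (xs ! i) \<subseteq> L (xs ! j)" if "i \<le> j" "j < m" for i j
    using that sorted by (intro mono) (auto simp: sorted_iff_nth_mono m_def)
  have B: "B i \<in> sets (Rn n)" for i unfolding B_def by auto
  have finB: "emeasure (Rn n) (B i) < \<infinity>" for i
    by (rule le_less_trans[OF emeasure_mono fin[of "xs ! i"]]) (auto simp: B_def)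
  have disj: "disjoint_family_on B {..<m}"
    unfolding disjoint_family_on_def
  proof (intro ballI impI)
    have *: "B i \<inter> B j = {}" if "i < j" "j < m" for i j
    proof -
      have "L (xs ! i) \<subseteq> L (xs ! (j - 1))" using that by (intro mono_xs) linarith+
      then show ?thesis using that by (auto simp: B_def)
    qed
    fix i j assume "i \<in> {..<m}" "j \<in> {..<m}" "i \<noteq> j"
    then show "B i \<inter> B j = {}" using *[of i j] *[of j i] by (cases i j rule: linorder_cases) auto
  qed
  have cnt: "point_count U (L (xs ! i)) w = (\<Sum>j\<le>i. point_count U (B j) w)" if "i < m" for U :: "nat \<Rightarrow> 'x \<Rightarrow> nat \<Rightarrow> real" and w i
    using that
  proof (induction i)
    case (Suc i)
    have "L (xs ! Suc i) = L (xs ! i) \<union> B (Suc i)" using mono_xs[of i "Suc i"] Suc by (auto simp: B_def)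
    moreover have "L (xs ! i) \<inter> B (Suc i) = {}" by (auto simp: B_def)
    ultimately show ?case using Suc by (simp add: point_count_Un)
  qed (simp add: B_def)
  define F where "F = {c \<in> space (PiM {..<m} (\<lambda>_. borel)). \<forall>i\<in>{..<m}. (\<Sum>j\<le>i. c j :: ennreal) \<in> A (xs ! i)}"
  have F: "F \<in> sets (PiM {..<m} (\<lambda>_. borel))"
    unfolding F_def
  proof (rule sets.sets_Collect_finite_All')
    fix i assume i: "i \<in> {..<m}"
    then have [measurable]: "A (xs ! i) \<in> sets borel" using set_xs by (intro A) (auto simp: m_def)
    have [measurable]: "(\<lambda>c. \<Sum>j\<le>i. c j :: ennreal) \<in> borel_measurable (PiM {..<m} (\<lambda>_. borel))"
      using i by (intro borel_measurable_sum measurable_component_singleton) auto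
    show "{c \<in> space (PiM {..<m} (\<lambda>_. borel)). (\<Sum>j\<le>i. c j :: ennreal) \<in> A (xs ! i)} \<in> sets (PiM {..<m} (\<lambda>_. borel))"
      by measurable
  qed (use m in auto)
  have all: "(\<forall>q\<in>J. Q q) \<longleftrightarrow> (\<forall>i\<in>{..<m}. Q (xs ! i))" for Q
  proof -
    have "J = (\<lambda>i. xs ! i) ` {..<m}" unfolding set_xs[symmetric] by (auto simp: set_conv_nth m_def)
    then show ?thesis by blast
  qed
  have ev: "{\<omega> \<in> space N. \<forall>q\<in>J. point_count U (L q) \<omega> \<in> A q} = 
      (\<lambda>\<omega>. \<lambda>i\<in>{..<m}. point_count U (B i) \<omega>) -` F \<inter> space N" for N :: "'x measure" and U
  proof -
    have s: "(\<Sum>j\<le>i. (\<lambda>i\<in>{..<m}. point_count U (B i) \<omega>) j) = point_count U (L (xs ! i)) \<omega>" if "i < m" for i \<omega>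
      unfolding cnt[OF that] by (rule sum.cong) (use that in auto)
    have "(\<lambda>i\<in>{..<m}. point_count U (B i) \<omega>) \<in> F \<longleftrightarrow> (\<forall>q\<in>J. point_count U (L q) \<omega> \<in> A q)" for \<omega>
    proof -
      have "(\<lambda>i\<in>{..<m}. point_count U (B i) \<omega>) \<in> F \<longleftrightarrow> 
        (\<forall>i\<in>{..<m}. (\<Sum>j\<le>i. (\<lambda>i\<in>{..<m}. point_count U (B i) \<omega>) j) \<in> A (xs ! i))"
        unfolding F_def by (simp only: mem_Collect_eq space_PiM restrict_PiE_iff space_borel UNIV_I) blast
      also have "\<dots> \<longleftrightarrow> (\<forall>i\<in>{..<m}. point_count U (L (xs ! i)) \<omega> \<in> A (xs ! i))"
        by (rule ball_cong[OF refl]) (simp only: s lessThan_iff)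
      finally show ?thesis by (simp only: all)
    qed
    then show ?thesis by (intro set_eqI) (simp only: mem_Collect_eq vimage_eq Int_iff conj_commute)
  qed
  have "emeasure M {\<omega> \<in> space M. \<forall>q\<in>J. point_count T (L q) \<omega> \<in> A q} = 
    emeasure (distr M (PiM {..<m} (\<lambda>_. borel)) (\<lambda>\<omega>. \<lambda>i\<in>{..<m}. point_count T (B i) \<omega>)) F"
    unfolding ev by (rule emeasure_distr[symmetric]) (auto intro!: measurable_restrict F B count_measurable)
  also have "\<dots> = emeasure (distr M' (PiM {..<m} (\<lambda>_. borel)) (\<lambda>\<omega>. \<lambda>i\<in>{..<m}. point_count T' (B i) \<omega>)) F"
    by (simp only: distr_counts_disjoint[OF P' B finB disj m])
  also have "\<dots> = emeasure M' {\<omega> \<in> space M'. \<forall>q\<in>J. point_count T' (L q) \<omega> \<in> A q}"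
    unfolding ev by (rule emeasure_distr) (auto intro!: measurable_restrict F B M'.count_measurable)
  finally show ?thesis .
qed

text \<open>A law on an infinite product is determined by its finite-dimensional cylinders. In the
  application the index is a rational threshold of the key.\<close>

lemma distr_counts_chain:
  fixes L :: "'i::linorder \<Rightarrow> (nat \<Rightarrow> real) set"
  assumes P': "poisson_points M' n lam T'"
  assumes L[measurable]: "\<And>q. L q \<in> sets (Rn n)" and fin: "\<And>q. emeasure (Rn n) (L q) < \<infinity>" and mono: "\<And>q r. q \<le> r \<Longrightarrow> L q \<subseteq> L r"
  shows "distr M (PiM UNIV (\<lambda>_. borel)) (\<lambda>\<omega> q. point_count T (L q) \<omega>) = distr M' (PiM UNIV (\<lambda>_. borel)) (\<lambda>\<omega> q. point_count T' (L q) \<omega>)"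
proof (rule measure_eqI_PiM_infinite)
  interpret M': poisson_points M' n lam T' by fact
  have meas: "(\<lambda>\<omega> q. point_count T (L q) \<omega>) \<in> M \<rightarrow>\<^sub>M PiM UNIV (\<lambda>_. borel)"
    "(\<lambda>\<omega> q. point_count T' (L q) \<omega>) \<in> M' \<rightarrow>\<^sub>M PiM UNIV (\<lambda>_. borel)"
    by (auto intro!: measurable_PiM_single' count_measurable M'.count_measurable)
  show "finite_measure (distr M (PiM UNIV (\<lambda>_. borel)) (\<lambda>\<omega> q. point_count T (L q) \<omega>))"
    by (intro finite_measure_distr meas)
  fix A :: "'i \<Rightarrow> ennreal set" and J :: "'i set"
  assume J: "finite J" "J \<subseteq> UNIV" and A: "\<And>i. i \<in> J \<Longrightarrow> A i \<in> sets borel"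
  have emb: "prod_emb UNIV (\<lambda>_. borel) J (Pi\<^sub>E J A) \<in> sets (PiM UNIV (\<lambda>_. borel))"
    using J A by (intro sets_PiM_I) auto
  have ev: "(\<lambda>\<omega> q. point_count U (L q) \<omega>) -` prod_emb UNIV (\<lambda>_. borel) J (Pi\<^sub>E J A) \<inter> space N =
     {\<omega> \<in> space N. \<forall>q\<in>J. point_count U (L q) \<omega> \<in> A q}" for N :: "'x measure" and U
    by (auto simp: prod_emb_def)
  show "emeasure (distr M (PiM UNIV (\<lambda>_. borel)) (\<lambda>\<omega> q. point_count T (L q) \<omega>)) (prod_emb UNIV (\<lambda>_. borel) J (Pi\<^sub>E J A)) =
    emeasure (distr M' (PiM UNIV (\<lambda>_. borel)) (\<lambda>\<omega> q. point_count T' (L q) \<omega>)) (prod_emb UNIV (\<lambda>_. borel) J (Pi\<^sub>E J A))"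
    unfolding emeasure_distr[OF meas(1) emb] emeasure_distr[OF meas(2) emb] ev
    by (rule emeasure_counts_chain[OF P' L fin mono J(1) A])
qed auto

end

section \<open>Sorting sequences of reals\<close>

text \<open>Ties are broken by the index, so that sorting does not change the order of equal values.\<close>

definition precedes :: "(nat \<Rightarrow> real) \<Rightarrow> nat \<Rightarrow> nat \<Rightarrow> bool" where
  "precedes a i j \<longleftrightarrow> a i < a j \<or> a i = a j \<and> i < j"

definition index_rank :: "(nat \<Rightarrow> real) \<Rightarrow> nat \<Rightarrow> nat" where
  "index_rank a j = card {i. precedes a i j}"

definition locally_finite :: "(nat \<Rightarrow> real) \<Rightarrow> bool" where
  "locally_finite a \<longleftrightarrow> (\<forall>m::nat. finite {i. a i \<le> real m})"

text \<open>It maps a position to the index found there. The identity as default keeps it a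
  bijection, measurable in \<open>a\<close>, even for sequences that cannot be sorted.\<close>

definition sorting :: "(nat \<Rightarrow> real) \<Rightarrow> nat \<Rightarrow> nat" where
  "sorting a = (if locally_finite a then inv (index_rank a) else id)"

lemma locally_finiteD: 
  assumes "locally_finite a" shows "finite {i. a i \<le> z}"
proof -
  obtain m :: nat where "z \<le> real m" using real_arch_simple by blast
  then have "{i. a i \<le> z} \<subseteq> {i. a i \<le> real m}" by auto
  then show ?thesis using assms finite_subset unfolding locally_finite_def by blast
qed

lemma precedes_trans: "precedes a i j \<Longrightarrow> precedes a j k \<Longrightarrow> precedes a i k"
  by (auto simp: precedes_def)

lemma finite_precedes: "locally_finite a \<Longrightarrow> finite {i. precedes a i j}"
  by (rule finite_subset[OF _ locally_finiteD[of a "a j"]]) (auto simp: precedes_def)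

lemma index_rank_less: 
  assumes "locally_finite a" "precedes a i j" shows "index_rank a i < index_rank a j"
  unfolding index_rank_def 
proof (rule psubset_card_mono[OF finite_precedes[OF assms(1)]])
  show "{i'. precedes a i' i} \<subset> {i. precedes a i j}"
    using precedes_trans[of a _ i j] assms(2) by (auto simp: precedes_def)
qed

lemma index_rank_less_iff: 
  assumes "locally_finite a" shows "index_rank a i < index_rank a j \<longleftrightarrow> precedes a i j"
proof -
  have "i = j \<or> precedes a i j \<or> precedes a j i" by (auto simp: precedes_def)
  then show ?thesis using index_rank_less[OF assms, of i j] index_rank_less[OF assms, of j i] by auto
qed

lemma inj_index_rank: 
  assumes "locally_finite a" shows "inj (index_rank a)"
proof (rule injI)
  fix i j assume "index_rank a i = index_rank a j"
  then have "\<not> precedes a i j" "\<not> precedes a j i" using index_rank_less_iff[OF assms] by (metis less_irrefl)+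
  then show "i = j" by (auto simp: precedes_def)
qed

text \<open>The predecessors of \<open>j\<close> are mapped injectively into the numbers below the
  rank of \<open>j\<close>, and there are exactly that many, so every smaller rank occurs; ranks are
  unbounded because they are injective.\<close>

lemma bij_index_rank:
  assumes a: "locally_finite a" shows "bij (index_rank a)"
proof (rule bijI[OF inj_index_rank[OF a]])
  show "range (index_rank a) = UNIV"
  proof (rule set_eqI)
    fix k
    have "infinite (range (index_rank a))" using inj_index_rank[OF a] finite_imageD infinite_UNIV_nat by blast
    then obtain j where j: "k < index_rank a j" by (metis infinite_nat_iff_unbounded rangeE)
    have "index_rank a ` {i. precedes a i j} = {..<index_rank a j}"
    proof (rule card_subset_eq)
      show "card (index_rank a ` {i. precedes a i j}) = card {..<index_rank a j}"
        unfolding card_image[OF inj_on_subset[OF inj_index_rank[OF a] subset_UNIV]] by (simp add: index_rank_def)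
      show "index_rank a ` {i. precedes a i j} \<subseteq> {..<index_rank a j}"
        by (auto intro: index_rank_less[OF a])
    qed simp
    with j show "k \<in> range (index_rank a) \<longleftrightarrow> k \<in> UNIV" by blast
  qed
qed

lemma bij_sorting: "bij (sorting a)"
  by (auto simp: sorting_def bij_index_rank bij_imp_bij_inv)

lemma index_rank_sorting: "locally_finite a \<Longrightarrow> index_rank a (sorting a k) = k"
  by (simp add: sorting_def bij_index_rank bij_is_surj surj_f_inv_f)

lemma sorting_eq_iff: "sorting a k = j \<longleftrightarrow> (if locally_finite a then index_rank a j = k else j = k)"
  by (auto simp: sorting_def bij_index_rank bij_is_surj bij_is_inj surj_f_inv_f)

text \<open>Stability of the sorting. Enumerated points may coincide, and regions then decide by the
  index, so sorting must not exchange equal points.\<close>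

lemma sorting_le_iff:
  assumes a: "locally_finite a" and eq: "a (sorting a i) = a (sorting a j)"
  shows "sorting a i \<le> sorting a j \<longleftrightarrow> i \<le> j"
proof -
  have "i < j \<longleftrightarrow> sorting a i < sorting a j" if "a (sorting a i) = a (sorting a j)" for i j
    using index_rank_less_iff[OF a, of "sorting a i" "sorting a j"] that by (simp add: index_rank_sorting[OF a] precedes_def)
  from this[OF eq[symmetric]] show ?thesis by (simp add: not_less[symmetric])
qed

text \<open>This is how counts determine sorted values. Positions start at 0, so position
  \<open>k\<close> needs more than \<open>k\<close> values up to \<open>z\<close>.\<close>

lemma sorted_value_le_iff:
  assumes a: "locally_finite a" 
  shows "a (sorting a k) \<le> z \<longleftrightarrow> k < card {i. a i \<le> z}"
proof -
  let ?j = "sorting a k"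
  have fin: "finite {i. a i \<le> z}" by (rule locally_finiteD[OF a])
  have k: "card {i. precedes a i ?j} = k" using index_rank_sorting[OF a, of k] by (simp add: index_rank_def)
  show ?thesis
  proof
    assume le: "a ?j \<le> z"
    have "card {i. precedes a i ?j} < card {i. a i \<le> z}"
    proof (rule psubset_card_mono[OF fin])
      show "{i. precedes a i ?j} \<subset> {i. a i \<le> z}" using le by (auto simp: precedes_def)
    qed
    then show "k < card {i. a i \<le> z}" by (simp add: k)
  next
    assume lt: "k < card {i. a i \<le> z}"
    show "a ?j \<le> z"
    proof (rule ccontr)
      assume "\<not> a ?j \<le> z"
      then have "card {i. a i \<le> z} \<le> card {i. precedes a i ?j}"
        by (intro card_mono finite_precedes[OF a]) (auto simp: precedes_def)
      with lt show False by (simp add: k)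
    qed
  qed
qed

text \<open>Whether position \<open>k\<close> holds index \<open>j\<close> depends on the rank of
  \<open>j\<close> alone, so the inverse function causes no difficulty.\<close>

lemma sorting_measurable:
  assumes [measurable]: "\<And>i. (\<lambda>x. a x i) \<in> borel_measurable M"
  shows "(\<lambda>x. sorting (a x) k) \<in> M \<rightarrow>\<^sub>M count_space UNIV"
proof -
  have [measurable]: "Measurable.pred M (\<lambda>x. precedes (a x) i j)" for i j
    unfolding precedes_def by measurable
  have [measurable]: "(\<lambda>x. index_rank (a x) j) \<in> M \<rightarrow>\<^sub>M count_space UNIV" for j
    unfolding index_rank_def by (rule measurable_card) measurable
  have [measurable]: "Measurable.pred M (\<lambda>x. locally_finite (a x))"
    unfolding locally_finite_def by measurable
  have "Measurable.pred M (\<lambda>x. sorting (a x) k = j)" for j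
    unfolding sorting_eq_iff by measurable
  then show ?thesis
    by (intro measurable_count_space_eq2_countable[THEN iffD2]) (auto simp: pred_def vimage_def Int_def conj_commute)
qed

text \<open>The value at position k of the sorted sequence is the least q with more than k values below it.\<close>

definition sorted_from_counts :: "(rat \<Rightarrow> ennreal) \<Rightarrow> nat \<Rightarrow> real" where
  "sorted_from_counts c k = real_of_ereal (INF q. if of_nat (Suc k) \<le> c q then ereal (real_of_rat q) else \<infinity>)"

lemma sorted_from_counts_measurable:
  "sorted_from_counts \<in> PiM UNIV (\<lambda>_. borel) \<rightarrow>\<^sub>M PiM UNIV (\<lambda>_. borel)"
proof (rule measurable_PiM_single')
  fix k
  have [measurable]: "(\<lambda>c. c q) \<in> borel_measurable (PiM UNIV (\<lambda>_::rat. borel :: ennreal measure))" for q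
    by (rule measurable_component_singleton) simp
  show "(\<lambda>c. sorted_from_counts c k) \<in> PiM UNIV (\<lambda>_. borel) \<rightarrow>\<^sub>M borel"
    unfolding sorted_from_counts_def by measurable
qed auto

lemma sorted_from_counts_eq:
  assumes a: "locally_finite a"
  shows "sorted_from_counts (\<lambda>q. \<Sum>i. indicator {..real_of_rat q} (a i)) k = a (sorting a k)"
proof -
  let ?v = "a (sorting a k)"
  have c: "(\<Sum>i. indicator {..z} (a i)) = (of_nat (card {i. a i \<le> z}) :: ennreal)" for z :: real
  proof -
    have "(\<Sum>i. indicator {..z} (a i)) = (\<Sum>i\<in>{i. a i \<le> z}. indicator {..z} (a i) :: ennreal)"
      by (rule suminf_finite[OF locally_finiteD[OF a]]) auto
    also have "\<dots> = (\<Sum>i\<in>{i. a i \<le> z}. 1)" by (rule sum.cong) auto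
    finally show ?thesis by simp
  qed
  have le: "of_nat (Suc k) \<le> (\<Sum>i. indicator {..z} (a i) :: ennreal) \<longleftrightarrow> ?v \<le> z" for z :: real
    unfolding c sorted_value_le_iff[OF a] of_nat_le_iff by auto
  have "(INF q. if ?v \<le> real_of_rat q then ereal (real_of_rat q) else \<infinity>) = ereal ?v"
  proof (rule antisym)
    show "ereal ?v \<le> (INF q. if ?v \<le> real_of_rat q then ereal (real_of_rat q) else \<infinity>)"
      by (rule INF_greatest) auto
    show "(INF q. if ?v \<le> real_of_rat q then ereal (real_of_rat q) else \<infinity>) \<le> ereal ?v"
    proof (rule ereal_le_epsilon2)
      fix e :: real assume "0 < e"
      then obtain q where q: "?v < real_of_rat q" "real_of_rat q < ?v + e" using of_rat_dense[of ?v "?v + e"] by auto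
      have "(INF q. if ?v \<le> real_of_rat q then ereal (real_of_rat q) else \<infinity>) \<le> ereal (real_of_rat q)"
        by (rule INF_lower2[of q]) (use q in auto)
      also have "\<dots> \<le> ereal ?v + ereal e" using q by simp
      finally show "(INF q. if ?v \<le> real_of_rat q then ereal (real_of_rat q) else \<infinity>) \<le> ereal ?v + ereal e" .
    qed
  qed
  then show ?thesis unfolding sorted_from_counts_def le by simp
qed

section \<open>An injective key on \<open>\<real>\<^sup>n\<close>\<close>

text \<open>\<open>from_nat\<close> runs through all pairs of a coordinate and a rational bound;
  pairs whose coordinate is out of range contribute the whole space.\<close>

definition half_space :: "nat \<Rightarrow> nat \<Rightarrow> (nat \<Rightarrow> real) set" where
  "half_space n i = {x \<in> space (Rn n). case from_nat i of (l, q) \<Rightarrow> l \<in> {1..n} \<longrightarrow> x l \<le> real_of_rat q}"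

text \<open>A Cantor-type code: base 3 with digits 0 and 1 only. The tail after a digit is less than
  the unit of that digit, so the digits are unique, which base 2 would not ensure.\<close>

definition ternary :: "nat \<Rightarrow> (nat \<Rightarrow> real) \<Rightarrow> real" where
  "ternary n x = (\<Sum>i. (1/3) ^ Suc i * indicator (half_space n i) x)"

text \<open>The two parts serve different ends: the integer part bounds the 1-norm, so sublevel sets
  are bounded and contain finitely many points, while the fractional part identifies the
  vector.\<close>

definition key :: "nat \<Rightarrow> (nat \<Rightarrow> real) \<Rightarrow> real" where
  "key n x = of_int \<lceil>\<Sum>l\<in>{1..n}. \<bar>x l\<bar>\<rceil> + ternary n x"

lemma half_space_sets [measurable]: "half_space n i \<in> sets (Rn n)"
proof (cases "from_nat i :: nat \<times> rat")
  case (Pair l q)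
  have "{x \<in> space (Rn n). l \<in> {1..n} \<longrightarrow> x l \<le> real_of_rat q} \<in> sets (Rn n)"
    by (cases "l \<in> {1..n}") measurable
  then show ?thesis unfolding half_space_def Pair prod.case .
qed

lemma ternary_measurable [measurable]: "ternary n \<in> borel_measurable (Rn n)"
  unfolding ternary_def[abs_def] by measurable

lemma key_measurable [measurable]: "key n \<in> borel_measurable (Rn n)"
proof -
  have [measurable]: "(\<lambda>x. \<Sum>l\<in>{1..n}. \<bar>x l\<bar>) \<in> borel_measurable (Rn n)"
    by (intro borel_measurable_sum borel_measurable_abs) measurable
  show ?thesis unfolding key_def[abs_def] by measurable
qed

lemma summable_ternary: "summable (\<lambda>i. (1/3::real) ^ Suc i * indicator (B i) x)"
proof (rule summable_comparison_test')
  show "summable (\<lambda>i. (1/3::real) ^ i)" by (rule summable_geometric) simp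
  show "norm ((1/3::real) ^ Suc i * indicator (B i) x) \<le> (1/3) ^ i" for i
    by (auto simp: indicator_def field_simps)
qed

lemma ternary_tail:
  "0 \<le> (\<Sum>j. (1/3::real) ^ Suc (j + i) * indicator (B (j + i)) x)"
  "(\<Sum>j. (1/3::real) ^ Suc (j + i) * indicator (B (j + i)) x) \<le> (1/3) ^ i / 2"
proof -
  have s: "summable (\<lambda>j. (1/3::real) ^ Suc (j + i) * indicator (B (j + i)) x)"
    using summable_ignore_initial_segment[OF summable_ternary[of B x], of i] by simp
  show "0 \<le> (\<Sum>j. (1/3::real) ^ Suc (j + i) * indicator (B (j + i)) x)"
    by (rule suminf_nonneg[OF s]) simp
  have g: "(\<lambda>j. (1/3::real) ^ Suc i * (1/3) ^ j) sums ((1/3) ^ Suc i * (1 / (1 - 1/3)))"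
    by (intro sums_mult geometric_sums) simp
  have "(\<Sum>j. (1/3::real) ^ Suc (j + i) * indicator (B (j + i)) x) \<le> (\<Sum>j. (1/3::real) ^ Suc i * (1/3) ^ j)"
    by (rule suminf_le[OF _ s sums_summable[OF g]]) (auto simp: indicator_def power_add mult_ac)
  also have "\<dots> = (1/3) ^ i / 2" using sums_unique[OF g] by simp
  finally show "(\<Sum>j. (1/3::real) ^ Suc (j + i) * indicator (B (j + i)) x) \<le> (1/3) ^ i / 2" .
qed

lemma ternary_bounds: "0 \<le> ternary n x" "ternary n x < 1"
proof -
  have "0 \<le> ternary n x" "ternary n x \<le> 1 / 2"
    using ternary_tail[of 0 "half_space n" x] by (simp_all add: ternary_def)
  then show "0 \<le> ternary n x" "ternary n x < 1" by linarith+
qed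

lemma key_nonneg: "0 \<le> key n x"
proof -
  have "0 \<le> (\<Sum>l\<in>{1..n}. \<bar>x l\<bar>)" by (simp add: sum_nonneg)
  then have "0 \<le> real_of_int \<lceil>\<Sum>l\<in>{1..n}. \<bar>x l\<bar>\<rceil>" by linarith
  then show ?thesis using ternary_bounds(1)[of n x] by (simp add: key_def)
qed

lemma key_sublevel:
  assumes x: "x \<in> space (Rn n)" and le: "key n x \<le> real m"
  shows "x \<in> big_cube n m"
proof -
  have "(\<Sum>l\<in>{1..n}. \<bar>x l\<bar>) \<le> real_of_int \<lceil>\<Sum>l\<in>{1..n}. \<bar>x l\<bar>\<rceil>" by linarith
  also have "\<dots> \<le> key n x" using ternary_bounds(1)[of n x] by (simp add: key_def)
  also have "\<dots> \<le> real m" by fact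
  finally have m: "(\<Sum>l\<in>{1..n}. \<bar>x l\<bar>) \<le> real m" .
  have "\<bar>x l\<bar> \<le> real m" if "l \<in> {1..n}" for l
    using member_le_sum[of l "{1..n}" "\<lambda>l. \<bar>x l\<bar>"] that m by auto
  then show "x \<in> big_cube n m" using x by (auto simp: big_cube_def space_PiM PiE_iff abs_le_iff minus_le_iff)
qed

text \<open>After removing the digits before \<open>i\<close>, what remains is digit
  \<open>i\<close> plus a tail of at most half its unit. This reads the digits off one by one from
  the number.\<close>

lemma half_space_iff_ternary:
  assumes "x \<in> space (Rn n)"
  shows "x \<in> half_space n i \<longleftrightarrow> (1/3) ^ Suc i \<le> ternary n x - (\<Sum>j<i. (1/3) ^ Suc j * indicator (half_space n j) x)"
proof -
  let ?t = "\<lambda>j. (1/3::real) ^ Suc j * indicator (half_space n j) x"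
  have "ternary n x = (\<Sum>j. ?t (j + Suc i)) + (\<Sum>j<Suc i. ?t j)"
    unfolding ternary_def by (rule suminf_split_initial_segment[OF summable_ternary])
  then have eq: "ternary n x - (\<Sum>j<i. ?t j) = (\<Sum>j. ?t (j + Suc i)) + ?t i" by simp
  have "0 \<le> (\<Sum>j. ?t (j + Suc i))" "(\<Sum>j. ?t (j + Suc i)) \<le> (1/3) ^ Suc i / 2"
    by (rule ternary_tail)+
  moreover have "(0::real) < (1/3) ^ Suc i" by simp
  ultimately have "0 \<le> (\<Sum>j. ?t (j + Suc i))" "(\<Sum>j. ?t (j + Suc i)) < (1/3) ^ Suc i" by linarith+
  then show ?thesis unfolding eq by (cases "x \<in> half_space n i") auto
qed

text \<open>The digits of the key recover all rational half spaces, so the key generates the Borel sets.\<close>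

lemma sets_Rn_eq_key_vimage:
  assumes E: "E \<in> sets (Rn n)"
  shows "\<exists>F\<in>sets borel. E = key n -` F \<inter> space (Rn n)"
proof -
  define V where "V = vimage_algebra (space (Rn n)) (key n) (borel :: real measure)"
  have sp: "space V = space (Rn n)" by (simp add: V_def)
  have k[measurable]: "key n \<in> borel_measurable V" unfolding V_def by (rule measurable_vimage_algebra1) simp
  have tern: "ternary n x = key n x - of_int \<lfloor>key n x\<rfloor>" for x
  proof -
    have "\<lfloor>key n x\<rfloor> = \<lceil>\<Sum>l\<in>{1..n}. \<bar>x l\<bar>\<rceil>"
      unfolding floor_eq_iff using ternary_bounds[of n x] by (simp add: key_def)
    then show ?thesis by (simp add: key_def)
  qed
  have [measurable]: "ternary n \<in> borel_measurable V" unfolding tern[abs_def] by measurable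
  have half[measurable]: "half_space n i \<in> sets V" for i
  proof (induction i rule: less_induct)
    case (less i)
    then have [measurable]: "\<And>j. j < i \<Longrightarrow> half_space n j \<in> sets V" by auto
    have [measurable]: "(\<lambda>x. \<Sum>j<i. (1/3::real) ^ Suc j * indicator (half_space n j) x) \<in> borel_measurable V"
      by (intro borel_measurable_sum borel_measurable_times borel_measurable_const borel_measurable_indicator less) simp
    have "half_space n i = {x \<in> space V. (1/3) ^ Suc i \<le> ternary n x - (\<Sum>j<i. (1/3) ^ Suc j * indicator (half_space n j) x)}"
      unfolding sp using half_space_iff_ternary[of _ n i] sets.sets_into_space[OF half_space_sets[of n i]] by blast
    also have "\<dots> \<in> sets V" by measurable
    finally show ?case .
  qed
  have "(\<lambda>x. x) \<in> V \<rightarrow>\<^sub>M Rn n"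
  proof (rule measurable_PiM_single')
    fix l assume l: "l \<in> {1..n}"
    have [measurable]: "{x \<in> space V. x l \<le> real_of_rat q} \<in> sets V" for q
    proof -
      have "half_space n (to_nat (l, q)) = {x \<in> space V. x l \<le> real_of_rat q}"
        unfolding half_space_def sp from_nat_to_nat prod.case using l by blast
      then show ?thesis using half[of "to_nat (l, q)"] by simp
    qed
    have "(\<lambda>x. x l) \<in> borel_measurable V"
    proof (rule borel_measurableI_le)
      fix y :: real
      have "x l \<le> y \<longleftrightarrow> (\<forall>q. y \<le> real_of_rat q \<longrightarrow> x l \<le> real_of_rat q)" for x :: "nat \<Rightarrow> real"
      proof (intro iffI allI impI)
        assume *: "\<forall>q. y \<le> real_of_rat q \<longrightarrow> x l \<le> real_of_rat q"
        show "x l \<le> y"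
        proof (rule ccontr)
          assume "\<not> x l \<le> y"
          then obtain q where "y < real_of_rat q" "real_of_rat q < x l" using of_rat_dense[of y "x l"] by auto
          with * show False by (metis less_imp_le not_less)
        qed
      qed auto
      then have "{x \<in> space V. x l \<le> y} = {x \<in> space V. \<forall>q. y \<le> real_of_rat q \<longrightarrow> x l \<le> real_of_rat q}" by blast
      also have "\<dots> \<in> sets V" by measurable
      finally show "{x \<in> space V. x l \<le> y} \<in> sets V" .
    qed
    then show "(\<lambda>x. x l) \<in> V \<rightarrow>\<^sub>M lborel" by simp
  qed (auto simp: sp space_PiM)
  from measurable_sets[OF this E] have "E \<in> sets V"
    using sets.sets_into_space[OF E] by (simp add: sp Int_absorb2)
  then show ?thesis unfolding V_def by (subst (asm) sets_vimage_algebra2) auto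
qed

text \<open>A preimage under \<open>key n\<close> cannot separate vectors with equal key, yet the
  sets fixing one coordinate are such preimages.\<close>

lemma key_inj:
  assumes x: "x \<in> space (Rn n)" and y: "y \<in> space (Rn n)" and eq: "key n x = key n y"
  shows "x = y"
proof -
  have "y l = x l" if l: "l \<in> {1..n}" for l
  proof -
    have "(\<lambda>z. z l) \<in> Rn n \<rightarrow>\<^sub>M lborel" using l by (rule measurable_component_singleton)
    then have "{z \<in> space (Rn n). z l = x l} \<in> sets (Rn n)" by measurable
    then obtain F where "{z \<in> space (Rn n). z l = x l} = key n -` F \<inter> space (Rn n)"
      using sets_Rn_eq_key_vimage by blast
    then show ?thesis using x y eq by (metis (mono_tags, lifting) IntI Int_iff mem_Collect_eq vimage_eq)
  qed
  then show ?thesis using x y by (auto simp: space_PiM intro!: PiE_ext[of x "{1..n}" "\<lambda>_. UNIV" y])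
qed

section \<open>Sequences of points, sorted by key\<close>

abbreviation point_seqs :: "nat \<Rightarrow> (nat \<Rightarrow> nat \<Rightarrow> real) measure" where
  "point_seqs n \<equiv> PiM UNIV (\<lambda>_. Rn n)"

definition point_order :: "nat \<Rightarrow> (nat \<Rightarrow> nat \<Rightarrow> real) \<Rightarrow> nat \<Rightarrow> nat" where
  "point_order n t = sorting (\<lambda>k. key n (t k))"

definition sorted_points :: "nat \<Rightarrow> (nat \<Rightarrow> nat \<Rightarrow> real) \<Rightarrow> nat \<Rightarrow> nat \<Rightarrow> real" where
  "sorted_points n t k = t (point_order n t k)"

lemma component_measurable [measurable]: "(\<lambda>t. t k) \<in> point_seqs n \<rightarrow>\<^sub>M Rn n"
  by (rule measurable_component_singleton) simp

lemma point_order_measurable [measurable]: "(\<lambda>t. point_order n t k) \<in> point_seqs n \<rightarrow>\<^sub>M count_space UNIV"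
  unfolding point_order_def by (rule sorting_measurable) measurable

lemma measurable_point_seqsI:
  assumes "\<And>k. (\<lambda>x. f x k) \<in> N \<rightarrow>\<^sub>M Rn n"
  shows "f \<in> N \<rightarrow>\<^sub>M point_seqs n"
proof -
  have "(\<lambda>x k. f x k) \<in> N \<rightarrow>\<^sub>M point_seqs n"
  proof (rule measurable_PiM_single')
    show "(\<lambda>x k. f x k) \<in> space N \<rightarrow> (\<Pi>\<^sub>E k\<in>UNIV. space (Rn n))"
      unfolding PiE_UNIV_domain by (intro Pi_I measurable_space[OF assms])
  qed (rule assms)
  then show ?thesis by simp
qed

lemma sorted_points_measurable [measurable]: "sorted_points n \<in> point_seqs n \<rightarrow>\<^sub>M point_seqs n"
proof (rule measurable_point_seqsI)
  show "(\<lambda>t. sorted_points n t k) \<in> point_seqs n \<rightarrow>\<^sub>M Rn n" for k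
    unfolding sorted_points_def
    by (rule measurable_compose_countable[of "\<lambda>i t. t i", OF component_measurable point_order_measurable])
qed

text \<open>Laws of point sequences can thus be compared through the laws of their keys, without a
  measurable inverse of \<open>key\<close>.\<close>

lemma sets_point_seqs_eq_key_vimage:
  assumes E: "E \<in> sets (point_seqs n)"
  shows "\<exists>F\<in>sets (PiM UNIV (\<lambda>_. borel)). E = (\<lambda>t k. key n (t k)) -` F \<inter> space (point_seqs n)"
proof -
  let ?K = "\<lambda>t (k::nat). key n (t k)"
  define V where "V = vimage_algebra (space (point_seqs n)) ?K (PiM UNIV (\<lambda>_. borel :: real measure))"
  have sp: "space V = space (point_seqs n)" by (simp add: V_def)
  have K: "?K \<in> V \<rightarrow>\<^sub>M PiM UNIV (\<lambda>_. borel)" unfolding V_def by (rule measurable_vimage_algebra1) (simp add: space_PiM)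
  have "(\<lambda>t. t) \<in> V \<rightarrow>\<^sub>M point_seqs n"
  proof (rule measurable_point_seqsI, rule measurableI)
    fix k t assume "t \<in> space V" then show "t k \<in> space (Rn n)" by (auto simp: sp space_PiM)
  next
    fix k B assume "B \<in> sets (Rn n)"
    then obtain F where F: "F \<in> sets borel" "B = key n -` F \<inter> space (Rn n)" using sets_Rn_eq_key_vimage by blast
    have "(\<lambda>t. ?K t k) \<in> V \<rightarrow>\<^sub>M borel"
      by (rule measurable_compose[OF K measurable_component_singleton]) simp
    from measurable_sets[OF this F(1)] show "(\<lambda>t. t k) -` B \<inter> space V \<in> sets V"
      by (rule back_subst[of "\<lambda>S. S \<in> sets V"]) (auto simp: F(2) sp space_PiM)
  qed
  from measurable_sets[OF this E] have "E \<in> sets V"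
    using sets.sets_into_space[OF E] by (simp add: sp Int_absorb2)
  then show ?thesis unfolding V_def by (subst (asm) sets_vimage_algebra2) (auto simp: space_PiM)
qed

lemma key_seq_measurable: "(\<lambda>t k. key n (t k)) \<in> point_seqs n \<rightarrow>\<^sub>M PiM UNIV (\<lambda>_. borel)"
  by (rule measurable_PiM_single') (auto intro: measurable_compose[OF component_measurable key_measurable])

context poisson_points
begin

lemma points_measurable [measurable]: "(\<lambda>\<omega> k. T k \<omega>) \<in> M \<rightarrow>\<^sub>M point_seqs n"
  by (rule measurable_point_seqsI) measurable

lemma AE_locally_finite_key: "AE \<omega> in M. locally_finite (\<lambda>k. key n (T k \<omega>))"
  using AE_locally_finite AE_space
proof eventually_elim
  case (elim \<omega>)
  have "finite {k. key n (T k \<omega>) \<le> real m}" for m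
    by (rule finite_subset[of _ "{k. T k \<omega> \<in> big_cube n m}"])
      (use elim measurable_space[OF T_measurable] key_sublevel in auto)
  then show ?case by (simp add: locally_finite_def)
qed

text \<open>Almost surely the keys tend to infinity, and then the sorted keys are a function of the
  counts of sublevel sets, whose law the Poisson hypotheses determine.\<close>

lemma distr_sorted_keys:
  "distr M (PiM UNIV (\<lambda>_. borel)) (\<lambda>\<omega> k. key n (sorted_points n (\<lambda>k. T k \<omega>) k)) =
   distr (distr M (PiM UNIV (\<lambda>_. borel)) (\<lambda>\<omega> q. point_count T {x \<in> space (Rn n). key n x \<le> real_of_rat q} \<omega>)) 
     (PiM UNIV (\<lambda>_. borel)) sorted_from_counts"
proof -
  let ?c = "\<lambda>\<omega> q. point_count T {x \<in> space (Rn n). key n x \<le> real_of_rat q} \<omega>"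
  have L: "{x \<in> space (Rn n). key n x \<le> real_of_rat q} \<in> sets (Rn n)" for q by measurable
  have c: "?c \<in> M \<rightarrow>\<^sub>M PiM UNIV (\<lambda>_. borel)"
    by (rule measurable_PiM_single') (auto intro: count_measurable L)
  have k: "(\<lambda>\<omega> k. key n (sorted_points n (\<lambda>k. T k \<omega>) k)) \<in> M \<rightarrow>\<^sub>M PiM UNIV (\<lambda>_. borel)"
    by (rule measurable_compose[OF measurable_compose[OF points_measurable sorted_points_measurable] key_seq_measurable])
  have "AE \<omega> in M. (\<lambda>k. key n (sorted_points n (\<lambda>k. T k \<omega>) k)) = sorted_from_counts (?c \<omega>)"
    using AE_locally_finite_key AE_space
  proof eventually_elim
    case (elim \<omega>)
    have "?c \<omega> = (\<lambda>q. \<Sum>i. indicator {..real_of_rat q} (key n (T i \<omega>)))"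
      using measurable_space[OF T_measurable elim(2)] 
      by (auto simp: point_count_def indicator_def fun_eq_iff intro!: suminf_cong)
    then show ?case
      by (simp add: fun_eq_iff sorted_from_counts_eq[OF elim(1)] sorted_points_def point_order_def)
  qed
  then have "distr M (PiM UNIV (\<lambda>_. borel)) (\<lambda>\<omega> k. key n (sorted_points n (\<lambda>k. T k \<omega>) k)) = 
     distr M (PiM UNIV (\<lambda>_. borel)) (\<lambda>\<omega>. sorted_from_counts (?c \<omega>))"
    by (intro distr_cong_AE refl k measurable_compose[OF c sorted_from_counts_measurable])
  then show ?thesis by (simp add: distr_distr[OF sorted_from_counts_measurable c] comp_def)
qed

text \<open>The counts along the chain of sublevel sets have the same law for both processes, hence
  so do the sorted keys, and the keys generate all events. It is used with the translated points as
  second process; no such statement is available for the unsorted sequences.\<close>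

lemma distr_sorted_points:
  assumes P': "poisson_points M' n lam T'"
  shows "distr M (point_seqs n) (\<lambda>\<omega>. sorted_points n (\<lambda>k. T k \<omega>)) = distr M' (point_seqs n) (\<lambda>\<omega>. sorted_points n (\<lambda>k. T' k \<omega>))"
proof -
  interpret M': poisson_points M' n lam T' by fact
  let ?L = "\<lambda>q. {x \<in> space (Rn n). key n x \<le> real_of_rat q}"
  have fin: "emeasure (Rn n) (?L q) < \<infinity>" for q
  proof -
    obtain m :: nat where m: "real_of_rat q \<le> real m" using real_arch_simple by blast
    have "?L q \<subseteq> big_cube n m" using m key_sublevel[of _ n m] by auto
    then have "emeasure (Rn n) (?L q) \<le> emeasure (Rn n) (big_cube n m)" by (rule emeasure_mono) measurable
    then show ?thesis using emeasure_big_cube[of n m] by simp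
  qed
  have cnt: "distr M (PiM UNIV (\<lambda>_. borel)) (\<lambda>\<omega> q. point_count T (?L q) \<omega>) = distr M' (PiM UNIV (\<lambda>_. borel)) (\<lambda>\<omega> q. point_count T' (?L q) \<omega>)"
  proof (rule distr_counts_chain[OF P' _ fin])
    fix q r :: rat assume "q \<le> r"
    then have "real_of_rat q \<le> real_of_rat r" by (simp add: of_rat_less_eq)
    then show "?L q \<subseteq> ?L r" by auto
  qed measurable
  have keys: "distr M (PiM UNIV (\<lambda>_. borel)) (\<lambda>\<omega> k. key n (sorted_points n (\<lambda>k. T k \<omega>) k)) =
    distr M' (PiM UNIV (\<lambda>_. borel)) (\<lambda>\<omega> k. key n (sorted_points n (\<lambda>k. T' k \<omega>) k))"
    unfolding distr_sorted_keys M'.distr_sorted_keys cnt ..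
  have m: "(\<lambda>\<omega>. sorted_points n (\<lambda>k. T k \<omega>)) \<in> M \<rightarrow>\<^sub>M point_seqs n" "(\<lambda>\<omega>. sorted_points n (\<lambda>k. T' k \<omega>)) \<in> M' \<rightarrow>\<^sub>M point_seqs n"
    by measurable
  show ?thesis
  proof (rule measure_eqI)
    fix E assume "E \<in> sets (distr M (point_seqs n) (\<lambda>\<omega>. sorted_points n (\<lambda>k. T k \<omega>)))"
    then have E: "E \<in> sets (point_seqs n)" by simp
    then obtain F where F: "F \<in> sets (PiM UNIV (\<lambda>_. borel))" and EF: "E = (\<lambda>t k. key n (t k)) -` F \<inter> space (point_seqs n)"
      using sets_point_seqs_eq_key_vimage by blast
    have ev: "X -` E \<inter> space N = (\<lambda>\<omega> k. key n (X \<omega> k)) -` F \<inter> space N" if "X \<in> N \<rightarrow>\<^sub>M point_seqs n" for X and N :: "'x measure"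
      using measurable_space[OF that] by (auto simp: EF)
    show "emeasure (distr M (point_seqs n) (\<lambda>\<omega>. sorted_points n (\<lambda>k. T k \<omega>))) E = emeasure (distr M' (point_seqs n) (\<lambda>\<omega>. sorted_points n (\<lambda>k. T' k \<omega>))) E"
      unfolding emeasure_distr[OF m(1) E] emeasure_distr[OF m(2) E] ev[OF m(1)] ev[OF m(2)]
        emeasure_distr[OF measurable_compose[OF m(1) key_seq_measurable] F, symmetric]
        emeasure_distr[OF measurable_compose[OF m(2) key_seq_measurable] F, symmetric] keys ..
  qed simp
qed

end

section \<open>Decoding regions\<close>

definition vsub :: "nat \<Rightarrow> (nat \<Rightarrow> real) \<Rightarrow> (nat \<Rightarrow> real) \<Rightarrow> (nat \<Rightarrow> real)" where
  "vsub n x y = (\<lambda>l\<in>{1..n}. x l - y l)"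

lemma vadd_space: "vadd n x y \<in> space (Rn n)" by (simp add: vadd_def space_PiM)

lemma vsub_space: "vsub n x y \<in> space (Rn n)" by (simp add: vsub_def space_PiM)

lemma vadd_measurable [measurable (raw)]:
  assumes "f \<in> N \<rightarrow>\<^sub>M Rn n" "g \<in> N \<rightarrow>\<^sub>M Rn n"
  shows "(\<lambda>x. vadd n (f x) (g x)) \<in> N \<rightarrow>\<^sub>M Rn n"
  unfolding vadd_def
proof (rule measurable_restrict)
  fix l assume "l \<in> {1..n}"
  then have "(\<lambda>x. x l) \<in> Rn n \<rightarrow>\<^sub>M lborel" by (rule measurable_component_singleton)
  from measurable_compose[OF assms(1) this] measurable_compose[OF assms(2) this]
  show "(\<lambda>x. f x l + g x l) \<in> N \<rightarrow>\<^sub>M lborel" by simp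
qed

lemma vsub_measurable [measurable (raw)]:
  assumes "f \<in> N \<rightarrow>\<^sub>M Rn n" "g \<in> N \<rightarrow>\<^sub>M Rn n"
  shows "(\<lambda>x. vsub n (f x) (g x)) \<in> N \<rightarrow>\<^sub>M Rn n"
  unfolding vsub_def
proof (rule measurable_restrict)
  fix l assume "l \<in> {1..n}"
  then have "(\<lambda>x. x l) \<in> Rn n \<rightarrow>\<^sub>M lborel" by (rule measurable_component_singleton)
  from measurable_compose[OF assms(1) this] measurable_compose[OF assms(2) this]
  show "(\<lambda>x. f x l - g x l) \<in> N \<rightarrow>\<^sub>M lborel" by simp
qed

lemma vsub_translate: "vsub n (vadd n z x) (vadd n z y) = vsub n x y"
  by (auto simp: vsub_def vadd_def fun_eq_iff)

lemma vadd_assoc: "vadd n (vadd n x y) z = vadd n x (vadd n y z)"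
  by (auto simp: vadd_def fun_eq_iff)

lemma Rn_ext: "x \<in> space (Rn n) \<Longrightarrow> y \<in> space (Rn n) \<Longrightarrow> (\<And>l. l \<in> {1..n} \<Longrightarrow> x l = y l) \<Longrightarrow> x = y"
  by (rule PiE_ext[of x "{1..n}" "\<lambda>_. UNIV" y]) (auto simp: space_PiM)

lemma vsub_right_inj:
  assumes "x \<in> space (Rn n)" "x' \<in> space (Rn n)" "vsub n x y = vsub n x' y"
  shows "x = x'"
proof (rule Rn_ext[OF assms(1,2)])
  fix l assume "l \<in> {1..n}"
  then show "x l = x' l" using fun_cong[OF assms(3), of l] by (simp add: vsub_def)
qed

lemma vsub_vadd_cancel: "d \<in> space (Rn n) \<Longrightarrow> vsub n (vadd n x d) x = d"
  by (rule Rn_ext[OF vsub_space]) (auto simp: vsub_def vadd_def)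

text \<open>A location y is decoded to the point x of least site key; points from which y is a typical
  displacement come before all others.\<close>

definition site_key :: "nat \<Rightarrow> (nat \<Rightarrow> real) set \<Rightarrow> (nat \<Rightarrow> real) \<Rightarrow> (nat \<Rightarrow> real) \<Rightarrow> real" where
  "site_key n A y x = (if vsub n y x \<in> A then key n (vsub n x y) / (1 + key n (vsub n x y)) else 1 + key n (vsub n x y))"

text \<open>Using \<open>precedes\<close> gives a location to the least index among coinciding
  points, so regions are disjoint for every sequence without exception.\<close>

definition region :: "nat \<Rightarrow> (nat \<Rightarrow> real) set \<Rightarrow> (nat \<Rightarrow> nat \<Rightarrow> real) \<Rightarrow> nat \<Rightarrow> (nat \<Rightarrow> real) set" where
  "region n A t k = {y \<in> space (Rn n). \<forall>j. \<not> precedes (\<lambda>i. site_key n A y (t i)) j k}"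

lemma site_key_translate: "site_key n A (vadd n z y) (vadd n z x) = site_key n A y x"
  by (simp add: site_key_def vsub_translate)

lemma key_quotient_less_1: "key n x / (1 + key n x) < 1"
  using key_nonneg[of n x] by (simp add: divide_less_eq)

text \<open>The increasing map \<open>u / (1 + u)\<close> squeezes the keys of typical points into
  \<open>[0, 1)\<close>, while the other points are moved to values from 1 on.\<close>

lemma site_key_less_1_iff: "site_key n A y x < 1 \<longleftrightarrow> vsub n y x \<in> A"
  using key_quotient_less_1[of n "vsub n x y"] key_nonneg[of n "vsub n x y"] by (simp add: site_key_def)

lemma key_quotient_le_iff: "key n x / (1 + key n x) \<le> key n y / (1 + key n y) \<longleftrightarrow> key n x \<le> key n y"
proof -
  have "0 < 1 + key n x" "0 < 1 + key n y" using key_nonneg[of n x] key_nonneg[of n y] by auto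
  then have "key n x / (1 + key n x) \<le> key n y / (1 + key n y) \<longleftrightarrow> key n x * (1 + key n y) \<le> key n y * (1 + key n x)"
    by (simp only: pos_divide_le_eq times_divide_eq_left pos_le_divide_eq)
  then show ?thesis by (simp add: algebra_simps)
qed

text \<open>The case excluded by the second assumption is \<open>x\<close> typical and
  \<open>x'\<close> not, where \<open>x\<close> wins whatever the keys are.\<close>

lemma site_key_le_imp:
  assumes "site_key n A y x \<le> site_key n A y x'" "vsub n y x' \<in> A \<or> vsub n y x \<notin> A"
  shows "key n (vsub n x y) \<le> key n (vsub n x' y)"
proof (cases "vsub n y x' \<in> A")
  case True
  then have "vsub n y x \<in> A" using assms(1) site_key_less_1_iff[of n A y x] site_key_less_1_iff[of n A y x'] by linarith
  then show ?thesis using assms(1) True by (simp add: site_key_def key_quotient_le_iff)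
next
  case False
  with assms show ?thesis by (simp add: site_key_def)
qed

lemma site_key_inj:
  assumes "x \<in> space (Rn n)" "x' \<in> space (Rn n)" and eq: "site_key n A y x = site_key n A y x'"
  shows "x = x'"
proof -
  have iff: "vsub n y x \<in> A \<longleftrightarrow> vsub n y x' \<in> A" 
    using eq site_key_less_1_iff[of n A y x] site_key_less_1_iff[of n A y x'] by simp
  have "key n (vsub n x y) \<le> key n (vsub n x' y)" "key n (vsub n x' y) \<le> key n (vsub n x y)"
    using iff eq by (auto intro!: site_key_le_imp[of n A])
  then have "vsub n x y = vsub n x' y" by (intro key_inj[OF vsub_space vsub_space]) auto
  then show ?thesis by (rule vsub_right_inj[OF assms(1,2)])
qed

lemma site_key_measurable [measurable]:
  assumes [measurable]: "A \<in> sets (Rn n)"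
  shows "(\<lambda>(y, x). site_key n A y x) \<in> borel_measurable (Rn n \<Otimes>\<^sub>M Rn n)"
  unfolding site_key_def by measurable

text \<open>With point sequence and location both arbitrary measurable functions, it serves three
  times: for the regions seen from a point, for these as functions of the configuration, and for the
  graph required by independence.\<close>

lemma region_graph_measurable:
  assumes A[measurable]: "A \<in> sets (Rn n)" 
    and t[measurable]: "t \<in> N \<rightarrow>\<^sub>M point_seqs n" and y[measurable]: "y \<in> N \<rightarrow>\<^sub>M Rn n"
  shows "{w \<in> space N. y w \<in> region n A (t w) k} \<in> sets N"
proof -
  have s[measurable]: "(\<lambda>w. site_key n A (y w) (t w i)) \<in> borel_measurable N" for i
  proof -
    have [measurable]: "(\<lambda>w. t w i) \<in> N \<rightarrow>\<^sub>M Rn n" by (rule measurable_compose[OF t component_measurable])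
    have "(\<lambda>w. (y w, t w i)) \<in> N \<rightarrow>\<^sub>M Rn n \<Otimes>\<^sub>M Rn n" by measurable
    from measurable_compose[OF this site_key_measurable[OF A]] show ?thesis by simp
  qed
  have "{w \<in> space N. y w \<in> region n A (t w) k} = {w \<in> space N. \<forall>j. \<not> precedes (\<lambda>i. site_key n A (y w) (t w i)) j k}"
    using measurable_space[OF y] by (auto simp: region_def)
  also have "\<dots> \<in> sets N" unfolding precedes_def by measurable
  finally show ?thesis .
qed

lemma seen_region_measurable:
  assumes A: "A \<in> sets (Rn n)"
  shows "(\<lambda>t. seen_from n (t k) (region n A t k)) \<in> point_seqs n \<rightarrow>\<^sub>M region_space n"
  unfolding region_space_def
proof (rule measurable_measure_of)
  show "(\<lambda>x. {A \<in> sets (Rn n). x \<in> A}) ` space (Rn n) \<subseteq> Pow (sets (Rn n))" by auto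
  have seen: "seen_from n (t k) (region n A t k) \<in> sets (Rn n)" if t: "t \<in> space (point_seqs n)" for t
  proof -
    have [measurable]: "t k \<in> space (Rn n)" using measurable_space[OF component_measurable t] .
    show ?thesis unfolding seen_from_def using t by (intro region_graph_measurable[OF A]) measurable
  qed
  show "(\<lambda>t. seen_from n (t k) (region n A t k)) \<in> space (point_seqs n) \<rightarrow> sets (Rn n)"
    using seen by blast
  fix B assume "B \<in> (\<lambda>x. {A \<in> sets (Rn n). x \<in> A}) ` space (Rn n)"
  then obtain x where x: "x \<in> space (Rn n)" and B: "B = {A \<in> sets (Rn n). x \<in> A}" by blast
  have "(\<lambda>t. seen_from n (t k) (region n A t k)) -` B \<inter> space (point_seqs n) = 
    {t \<in> space (point_seqs n). vadd n (t k) x \<in> region n A t k}"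
    using seen x by (auto simp: B seen_from_def)
  also have "\<dots> \<in> sets (point_seqs n)" using x by (intro region_graph_measurable[OF A]) measurable
  finally show "(\<lambda>t. seen_from n (t k) (region n A t k)) -` B \<inter> space (point_seqs n) \<in> sets (point_seqs n)" .
qed

lemma seen_region_translate:
  "seen_from n (vadd n z (t k)) (region n A (\<lambda>k. vadd n z (t k)) k) = seen_from n (t k) (region n A t k)"
  by (simp add: seen_from_def region_def vadd_assoc site_key_translate vadd_space)

text \<open>Equal site keys mean equal points, whose order stable sorting preserves; so relabelling
  the points relabels the regions and changes nothing else.\<close>

lemma region_sorted_points:
  assumes lf: "locally_finite (\<lambda>k. key n (t k))" and t: "\<And>k. t k \<in> space (Rn n)"
  shows "region n A (sorted_points n t) k = region n A t (point_order n t k)"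
proof -
  let ?p = "point_order n t"
  have "precedes (\<lambda>i. site_key n A y (sorted_points n t i)) j k \<longleftrightarrow> precedes (\<lambda>i. site_key n A y (t i)) (?p j) (?p k)" for y j
  proof (cases "site_key n A y (t (?p j)) = site_key n A y (t (?p k))")
    case True
    then have "t (?p j) = t (?p k)" by (rule site_key_inj[OF t t])
    then have "?p k \<le> ?p j \<longleftrightarrow> k \<le> j" 
      unfolding point_order_def by (intro sorting_le_iff[OF lf]) simp
    then show ?thesis using True by (simp add: precedes_def sorted_points_def not_le[symmetric])
  next
    case False
    then show ?thesis by (simp add: precedes_def sorted_points_def)
  qed
  moreover have all: "(\<forall>j. Q (?p j)) \<longleftrightarrow> (\<forall>j. Q j)" for Q
    using bij_is_surj[OF bij_sorting[of "\<lambda>k. key n (t k)"]] unfolding point_order_def by (metis surjD)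
  ultimately have "y \<in> region n A (sorted_points n t) k \<longleftrightarrow> y \<in> region n A t (?p k)" for y
    using all[of "\<lambda>j. \<not> precedes (\<lambda>i. site_key n A y (t i)) j (?p k)"] by (simp add: region_def)
  then show ?thesis by blast
qed

lemma first_exists:
  assumes "finite {j. a j \<le> a i}"
  shows "\<exists>k. \<forall>j. \<not> precedes a j k"
proof -
  let ?F = "{j. a j \<le> a i}"
  define m where "m = Min (a ` ?F)"
  have m: "m \<in> a ` ?F" unfolding m_def using assms by (intro Min_in) auto
  have least: "m \<le> a j" for j
  proof (cases "a j \<le> a i")
    case True
    then show ?thesis unfolding m_def using assms by (intro Min_le) auto
  next
    case False
    have "m \<le> a i" using m by auto
    with False show ?thesis by simp
  qed
  define k where "k = (LEAST k. a k = m)"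
  have "\<exists>k. a k = m" using m by auto
  then have k: "a k = m" unfolding k_def by (rule LeastI_ex)
  have "a j \<noteq> m" if "j < k" for j using that unfolding k_def by (rule not_less_Least)
  then have "\<not> precedes a j k" for j
    using least[of j] unfolding precedes_def k by auto
  then show ?thesis by blast
qed

lemma region_cover:
  assumes t: "\<And>k. t k \<in> space (Rn n)" and fin: "\<And>m. finite {k. t k \<in> big_cube n m}" and y: "y \<in> space (Rn n)"
  shows "\<exists>k. y \<in> region n A t k"
proof -
  have "y \<in> (\<Union>m. big_cube n m)" using y by (simp add: UN_big_cube)
  then obtain m where m: "y \<in> big_cube n m" by blast
  have fin_key: "finite {k. key n (vsub n (t k) y) \<le> z}" for z
  proof -
    obtain m' :: nat where m': "z \<le> real m'" using real_arch_simple by blast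
    have "{k. key n (vsub n (t k) y) \<le> z} \<subseteq> {k. t k \<in> big_cube n (m + m')}"
    proof safe
      fix k assume "key n (vsub n (t k) y) \<le> z"
      then have v: "vsub n (t k) y \<in> big_cube n m'" using m' by (intro key_sublevel vsub_space) simp
      have "t k l \<in> {- real (m + m')..real (m + m')}" if l: "l \<in> {1..n}" for l
      proof -
        have "vsub n (t k) y l \<in> {- real m'..real m'}" using v l unfolding big_cube_def by (rule PiE_mem)
        moreover have "y l \<in> {- real m..real m}" using m l unfolding big_cube_def by (rule PiE_mem)
        ultimately show ?thesis using l by (simp add: vsub_def)
      qed
      then show "t k \<in> big_cube n (m + m')" using t[of k] unfolding big_cube_def by (auto simp: space_PiM PiE_iff)
    qed
    then show ?thesis by (rule finite_subset) (rule fin)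
  qed
  \<comment> \<open>Take a typical point if there is one, any point otherwise. In both cases a point
    with smaller or equal site key also has smaller or equal key, and only finitely many do.\<close>
  obtain i where i: "vsub n y (t i) \<in> A \<or> (\<forall>j. vsub n y (t j) \<notin> A)" by blast
  have "finite {j. site_key n A y (t j) \<le> site_key n A y (t i)}"
  proof (rule finite_subset[OF _ fin_key])
    show "{j. site_key n A y (t j) \<le> site_key n A y (t i)} \<subseteq> {k. key n (vsub n (t k) y) \<le> key n (vsub n (t i) y)}"
      using i site_key_le_imp[of n A y] by blast
  qed
  from first_exists[OF this] show ?thesis using y by (auto simp: region_def)
qed

lemma region_disjoint: "disjoint_family (region n A t)"
  by (auto simp: disjoint_family_on_def region_def precedes_def) (metis linorder_less_linear)+

text \<open>The true point, being typical, has site key below 1, so a competitor that precedes it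
  has one too and must be typical itself.\<close>

lemma region_error:
  assumes d: "d \<in> space (Rn n)" and dA: "d \<in> A" and nd: "vadd n (t k) d \<notin> region n A t k"
  shows "\<exists>j. j \<noteq> k \<and> vsub n (vadd n (t k) d) (t j) \<in> A"
proof -
  let ?y = "vadd n (t k) d"
  obtain j where j: "precedes (\<lambda>i. site_key n A ?y (t i)) j k" using nd by (auto simp: region_def vadd_space)
  have "site_key n A ?y (t k) < 1" unfolding site_key_less_1_iff vsub_vadd_cancel[OF d] by (rule dA)
  moreover have "site_key n A ?y (t j) \<le> site_key n A ?y (t k)" "j \<noteq> k" using j by (auto simp: precedes_def)
  ultimately have "site_key n A ?y (t j) < 1" by simp
  then show ?thesis using \<open>j \<noteq> k\<close> unfolding site_key_less_1_iff by blast
qed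

section \<open>Invariance of Lebesgue measure under translation and reflection\<close>

lemma distr_Rn_componentwise:
  assumes g: "\<And>l. l \<in> {1..n} \<Longrightarrow> distr lborel lborel (g l) = lborel" and m: "\<And>l. g l \<in> borel_measurable borel"
  shows "distr (Rn n) (Rn n) (\<lambda>x. \<lambda>l\<in>{1..n}. g l (x l)) = Rn n"
proof (rule lborel_prod.PiM_eqI)
  have meas: "(\<lambda>x. \<lambda>l\<in>{1..n}. g l (x l)) \<in> Rn n \<rightarrow>\<^sub>M Rn n"
  proof (rule measurable_restrict)
    fix l assume "l \<in> {1..n}"
    then have "(\<lambda>x. x l) \<in> Rn n \<rightarrow>\<^sub>M lborel" by (rule measurable_component_singleton)
    then show "(\<lambda>x. g l (x l)) \<in> Rn n \<rightarrow>\<^sub>M lborel" using measurable_compose[OF _ m[of l], of "\<lambda>x. x l" "Rn n"] by simp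
  qed
  fix A :: "nat \<Rightarrow> real set" assume A: "\<And>i. i \<in> {1..n} \<Longrightarrow> A i \<in> sets lborel"
  have "emeasure (distr (Rn n) (Rn n) (\<lambda>x. \<lambda>l\<in>{1..n}. g l (x l))) (Pi\<^sub>E {1..n} A) =
    emeasure (Rn n) ((\<lambda>x. \<lambda>l\<in>{1..n}. g l (x l)) -` (Pi\<^sub>E {1..n} A) \<inter> space (Rn n))"
    by (rule emeasure_distr[OF meas]) (intro sets_PiM_I_finite, use A in auto)
  also have "(\<lambda>x. \<lambda>l\<in>{1..n}. g l (x l)) -` (Pi\<^sub>E {1..n} A) \<inter> space (Rn n) = Pi\<^sub>E {1..n} (\<lambda>l. g l -` A l)"
    by (auto simp: space_PiM PiE_iff)
  also have "emeasure (Rn n) \<dots> = (\<Prod>l\<in>{1..n}. emeasure lborel (g l -` A l))"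
    using A measurable_sets[OF m] by (intro lborel_prod.emeasure_PiM) auto
  also have "\<dots> = (\<Prod>l\<in>{1..n}. emeasure lborel (A l))"
  proof (rule prod.cong[OF refl])
    fix l assume l: "l \<in> {1..n}"
    have "emeasure lborel (A l) = emeasure (distr lborel lborel (g l)) (A l)" by (simp only: g[OF l])
    also have "\<dots> = emeasure lborel (g l -` A l)" using A[OF l] m[of l] by (subst emeasure_distr) auto
    finally show "emeasure lborel (g l -` A l) = emeasure lborel (A l)" by simp
  qed
  finally show "emeasure (distr (Rn n) (Rn n) (\<lambda>x. \<lambda>l\<in>{1..n}. g l (x l))) (Pi\<^sub>E {1..n} A) = (\<Prod>l\<in>{1..n}. emeasure lborel (A l))" .
qed auto

lemma distr_Rn_vadd: "distr (Rn n) (Rn n) (vadd n z) = Rn n"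
proof -
  have "distr lborel lborel ((+) (z l)) = lborel" for l
    using lborel_distr_plus[of "z l"] by (simp cong: distr_cong)
  then show ?thesis using distr_Rn_componentwise[of n "\<lambda>l x. z l + x"] by (simp add: vadd_def[abs_def])
qed

lemma distr_Rn_vsub: "distr (Rn n) (Rn n) (vsub n z) = Rn n"
proof -
  have "distr lborel lborel (\<lambda>x. z l - x) = lborel" for l
  proof -
    have "distr (distr lborel borel uminus) borel ((+) (z l)) = lborel"
      by (simp add: lborel_distr_uminus lborel_distr_plus)
    then show ?thesis by (subst (asm) distr_distr) (simp_all add: comp_def cong: distr_cong)
  qed
  then show ?thesis using distr_Rn_componentwise[of n "\<lambda>l x. z l - x"] by (simp add: vsub_def[abs_def])
qed

section \<open>Stationarity of the marked process\<close>

lemma suminf_bij_ennreal: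
  fixes f :: "nat \<Rightarrow> ennreal"
  assumes "bij p" shows "(\<Sum>k. f (p k)) = (\<Sum>k. f k)"
  using nn_integral_bij_count_space[OF assms, of f] by (simp only: nn_integral_count_space_nat)

text \<open>Counting translated points in \<open>B\<close> is counting the original points in a
  preimage of \<open>B\<close>, which has the same volume; preimages of disjoint sets stay
  disjoint.\<close>

lemma poisson_points_translate:
  assumes "poisson_points M n lam T"
  shows "poisson_points M n lam (\<lambda>k \<omega>. vadd n z (T k \<omega>))"
proof -
  interpret poisson_points M n lam T by fact
  let ?T = "\<lambda>k \<omega>. vadd n z (T k \<omega>)"
  let ?S = "\<lambda>B. {x \<in> space (Rn n). vadd n z x \<in> B}"
  have zm[measurable]: "vadd n z \<in> Rn n \<rightarrow>\<^sub>M Rn n"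
  proof -
    have "vadd n (restrict z {1..n}) \<in> Rn n \<rightarrow>\<^sub>M Rn n" by (intro vadd_measurable measurable_const) (auto simp: space_PiM)
    moreover have "vadd n (restrict z {1..n}) = vadd n z" by (auto simp: vadd_def fun_eq_iff)
    ultimately show ?thesis by simp
  qed
  have S: "?S B \<in> sets (Rn n)" if "B \<in> sets (Rn n)" for B using that by measurable
  have vol: "emeasure (Rn n) (?S B) = emeasure (Rn n) B" if B: "B \<in> sets (Rn n)" for B
  proof -
    have "emeasure (Rn n) B = emeasure (distr (Rn n) (Rn n) (vadd n z)) B" by (simp only: distr_Rn_vadd)
    also have "\<dots> = emeasure (Rn n) (vadd n z -` B \<inter> space (Rn n))" by (rule emeasure_distr[OF zm B])
    also have "vadd n z -` B \<inter> space (Rn n) = ?S B" by auto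
    finally show ?thesis by simp
  qed
  have cnt: "point_count ?T B \<omega> = point_count T (?S B) \<omega>" if "\<omega> \<in> space M" for B \<omega>
    unfolding point_count_def using measurable_space[OF T_measurable that]
    by (intro suminf_cong) (auto simp: indicator_def)
  have "poisson_process n M lam ?T"
    unfolding poisson_process_def
  proof (intro conjI allI ballI impI)
    show "?T k \<in> M \<rightarrow>\<^sub>M Rn n" for k by (rule measurable_compose[OF T_measurable zm])
    fix B :: "(nat \<Rightarrow> real) set" and j :: nat assume B: "B \<in> sets (Rn n)" and fin: "emeasure (Rn n) B < \<infinity>"
    have ev: "{\<omega> \<in> space M. point_count ?T B \<omega> = of_nat j} = {\<omega> \<in> space M. point_count T (?S B) \<omega> = of_nat j}"
      using cnt by auto
    have "prob {\<omega> \<in> space M. point_count T (?S B) \<omega> = of_nat j} = 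
      (lam * measure (Rn n) (?S B)) ^ j / fact j * exp (- (lam * measure (Rn n) (?S B)))"
      using poisson[unfolded poisson_process_def, THEN conjunct2, THEN conjunct1, rule_format, OF S[OF B]] fin by (simp only: vol[OF B])
    then show "prob {\<omega> \<in> space M. point_count ?T B \<omega> = of_nat j} = 
      (lam * measure (Rn n) B) ^ j / fact j * exp (- (lam * measure (Rn n) B))"
      unfolding ev using vol[OF B] by (simp only: measure_def)
  next
    fix m :: nat and B :: "nat \<Rightarrow> (nat \<Rightarrow> real) set"
    assume B: "\<forall>i<m. B i \<in> sets (Rn n) \<and> emeasure (Rn n) (B i) < \<infinity>" and disj: "disjoint_family_on B {..<m}"
    have "indep_vars (\<lambda>_. borel) (\<lambda>i. point_count T (?S (B i))) {..<m}"
    proof (rule indep_counts)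
      show "disjoint_family_on (\<lambda>i. ?S (B i)) {..<m}" using disj unfolding disjoint_family_on_def by blast
    qed (use B in \<open>auto intro!: S simp: vol\<close>)
    moreover have "point_count ?T (B i) -` U \<inter> space M = point_count T (?S (B i)) -` U \<inter> space M" for i U
      using cnt[of _ "B i"] by auto
    moreover have "point_count ?T (B i) \<in> borel_measurable M" if "i < m" for i
      using B that by (intro point_count_measurable[OF measurable_compose[OF T_measurable zm]]) auto
    ultimately show "indep_vars (\<lambda>_. borel) (\<lambda>i. point_count ?T (B i)) {..<m}"
      unfolding indep_vars_def2 by simp
  qed
  then show ?thesis using lam_pos by unfold_locales
qed

text \<open>The mark counts as a function of the two sequences alone, so that their law is an image
  of the joint law of displacements and points.\<close>

definition marks :: "nat \<Rightarrow> (nat \<Rightarrow> real) set \<Rightarrow> (nat \<Rightarrow> ((nat \<Rightarrow> real) \<times> (nat \<Rightarrow> real) \<times> (nat \<Rightarrow> real) set) set) \<Rightarrow>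
    (nat \<Rightarrow> nat \<Rightarrow> real) \<times> (nat \<Rightarrow> nat \<Rightarrow> real) \<Rightarrow> nat \<Rightarrow> ennreal" where
  "marks n A E = (\<lambda>(d, t) i. \<Sum>k. indicator (E i) (t k, d k, seen_from n (t k) (region n A t k)))"

lemma marks_measurable:
  assumes A: "A \<in> sets (Rn n)" and E: "\<And>i. E i \<in> sets (Rn n \<Otimes>\<^sub>M (Rn n \<Otimes>\<^sub>M region_space n))"
  shows "marks n A E \<in> point_seqs n \<Otimes>\<^sub>M point_seqs n \<rightarrow>\<^sub>M PiM UNIV (\<lambda>_. borel)"
  unfolding marks_def case_prod_unfold
proof (rule measurable_PiM_single')
  fix i
  have [measurable]: "E i \<in> sets (Rn n \<Otimes>\<^sub>M (Rn n \<Otimes>\<^sub>M region_space n))" by (rule E)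
  have [measurable]: "(\<lambda>t. seen_from n (t k) (region n A t k)) \<in> point_seqs n \<rightarrow>\<^sub>M region_space n" for k
    by (rule seen_region_measurable[OF A])
  have "(\<lambda>p. (snd p k, fst p k, seen_from n (snd p k) (region n A (snd p) k))) \<in> 
    point_seqs n \<Otimes>\<^sub>M point_seqs n \<rightarrow>\<^sub>M Rn n \<Otimes>\<^sub>M (Rn n \<Otimes>\<^sub>M region_space n)" for k
    by (intro measurable_Pair measurable_compose[OF measurable_fst] measurable_compose[OF measurable_snd]
      component_measurable seen_region_measurable[OF A])
  then have "(\<lambda>p. indicator (E i) (snd p k, fst p k, seen_from n (snd p k) (region n A (snd p) k)) :: ennreal)
     \<in> borel_measurable (point_seqs n \<Otimes>\<^sub>M point_seqs n)" for k
    by (rule measurable_compose) measurable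
  then show "(\<lambda>p. \<Sum>k. indicator (E i) (snd p k, fst p k, seen_from n (snd p k) (region n A (snd p) k)) :: ennreal)
     \<in> borel_measurable (point_seqs n \<Otimes>\<^sub>M point_seqs n)"
    by (rule borel_measurable_suminf_order)
qed auto

definition sort_pair :: "nat \<Rightarrow> (nat \<Rightarrow> nat \<Rightarrow> real) \<times> (nat \<Rightarrow> nat \<Rightarrow> real) \<Rightarrow> (nat \<Rightarrow> nat \<Rightarrow> real) \<times> (nat \<Rightarrow> nat \<Rightarrow> real)" where
  "sort_pair n p = ((\<lambda>k. fst p (point_order n (snd p) k)), sorted_points n (snd p))"

lemma sort_pair_measurable [measurable]: "sort_pair n \<in> point_seqs n \<Otimes>\<^sub>M point_seqs n \<rightarrow>\<^sub>M point_seqs n \<Otimes>\<^sub>M point_seqs n"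
  unfolding sort_pair_def[abs_def]
proof (rule measurable_Pair)
  show "(\<lambda>p. sorted_points n (snd p)) \<in> point_seqs n \<Otimes>\<^sub>M point_seqs n \<rightarrow>\<^sub>M point_seqs n" by measurable
  show "(\<lambda>p k. fst p (point_order n (snd p) k)) \<in> point_seqs n \<Otimes>\<^sub>M point_seqs n \<rightarrow>\<^sub>M point_seqs n"
  proof (rule measurable_point_seqsI)
    fix k
    show "(\<lambda>p. fst p (point_order n (snd p) k)) \<in> point_seqs n \<Otimes>\<^sub>M point_seqs n \<rightarrow>\<^sub>M Rn n"
      by (rule measurable_compose_countable[of "\<lambda>i p. fst p i", OF measurable_compose[OF measurable_fst component_measurable]
        measurable_compose[OF measurable_snd point_order_measurable]])
  qed
qed

text \<open>Sorting permutes the terms of the series: each point takes its displacement and, by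
  \<open>region_sorted_points\<close>, its region along.\<close>

lemma marks_sort_pair:
  assumes lf: "locally_finite (\<lambda>k. key n (t k))" and t: "\<And>k. t k \<in> space (Rn n)"
  shows "marks n A E (sort_pair n (d, t)) = marks n A E (d, t)"
proof
  fix i
  let ?f = "\<lambda>k. indicator (E i) (t k, d k, seen_from n (t k) (region n A t k)) :: ennreal"
  have "marks n A E (sort_pair n (d, t)) i = (\<Sum>k. ?f (point_order n t k))"
    by (simp add: marks_def sort_pair_def region_sorted_points[OF lf t]) (simp add: sorted_points_def)
  also have "\<dots> = (\<Sum>k. ?f k)" unfolding point_order_def by (rule suminf_bij_ennreal[OF bij_sorting])
  finally show "marks n A E (sort_pair n (d, t)) i = marks n A E (d, t) i" by (simp add: marks_def)
qed

locale displaced_points = poisson_points M n lam T for M :: "'w measure" and n lam T +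
  fixes D :: "nat \<Rightarrow> 'w \<Rightarrow> nat \<Rightarrow> real" and Q :: "(nat \<Rightarrow> real) measure"
  assumes iid: "iid_displacements n M Q D" and indep: "displacements_indep_points n M T D"
begin

lemma D_measurable [measurable]: "D k \<in> M \<rightarrow>\<^sub>M Rn n"
  using iid unfolding iid_displacements_def indep_vars_def by blast

lemma Q_eq: "Q = distr M (Rn n) (D k)"
  using iid by (simp add: iid_displacements_def)

lemma prob_space_Q: "prob_space Q" unfolding Q_eq[of 0] by (rule prob_space_distr) measurable

lemma sets_Q: "sets Q = sets (Rn n)" by (simp add: Q_eq[of 0])

lemma displacements_measurable [measurable]: "(\<lambda>\<omega> k. D k \<omega>) \<in> M \<rightarrow>\<^sub>M point_seqs n"
  by (rule measurable_point_seqsI) measurable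

lemma distr_displacements: "distr M (point_seqs n) (\<lambda>\<omega> k. D k \<omega>) = PiM UNIV (\<lambda>_. Q)"
proof -
  have "distr M (point_seqs n) (\<lambda>\<omega>. \<lambda>k\<in>UNIV. D k \<omega>) = PiM UNIV (\<lambda>k. distr M (Rn n) (D k))"
    by (rule iffD1[OF indep_vars_iff_distr_eq_PiM']) (use iid in \<open>auto simp: iid_displacements_def\<close>)
  then show ?thesis by (simp only: restrict_UNIV Q_eq[symmetric])
qed

lemma distr_displacements_points:
  "distr M (point_seqs n \<Otimes>\<^sub>M point_seqs n) (\<lambda>\<omega>. (\<lambda>k. D k \<omega>, \<lambda>k. T k \<omega>)) =
   PiM UNIV (\<lambda>_. Q) \<Otimes>\<^sub>M distr M (point_seqs n) (\<lambda>\<omega> k. T k \<omega>)"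
  using indep unfolding displacements_indep_points_def indep_var_distribution_eq distr_displacements by simp

lemma prob_space_displacements: "prob_space (PiM UNIV (\<lambda>_::nat. Q))"
  by (intro prob_space_PiM prob_space_Q)

lemma sets_displacements: "sets (PiM UNIV (\<lambda>_::nat. Q)) = sets (point_seqs n)"
  by (intro sets_PiM_cong refl sets_Q)

text \<open>Given the points, sorting permutes the displacements by a fixed permutation, which does not
  change their product law.\<close>

lemma distr_sort_pair:
  "distr M (point_seqs n \<Otimes>\<^sub>M point_seqs n) (\<lambda>\<omega>. sort_pair n (\<lambda>k. D k \<omega>, \<lambda>k. T k \<omega>)) =
   PiM UNIV (\<lambda>_. Q) \<Otimes>\<^sub>M distr M (point_seqs n) (\<lambda>\<omega>. sorted_points n (\<lambda>k. T k \<omega>))"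
proof -
  let ?S = "point_seqs n" and ?P = "PiM UNIV (\<lambda>_::nat. Q)"
  let ?tau = "distr M ?S (\<lambda>\<omega> k. T k \<omega>)" and ?sig = "distr M ?S (\<lambda>\<omega>. sorted_points n (\<lambda>k. T k \<omega>))"
  interpret P: prob_space ?P by (rule prob_space_displacements)
  interpret tau: prob_space ?tau by (rule prob_space_distr) measurable
  interpret sig: prob_space ?sig by (rule prob_space_distr) measurable
  interpret PT: pair_sigma_finite ?P ?tau ..
  interpret PS: pair_sigma_finite ?P ?sig ..
  have sets: "sets (?P \<Otimes>\<^sub>M N) = sets (?S \<Otimes>\<^sub>M ?S)" if "sets N = sets ?S" for N
    by (intro sets_pair_measure_cong sets_displacements that)
  have perm: "(\<integral>\<^sup>+d. g (\<lambda>k. d (p k)) \<partial>?P) = (\<integral>\<^sup>+d. g d \<partial>?P)" if p: "bij p" and g: "g \<in> borel_measurable ?S" for g and p :: "nat \<Rightarrow> nat"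
  proof -
    have g': "g \<in> borel_measurable ?P" using g by (simp cong: measurable_cong_sets add: sets_displacements)
    have m: "(\<lambda>d k. d (p k)) \<in> ?P \<rightarrow>\<^sub>M ?P"
      by (rule measurable_PiM_single') (auto simp: space_PiM intro: measurable_component_singleton)
    have "distr ?P (PiM UNIV (\<lambda>i. Q)) (\<lambda>d. \<lambda>k\<in>UNIV. d (p k)) = PiM UNIV (\<lambda>i. Q)"
      using p by (intro distr_PiM_reindex[where M="\<lambda>_. Q"] prob_space_Q) (auto simp: bij_def)
    then have "distr ?P ?P (\<lambda>d k. d (p k)) = ?P" by (simp only: restrict_UNIV)
    then have "(\<integral>\<^sup>+d. g d \<partial>?P) = (\<integral>\<^sup>+d. g d \<partial>distr ?P ?P (\<lambda>d k. d (p k)))" by simp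
    also have "\<dots> = (\<integral>\<^sup>+d. g (\<lambda>k. d (p k)) \<partial>?P)" by (rule nn_integral_distr[OF m]) (simp add: g')
    finally show ?thesis by simp
  qed
  have "distr M (?S \<Otimes>\<^sub>M ?S) (\<lambda>\<omega>. sort_pair n (\<lambda>k. D k \<omega>, \<lambda>k. T k \<omega>)) = 
    distr (distr M (?S \<Otimes>\<^sub>M ?S) (\<lambda>\<omega>. (\<lambda>k. D k \<omega>, \<lambda>k. T k \<omega>))) (?S \<Otimes>\<^sub>M ?S) (sort_pair n)"
    by (subst distr_distr) (simp_all add: comp_def)
  also have "\<dots> = distr (?P \<Otimes>\<^sub>M ?tau) (?S \<Otimes>\<^sub>M ?S) (sort_pair n)" by (simp only: distr_displacements_points)
  also have "\<dots> = ?P \<Otimes>\<^sub>M ?sig"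
  proof (rule measure_eqI)
    show "sets (distr (?P \<Otimes>\<^sub>M ?tau) (?S \<Otimes>\<^sub>M ?S) (sort_pair n)) = sets (?P \<Otimes>\<^sub>M ?sig)"
      by (simp add: sets)
    fix E assume "E \<in> sets (distr (?P \<Otimes>\<^sub>M ?tau) (?S \<Otimes>\<^sub>M ?S) (sort_pair n))"
    then have E: "E \<in> sets (?S \<Otimes>\<^sub>M ?S)" by simp
    have ind[measurable]: "indicator E \<in> borel_measurable (?S \<Otimes>\<^sub>M ?S)" using E by simp
    have sp: "sort_pair n \<in> ?P \<Otimes>\<^sub>M ?tau \<rightarrow>\<^sub>M ?S \<Otimes>\<^sub>M ?S"
      using sort_pair_measurable by (simp cong: measurable_cong_sets add: sets)
    have indt: "(\<lambda>p. indicator E (sort_pair n p) :: ennreal) \<in> borel_measurable (?P \<Otimes>\<^sub>M ?tau)"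
      by (rule measurable_compose[OF sp ind])
    have inds: "indicator E \<in> borel_measurable (?P \<Otimes>\<^sub>M ?sig)"
      using ind by (simp cong: measurable_cong_sets add: sets)
    have sect: "(\<lambda>d. indicator E (d, s) :: ennreal) \<in> borel_measurable ?S" if "s \<in> space ?S" for s
      by (rule measurable_compose[OF measurable_Pair2'[OF that] ind])
    have int_meas: "(\<lambda>s. \<integral>\<^sup>+d. indicator E (d, s) \<partial>?P) \<in> borel_measurable ?S"
    proof -
      have "(\<lambda>p. indicator E (snd p, fst p) :: ennreal) \<in> borel_measurable (?S \<Otimes>\<^sub>M ?P)"
        using measurable_compose[OF measurable_pair_swap' ind] 
        by (simp cong: measurable_cong_sets add: sets_pair_measure_cong[OF refl sets_displacements] case_prod_unfold)
      then show ?thesis using P.borel_measurable_nn_integral_fst[of "\<lambda>p. indicator E (snd p, fst p)" ?S] by simp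
    qed
    have "emeasure (distr (?P \<Otimes>\<^sub>M ?tau) (?S \<Otimes>\<^sub>M ?S) (sort_pair n)) E = 
      (\<integral>\<^sup>+p. indicator E p \<partial>distr (?P \<Otimes>\<^sub>M ?tau) (?S \<Otimes>\<^sub>M ?S) (sort_pair n))" using E by simp
    also have "\<dots> = (\<integral>\<^sup>+p. indicator E (sort_pair n p) \<partial>(?P \<Otimes>\<^sub>M ?tau))" by (rule nn_integral_distr[OF sp]) simp
    also have "\<dots> = (\<integral>\<^sup>+t. \<integral>\<^sup>+d. indicator E (sort_pair n (d, t)) \<partial>?P \<partial>?tau)"
      by (rule PT.nn_integral_snd[OF indt, symmetric])
    also have "\<dots> = (\<integral>\<^sup>+t. \<integral>\<^sup>+d. indicator E (d, sorted_points n t) \<partial>?P \<partial>?tau)"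
    proof (rule nn_integral_cong)
      fix t assume "t \<in> space ?tau"
      then have s: "sorted_points n t \<in> space ?S" using measurable_space[OF sorted_points_measurable] by simp
      show "(\<integral>\<^sup>+d. indicator E (sort_pair n (d, t)) \<partial>?P) = (\<integral>\<^sup>+d. indicator E (d, sorted_points n t) \<partial>?P)"
        using perm[OF bij_sorting sect[OF s], of "\<lambda>k. key n (t k)"] by (simp add: sort_pair_def point_order_def)
    qed
    also have "\<dots> = (\<integral>\<^sup>+\<omega>. \<integral>\<^sup>+d. indicator E (d, sorted_points n (\<lambda>k. T k \<omega>)) \<partial>?P \<partial>M)"
      by (rule nn_integral_distr[OF points_measurable]) (simp add: measurable_compose[OF sorted_points_measurable int_meas])
    also have "\<dots> = (\<integral>\<^sup>+s. \<integral>\<^sup>+d. indicator E (d, s) \<partial>?P \<partial>?sig)"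
      by (rule nn_integral_distr[OF measurable_compose[OF points_measurable sorted_points_measurable], symmetric]) (simp add: int_meas)
    also have "\<dots> = (\<integral>\<^sup>+p. indicator E p \<partial>(?P \<Otimes>\<^sub>M ?sig))"
      by (rule PS.nn_integral_snd[OF inds])
    also have "\<dots> = emeasure (?P \<Otimes>\<^sub>M ?sig) E" using E by (intro nn_integral_indicator) (simp add: sets)
    finally show "emeasure (distr (?P \<Otimes>\<^sub>M ?tau) (?S \<Otimes>\<^sub>M ?S) (sort_pair n)) E = emeasure (?P \<Otimes>\<^sub>M ?sig) E" .
  qed
  finally show ?thesis .
qed

text \<open>On the right the points enter only through the law of their sorted sequence, which is
  the same before and after a translation.\<close>

lemma distr_marks:
  assumes A: "A \<in> sets (Rn n)" and E: "\<And>i. E i \<in> sets (Rn n \<Otimes>\<^sub>M (Rn n \<Otimes>\<^sub>M region_space n))"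
  shows "distr M (PiM UNIV (\<lambda>_. borel)) (\<lambda>\<omega>. marks n A E (\<lambda>k. D k \<omega>, \<lambda>k. T k \<omega>)) =
    distr (PiM UNIV (\<lambda>_. Q) \<Otimes>\<^sub>M distr M (point_seqs n) (\<lambda>\<omega>. sorted_points n (\<lambda>k. T k \<omega>))) (PiM UNIV (\<lambda>_. borel)) (marks n A E)"
proof -
  have pair: "(\<lambda>\<omega>. (\<lambda>k. D k \<omega>, \<lambda>k. T k \<omega>)) \<in> M \<rightarrow>\<^sub>M point_seqs n \<Otimes>\<^sub>M point_seqs n" by measurable
  note spair = measurable_compose[OF pair sort_pair_measurable]
  note marks = marks_measurable[OF A E]
  have "AE \<omega> in M. marks n A E (\<lambda>k. D k \<omega>, \<lambda>k. T k \<omega>) = marks n A E (sort_pair n (\<lambda>k. D k \<omega>, \<lambda>k. T k \<omega>))"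
    using AE_locally_finite_key AE_space
    by eventually_elim (rule marks_sort_pair[symmetric], auto intro: measurable_space[OF T_measurable])
  then have "distr M (PiM UNIV (\<lambda>_. borel)) (\<lambda>\<omega>. marks n A E (\<lambda>k. D k \<omega>, \<lambda>k. T k \<omega>)) =
    distr M (PiM UNIV (\<lambda>_. borel)) (\<lambda>\<omega>. marks n A E (sort_pair n (\<lambda>k. D k \<omega>, \<lambda>k. T k \<omega>)))"
    by (intro distr_cong_AE refl measurable_compose[OF pair marks] measurable_compose[OF spair marks])
  also have "\<dots> = distr (distr M (point_seqs n \<Otimes>\<^sub>M point_seqs n) (\<lambda>\<omega>. sort_pair n (\<lambda>k. D k \<omega>, \<lambda>k. T k \<omega>))) (PiM UNIV (\<lambda>_. borel)) (marks n A E)"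
    unfolding distr_distr[OF marks spair] comp_def ..
  finally show ?thesis unfolding distr_sort_pair .
qed

lemma displaced_points_translate:
  assumes z: "z \<in> space (Rn n)"
  shows "displaced_points M n lam (\<lambda>k \<omega>. vadd n z (T k \<omega>)) D Q"
proof -
  interpret T': poisson_points M n lam "\<lambda>k \<omega>. vadd n z (T k \<omega>)"
    by (rule poisson_points_translate) unfold_locales
  have v: "(\<lambda>t k. vadd n z (t k)) \<in> point_seqs n \<rightarrow>\<^sub>M point_seqs n"
    by (rule measurable_point_seqsI) (use z in measurable)
  have "indep_var (point_seqs n) ((\<lambda>d. d) \<circ> (\<lambda>\<omega> k. D k \<omega>)) (point_seqs n) ((\<lambda>t k. vadd n z (t k)) \<circ> (\<lambda>\<omega> k. T k \<omega>))"
    using indep v unfolding displacements_indep_points_def by (intro indep_var_compose) auto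
  then have "displacements_indep_points n M (\<lambda>k \<omega>. vadd n z (T k \<omega>)) D"
    unfolding displacements_indep_points_def by (simp add: comp_def)
  then show ?thesis using iid by unfold_locales
qed

text \<open>Regions move along with the points, so translating the points with marks kept is the
  same as marking the translated configuration, to which \<open>distr_marks\<close> applies as
  well.\<close>

lemma stationary_regions:
  assumes A: "A \<in> sets (Rn n)" 
  shows "stationary_marked n (Rn n \<Otimes>\<^sub>M region_space n) M T
    (\<lambda>k \<omega>. (D k \<omega>, seen_from n (T k \<omega>) (region n A (\<lambda>k. T k \<omega>) k)))"
  unfolding stationary_marked_def
proof (intro conjI allI ballI impI)
  show "T k \<in> M \<rightarrow>\<^sub>M Rn n" for k by measurable
  show "(\<lambda>\<omega>. (D k \<omega>, seen_from n (T k \<omega>) (region n A (\<lambda>k. T k \<omega>) k))) \<in> M \<rightarrow>\<^sub>M Rn n \<Otimes>\<^sub>M region_space n" for k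
    by (intro measurable_Pair D_measurable measurable_compose[OF points_measurable seen_region_measurable[OF A]])
  fix z and E :: "nat \<Rightarrow> ((nat \<Rightarrow> real) \<times> (nat \<Rightarrow> real) \<times> (nat \<Rightarrow> real) set) set"
  assume z: "z \<in> space (Rn n)" and E: "\<forall>i. E i \<in> sets (Rn n \<Otimes>\<^sub>M (Rn n \<Otimes>\<^sub>M region_space n))"
  interpret T': displaced_points M n lam "\<lambda>k \<omega>. vadd n z (T k \<omega>)" D Q by (rule displaced_points_translate[OF z])
  have P: "poisson_points M n lam (\<lambda>k \<omega>. vadd n z (T k \<omega>))" by unfold_locales
  have "(\<lambda>\<omega> i. mark_count (\<lambda>k \<omega>. vadd n z (T k \<omega>)) (\<lambda>k \<omega>. (D k \<omega>, seen_from n (T k \<omega>) (region n A (\<lambda>k. T k \<omega>) k))) (E i) \<omega>) =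
    (\<lambda>\<omega>. marks n A E (\<lambda>k. D k \<omega>, \<lambda>k. vadd n z (T k \<omega>)))"
    by (intro ext) (simp add: mark_count_def marks_def seen_region_translate[of n z "\<lambda>k. T k _"])
  moreover have "(\<lambda>\<omega> i. mark_count T (\<lambda>k \<omega>. (D k \<omega>, seen_from n (T k \<omega>) (region n A (\<lambda>k. T k \<omega>) k))) (E i) \<omega>) =
    (\<lambda>\<omega>. marks n A E (\<lambda>k. D k \<omega>, \<lambda>k. T k \<omega>))"
    by (intro ext) (simp add: mark_count_def marks_def)
  moreover have "distr M (PiM UNIV (\<lambda>_. borel)) (\<lambda>\<omega>. marks n A E (\<lambda>k. D k \<omega>, \<lambda>k. vadd n z (T k \<omega>))) =
    distr M (PiM UNIV (\<lambda>_. borel)) (\<lambda>\<omega>. marks n A E (\<lambda>k. D k \<omega>, \<lambda>k. T k \<omega>))"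
    unfolding distr_marks[OF A spec[OF E]] T'.distr_marks[OF A spec[OF E]] distr_sorted_points[OF P] ..
  ultimately show "distr M (PiM UNIV (\<lambda>_. borel)) (\<lambda>\<omega> i. mark_count (\<lambda>k \<omega>. vadd n z (T k \<omega>)) (\<lambda>k \<omega>. (D k \<omega>, seen_from n (T k \<omega>) (region n A (\<lambda>k. T k \<omega>) k))) (E i) \<omega>) =
    distr M (PiM UNIV (\<lambda>_. borel)) (\<lambda>\<omega> i. mark_count T (\<lambda>k \<omega>. (D k \<omega>, seen_from n (T k \<omega>) (region n A (\<lambda>k. T k \<omega>) k))) (E i) \<omega>)"
    by (simp only:)
qed

lemma decomposition_regions: "decomposition n M (\<lambda>k \<omega>. region n A (\<lambda>k. T k \<omega>) k)"
  unfolding decomposition_def using AE_locally_finite AE_space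
proof eventually_elim
  case (elim \<omega>)
  have "\<exists>k. y \<in> region n A (\<lambda>k. T k \<omega>) k" if "y \<in> space (Rn n)" for y
    using elim that by (intro region_cover measurable_space[OF T_measurable]) auto
  then have "space (Rn n) - (\<Union>k. region n A (\<lambda>k. T k \<omega>) k) = {}" by blast
  then have "space (Rn n) - (\<Union>k. region n A (\<lambda>k. T k \<omega>) k) \<in> null_sets (Rn n)" by (metis null_sets.empty_sets)
  then show ?case using region_disjoint by blast
qed

text \<open>The witness is the sigma-algebra generated by the point sequence: regions are functions
  of the points only.\<close>

lemma regions_indep:
  assumes A: "A \<in> sets (Rn n)" 
  shows "regions_indep_displacements n M T D (\<lambda>k \<omega>. region n A (\<lambda>k. T k \<omega>) k)"
  unfolding regions_indep_displacements_def
proof (intro exI conjI allI)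
  let ?G = "vimage_algebra (space M) (\<lambda>\<omega> k. T k \<omega>) (point_seqs n)"
  have T: "(\<lambda>\<omega> k. T k \<omega>) \<in> ?G \<rightarrow>\<^sub>M point_seqs n"
    by (rule measurable_vimage_algebra1) (use measurable_space[OF points_measurable] in auto)
  show "subalgebra M ?G"
    unfolding subalgebra_def using sets_image_in_sets[OF refl points_measurable] by simp
  show "T k \<in> ?G \<rightarrow>\<^sub>M Rn n" for k using measurable_compose[OF T component_measurable] .
  show "{(\<omega>, x). \<omega> \<in> space M \<and> x \<in> region n A (\<lambda>k. T k \<omega>) k} \<in> sets (?G \<Otimes>\<^sub>M Rn n)" for k
  proof -
    have "{w \<in> space (?G \<Otimes>\<^sub>M Rn n). snd w \<in> region n A (\<lambda>k. T k (fst w)) k} \<in> sets (?G \<Otimes>\<^sub>M Rn n)"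
      by (rule region_graph_measurable[OF A measurable_compose[OF measurable_fst T] measurable_snd])
    moreover have "{w \<in> space (?G \<Otimes>\<^sub>M Rn n). snd w \<in> region n A (\<lambda>k. T k (fst w)) k} = {(\<omega>, x). \<omega> \<in> space M \<and> x \<in> region n A (\<lambda>k. T k \<omega>) k}"
      by (auto simp: space_pair_measure region_def)
    ultimately show ?thesis by simp
  qed
  show "indep_set (sets (vimage_algebra (space M) (\<lambda>\<omega> k. D k \<omega>) (point_seqs n))) (sets ?G)"
    using indep unfolding displacements_indep_points_def indep_var_eq sets_vimage_algebra by simp
qed

lemma decoding_regions_region:
  assumes A: "A \<in> sets (Rn n)" 
  shows "decoding_regions n M T D (\<lambda>k \<omega>. region n A (\<lambda>k. T k \<omega>) k)"
  unfolding decoding_regions_def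
  by (intro conjI regions_indep[OF A] stationary_regions[OF A] decomposition_regions)

end

section \<open>The second factorial moment and the error probability\<close>

lemma
  fixes h :: "'i::countable \<Rightarrow> 'a \<Rightarrow> ennreal"
  assumes M: "sigma_finite_measure M" and h: "\<And>i. h i \<in> borel_measurable M"
  shows measurable_pair_count_space: "(\<lambda>w. h (snd w) (fst w)) \<in> borel_measurable (M \<Otimes>\<^sub>M count_space UNIV)"
    and nn_integral_pair_count_space: "(\<integral>\<^sup>+w. h (snd w) (fst w) \<partial>(M \<Otimes>\<^sub>M count_space UNIV)) = (\<integral>\<^sup>+i. \<integral>\<^sup>+x. h i x \<partial>M \<partial>count_space UNIV)"
proof -
  interpret M: sigma_finite_measure M by fact
  interpret C: sigma_finite_measure "count_space (UNIV :: 'i set)" by (rule sigma_finite_measure_count_space)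
  interpret P: pair_sigma_finite M "count_space (UNIV :: 'i set)" ..
  show m: "(\<lambda>w. h (snd w) (fst w)) \<in> borel_measurable (M \<Otimes>\<^sub>M count_space UNIV)"
    by (rule measurable_compose_countable[of "\<lambda>i w. h i (fst w)" _ _ snd, OF measurable_compose[OF measurable_fst h] measurable_snd])
  show "(\<integral>\<^sup>+w. h (snd w) (fst w) \<partial>(M \<Otimes>\<^sub>M count_space UNIV)) = (\<integral>\<^sup>+i. \<integral>\<^sup>+x. h i x \<partial>M \<partial>count_space UNIV)"
    using P.nn_integral_snd[OF m] by simp
qed

context poisson_points
begin

text \<open>Splitting into \<open>A \<inter> B\<close>, \<open>A - B\<close> and
  \<open>B - A\<close> leaves one square and three products over disjoint sets. The extra summand
  comes from the square.\<close>

lemma nn_integral_count_mult: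
  assumes A[measurable]: "A \<in> sets (Rn n)" and finA: "emeasure (Rn n) A < \<infinity>"
    and B[measurable]: "B \<in> sets (Rn n)" and finB: "emeasure (Rn n) B < \<infinity>"
  shows "(\<integral>\<^sup>+\<omega>. point_count T A \<omega> * point_count T B \<omega> \<partial>M) =
    ennreal lam * emeasure (Rn n) A * (ennreal lam * emeasure (Rn n) B) + ennreal lam * emeasure (Rn n) (A \<inter> B)"
proof -
  define I where "I = A \<inter> B"
  define A' where "A' = A - B"
  define B' where "B' = B - A"
  have s[measurable]: "I \<in> sets (Rn n)" "A' \<in> sets (Rn n)" "B' \<in> sets (Rn n)" by (auto simp: I_def A'_def B'_def)
  have m: "(\<lambda>\<omega>. point_count T U \<omega> * point_count T V \<omega>) \<in> borel_measurable M" if "U \<in> sets (Rn n)" "V \<in> sets (Rn n)" for U V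
    by (intro borel_measurable_times_ennreal count_measurable that)
  have fin: "emeasure (Rn n) I < \<infinity>" "emeasure (Rn n) A' < \<infinity>" "emeasure (Rn n) B' < \<infinity>"
    using emeasure_mono[OF _ A, of I] emeasure_mono[OF _ A, of A'] emeasure_mono[OF _ B, of B'] finA finB
    by (auto simp: I_def A'_def B'_def intro: le_less_trans)
  have disj: "I \<inter> A' = {}" "I \<inter> B' = {}" "A' \<inter> I = {}" "A' \<inter> B' = {}" by (auto simp: I_def A'_def B'_def)
  have AB: "A = I \<union> A'" "B = I \<union> B'" by (auto simp: I_def A'_def B'_def)
  have eA: "emeasure (Rn n) A = emeasure (Rn n) I + emeasure (Rn n) A'"
    unfolding AB(1) by (rule plus_emeasure[symmetric]) (use disj in auto)
  have eB: "emeasure (Rn n) B = emeasure (Rn n) I + emeasure (Rn n) B'"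
    unfolding AB(2) by (rule plus_emeasure[symmetric]) (use disj in auto)
  have "(\<integral>\<^sup>+\<omega>. point_count T A \<omega> * point_count T B \<omega> \<partial>M) =
    (\<integral>\<^sup>+\<omega>. point_count T I \<omega> * point_count T I \<omega> + point_count T I \<omega> * point_count T B' \<omega> + 
      (point_count T A' \<omega> * point_count T I \<omega> + point_count T A' \<omega> * point_count T B' \<omega>) \<partial>M)"
    unfolding AB point_count_Un[OF disj(1)] point_count_Un[OF disj(2)] by (simp only: distrib_left distrib_right add_ac)
  also have "\<dots> = (\<integral>\<^sup>+\<omega>. point_count T I \<omega> * point_count T I \<omega> \<partial>M) + (\<integral>\<^sup>+\<omega>. point_count T I \<omega> * point_count T B' \<omega> \<partial>M) +
    ((\<integral>\<^sup>+\<omega>. point_count T A' \<omega> * point_count T I \<omega> \<partial>M) + (\<integral>\<^sup>+\<omega>. point_count T A' \<omega> * point_count T B' \<omega> \<partial>M))"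
    unfolding nn_integral_add[OF borel_measurable_add[OF m m] borel_measurable_add[OF m m], OF s(1,1,1,3,2,1,2,3)]
      nn_integral_add[OF m m, OF s(1,1,1,3)] nn_integral_add[OF m m, OF s(2,1,2,3)] ..
  also have "\<dots> = ennreal lam * emeasure (Rn n) A * (ennreal lam * emeasure (Rn n) B) + ennreal lam * emeasure (Rn n) I"
    unfolding eA eB
    by (simp only: nn_integral_count_square[OF \<open>I \<in> sets (Rn n)\<close> fin(1)]
      nn_integral_count_mult_disjoint[OF \<open>I \<in> sets (Rn n)\<close> fin(1) \<open>B' \<in> sets (Rn n)\<close> fin(3) disj(2)]
      nn_integral_count_mult_disjoint[OF \<open>A' \<in> sets (Rn n)\<close> fin(2) \<open>I \<in> sets (Rn n)\<close> fin(1) disj(3)]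
      nn_integral_count_mult_disjoint[OF \<open>A' \<in> sets (Rn n)\<close> fin(2) \<open>B' \<in> sets (Rn n)\<close> fin(3) disj(4)]
      distrib_left distrib_right add_ac)
  finally show ?thesis by (simp only: I_def)
qed

text \<open>The intensity of ordered pairs of distinct points, normalised to be the product of volumes.\<close>

definition pair_intensity :: "((nat \<Rightarrow> real) \<times> (nat \<Rightarrow> real)) measure" where
  "pair_intensity = distr (density (M \<Otimes>\<^sub>M count_space UNIV) (\<lambda>w. if fst (snd w) \<noteq> snd (snd w) then ennreal (1 / lam\<^sup>2) else 0))
    (Rn n \<Otimes>\<^sub>M Rn n) (\<lambda>w. (T (fst (snd w)) (fst w), T (snd (snd w)) (fst w)))"

lemma nn_integral_pair_intensity:
  assumes g[measurable]: "g \<in> borel_measurable (Rn n \<Otimes>\<^sub>M Rn n)"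
  shows "(\<integral>\<^sup>+p. g p \<partial>pair_intensity) = 
    ennreal (1 / lam\<^sup>2) * (\<integral>\<^sup>+i. \<integral>\<^sup>+\<omega>. (if fst i \<noteq> snd i then g (T (fst i) \<omega>, T (snd i) \<omega>) else 0) \<partial>M \<partial>count_space UNIV)"
proof -
  have sf: "sigma_finite_measure M" by unfold_locales
  let ?C = "count_space (UNIV :: (nat \<times> nat) set)"
  have X: "(\<lambda>w. (T (fst (snd w)) (fst w), T (snd (snd w)) (fst w))) \<in> M \<Otimes>\<^sub>M ?C \<rightarrow>\<^sub>M Rn n \<Otimes>\<^sub>M Rn n"
    by (rule measurable_compose_countable[of "\<lambda>i w. (T (fst i) (fst w), T (snd i) (fst w))" _ _ snd]) measurable
  have c: "(\<lambda>w. if fst (snd w) \<noteq> snd (snd w) then ennreal (1 / lam\<^sup>2) else 0) \<in> borel_measurable (M \<Otimes>\<^sub>M ?C)"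
    by (rule measurable_compose[OF measurable_snd]) simp
  have gm: "(\<lambda>\<omega>. if fst i \<noteq> snd i then g (T (fst i) \<omega>, T (snd i) \<omega>) else 0) \<in> borel_measurable M" for i
    by measurable
  have "(\<integral>\<^sup>+p. g p \<partial>pair_intensity) = (\<integral>\<^sup>+w. (if fst (snd w) \<noteq> snd (snd w) then ennreal (1 / lam\<^sup>2) else 0) * 
      g (T (fst (snd w)) (fst w), T (snd (snd w)) (fst w)) \<partial>(M \<Otimes>\<^sub>M ?C))"
    unfolding pair_intensity_def using X measurable_compose[OF X g]
    by (subst nn_integral_distr) (simp_all add: nn_integral_density[OF c])
  also have "\<dots> = (\<integral>\<^sup>+w. ennreal (1 / lam\<^sup>2) * (if fst (snd w) \<noteq> snd (snd w) then g (T (fst (snd w)) (fst w), T (snd (snd w)) (fst w)) else 0) \<partial>(M \<Otimes>\<^sub>M ?C))"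
    by (intro nn_integral_cong) simp
  also have "\<dots> = ennreal (1 / lam\<^sup>2) * (\<integral>\<^sup>+w. (if fst (snd w) \<noteq> snd (snd w) then g (T (fst (snd w)) (fst w), T (snd (snd w)) (fst w)) else 0) \<partial>(M \<Otimes>\<^sub>M ?C))"
    by (rule nn_integral_cmult) (rule measurable_pair_count_space[OF sf gm])
  also have "(\<integral>\<^sup>+w. (if fst (snd w) \<noteq> snd (snd w) then g (T (fst (snd w)) (fst w), T (snd (snd w)) (fst w)) else 0) \<partial>(M \<Otimes>\<^sub>M ?C)) =
    (\<integral>\<^sup>+i. \<integral>\<^sup>+\<omega>. (if fst i \<noteq> snd i then g (T (fst i) \<omega>, T (snd i) \<omega>) else 0) \<partial>M \<partial>?C)"
    by (rule nn_integral_pair_count_space[OF sf gm])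
  finally show ?thesis .
qed

text \<open>The product counts ordered pairs of indices; the diagonal pairs contribute the count of
  \<open>A \<inter> B\<close>.\<close>

lemma count_mult_eq_pairs:
  "point_count T A \<omega> * point_count T B \<omega> = 
    (\<integral>\<^sup>+i. (if fst i \<noteq> snd i then indicator (A \<times> B) (T (fst i) \<omega>, T (snd i) \<omega>) else 0) \<partial>count_space UNIV) + point_count T (A \<inter> B) \<omega>"
proof -
  let ?f = "\<lambda>i :: nat \<times> nat. indicator (A \<times> B) (T (fst i) \<omega>, T (snd i) \<omega>) :: ennreal"
  have cnt: "point_count T S \<omega> = (\<integral>\<^sup>+k. indicator S (T k \<omega>) \<partial>count_space UNIV)" for S
    by (simp add: point_count_def nn_integral_count_space_nat)
  have "point_count T A \<omega> * point_count T B \<omega> = (\<integral>\<^sup>+k. indicator A (T k \<omega>) * point_count T B \<omega> \<partial>count_space UNIV)"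
    unfolding cnt[of A] by (rule nn_integral_multc[symmetric]) simp
  also have "\<dots> = (\<integral>\<^sup>+k. \<integral>\<^sup>+j. ?f (k, j) \<partial>count_space UNIV \<partial>count_space UNIV)"
    unfolding cnt[of B] fst_conv snd_conv indicator_times by (intro nn_integral_cong nn_integral_cmult[symmetric]) simp
  also have "\<dots> = (\<integral>\<^sup>+i. ?f i \<partial>count_space UNIV)" by (rule nn_integral_fst_count_space)
  also have "\<dots> = (\<integral>\<^sup>+i. (if fst i \<noteq> snd i then ?f i else 0) + (if fst i = snd i then ?f i else 0) \<partial>count_space UNIV)"
    by (intro nn_integral_cong) simp
  also have "\<dots> = (\<integral>\<^sup>+i. (if fst i \<noteq> snd i then ?f i else 0) \<partial>count_space UNIV) + (\<integral>\<^sup>+i. (if fst i = snd i then ?f i else 0) \<partial>count_space UNIV)"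
    by (rule nn_integral_add) auto
  also have "(\<integral>\<^sup>+i. (if fst i = snd i then ?f i else 0) \<partial>count_space UNIV) = 
    (\<integral>\<^sup>+k. \<integral>\<^sup>+j. (if k = j then ?f (k, j) else 0) \<partial>count_space UNIV \<partial>count_space UNIV)"
    by (subst nn_integral_fst_count_space[symmetric]) simp
  also have "\<dots> = (\<integral>\<^sup>+k. indicator (A \<inter> B) (T k \<omega>) \<partial>count_space UNIV)"
  proof (rule nn_integral_cong)
    fix k
    have "(\<integral>\<^sup>+j. (if k = j then ?f (k, j) else 0) \<partial>count_space UNIV) = (\<integral>\<^sup>+j. ?f (k, k) * indicator {k} j \<partial>count_space UNIV)"
      by (intro nn_integral_cong) auto
    also have "\<dots> = indicator (A \<inter> B) (T k \<omega>)"
      by (subst nn_integral_cmult_indicator) (auto simp: indicator_def)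
    finally show "(\<integral>\<^sup>+j. (if k = j then ?f (k, j) else 0) \<partial>count_space UNIV) = indicator (A \<inter> B) (T k \<omega>)" .
  qed
  finally show ?thesis by (simp only: cnt)
qed

text \<open>The diagonal has mean \<open>lam\<close> times the volume of
  \<open>A \<inter> B\<close>, exactly the extra summand of \<open>nn_integral_count_mult\<close>.
  It cancels because that volume is finite.\<close>

lemma emeasure_pair_intensity_bounded:
  assumes A[measurable]: "A \<in> sets (Rn n)" and finA: "emeasure (Rn n) A < \<infinity>"
    and B[measurable]: "B \<in> sets (Rn n)" and finB: "emeasure (Rn n) B < \<infinity>"
  shows "emeasure pair_intensity (A \<times> B) = emeasure (Rn n) A * emeasure (Rn n) B"
proof -
  let ?h = "\<lambda>i \<omega>. (if fst i \<noteq> snd i then indicator (A \<times> B) (T (fst i) \<omega>, T (snd i) \<omega>) else 0) :: ennreal"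
  let ?C = "count_space (UNIV :: (nat \<times> nat) set)"
  have sf: "sigma_finite_measure M" by unfold_locales
  interpret M: sigma_finite_measure M by fact
  interpret C: sigma_finite_measure ?C by (rule sigma_finite_measure_count_space)
  interpret P: pair_sigma_finite M ?C ..
  have hm: "?h i \<in> borel_measurable M" for i by measurable
  note m = measurable_pair_count_space[OF sf, of ?h, OF hm]
  have swap: "(\<integral>\<^sup>+\<omega>. \<integral>\<^sup>+i. ?h i \<omega> \<partial>?C \<partial>M) = (\<integral>\<^sup>+i. \<integral>\<^sup>+\<omega>. ?h i \<omega> \<partial>M \<partial>?C)"
    using P.Fubini[OF m] by (simp cong del: if_weak_cong)
  have inner: "(\<lambda>\<omega>. \<integral>\<^sup>+i. ?h i \<omega> \<partial>?C) \<in> borel_measurable M"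
    using C.borel_measurable_nn_integral_fst[OF m] by (simp cong del: if_weak_cong)
  have I: "emeasure (Rn n) (A \<inter> B) < \<infinity>" using emeasure_mono[OF _ A, of "A \<inter> B"] finA by (auto intro: le_less_trans)
  have "(\<integral>\<^sup>+i. \<integral>\<^sup>+\<omega>. ?h i \<omega> \<partial>M \<partial>?C) + ennreal lam * emeasure (Rn n) (A \<inter> B) = (\<integral>\<^sup>+\<omega>. point_count T A \<omega> * point_count T B \<omega> \<partial>M)"
    unfolding count_mult_eq_pairs swap[symmetric] nn_integral_count_mean[OF sets.Int[OF A B] I, symmetric]
    by (rule nn_integral_add[symmetric]) (use inner in \<open>auto intro: count_measurable\<close>)
  also have "\<dots> = ennreal lam * emeasure (Rn n) A * (ennreal lam * emeasure (Rn n) B) + ennreal lam * emeasure (Rn n) (A \<inter> B)"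
    by (rule nn_integral_count_mult[OF A finA B finB])
  finally have eq: "(\<integral>\<^sup>+i. \<integral>\<^sup>+\<omega>. ?h i \<omega> \<partial>M \<partial>?C) = ennreal lam * emeasure (Rn n) A * (ennreal lam * emeasure (Rn n) B)"
    using I by (subst (asm) (1 2) add.commute, subst (asm) ennreal_add_left_cancel) (auto simp: ennreal_mult_eq_top_iff)
  have "emeasure pair_intensity (A \<times> B) = (\<integral>\<^sup>+p. indicator (A \<times> B) p \<partial>pair_intensity)"
    by (rule nn_integral_indicator[symmetric]) (simp add: pair_intensity_def)
  also have "\<dots> = ennreal (1 / lam\<^sup>2) * (ennreal lam * emeasure (Rn n) A * (ennreal lam * emeasure (Rn n) B))"
    by (subst nn_integral_pair_intensity) (simp_all only: eq, measurable)
  also have "\<dots> = (ennreal (1 / lam\<^sup>2) * ennreal lam * ennreal lam) * (emeasure (Rn n) A * emeasure (Rn n) B)"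
    by (simp only: mult_ac)
  also have "ennreal (1 / lam\<^sup>2) * ennreal lam * ennreal lam = 1"
    using lam_pos by (simp add: ennreal_mult[symmetric] power2_eq_square)
  finally show ?thesis by simp
qed

text \<open>Uniqueness of the product measure asks for all rectangles, also those of infinite
  volume; these are exhausted by intersections with cubes.\<close>

lemma pair_intensity_eq: "Rn n \<Otimes>\<^sub>M Rn n = pair_intensity"
proof (rule pair_measure_eqI)
  interpret R: finite_product_sigma_finite "\<lambda>_. lborel" "{1..n}" by standard simp
  show "sigma_finite_measure (Rn n)" "sigma_finite_measure (Rn n)" by (rule R.sigma_finite_measure_axioms)+
  show sets: "sets (Rn n \<Otimes>\<^sub>M Rn n) = sets pair_intensity" by (simp add: pair_intensity_def)
  fix A B assume A: "A \<in> sets (Rn n)" and B: "B \<in> sets (Rn n)"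
  let ?A = "\<lambda>m. A \<inter> big_cube n m" and ?B = "\<lambda>m. B \<inter> big_cube n m"
  have Am: "?A m \<in> sets (Rn n)" and Bm: "?B m \<in> sets (Rn n)" for m using A B by auto
  have incAB: "incseq (\<lambda>m. ?A m \<times> ?B m)"
    unfolding incseq_def by (intro allI impI Sigma_mono Int_mono big_cube_mono order_refl; assumption)
  have UA: "(\<Union>m. ?A m) = A" and UB: "(\<Union>m. ?B m) = B"
    using sets.sets_into_space[OF A] sets.sets_into_space[OF B] by (simp_all only: Int_UN_distrib[symmetric] UN_big_cube Int_absorb2)
  have UAB: "(\<Union>m. ?A m \<times> ?B m) = A \<times> B"
  proof (intro antisym subsetI)
    fix p assume "p \<in> A \<times> B"
    then obtain x y where p: "p = (x, y)" "x \<in> A" "y \<in> B" by auto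
    then obtain m1 m2 where "x \<in> ?A m1" "y \<in> ?B m2" using UA UB by blast
    then have "x \<in> ?A (max m1 m2)" "y \<in> ?B (max m1 m2)"
      using big_cube_mono[of m1 "max m1 m2" n] big_cube_mono[of m2 "max m1 m2" n] by auto
    then show "p \<in> (\<Union>m. ?A m \<times> ?B m)" using p by blast
  qed auto
  have fin: "emeasure (Rn n) (?A m) < \<infinity>" "emeasure (Rn n) (?B m) < \<infinity>" for m
    by (rule le_less_trans[OF emeasure_mono[OF Int_lower2 big_cube_sets] emeasure_big_cube])+
  have r: "range (\<lambda>m. ?A m \<times> ?B m) \<subseteq> sets (Rn n \<Otimes>\<^sub>M Rn n)" using Am Bm by auto
  have "(\<lambda>m. emeasure (Rn n) (?A m) * emeasure (Rn n) (?B m)) \<longlonglongrightarrow> emeasure pair_intensity (A \<times> B)"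
    using Lim_emeasure_incseq[OF r[unfolded sets] incAB]
    unfolding UAB emeasure_pair_intensity_bounded[OF Am fin(1) Bm fin(2)] .
  moreover have "(\<lambda>m. emeasure (Rn n) (?A m) * emeasure (Rn n) (?B m)) \<longlonglongrightarrow> emeasure (Rn n) A * emeasure (Rn n) B"
    using Lim_emeasure_incseq[OF r incAB]
    unfolding UAB R.emeasure_pair_measure_Times[OF Am Bm] R.emeasure_pair_measure_Times[OF A B] .
  ultimately show "emeasure (Rn n) A * emeasure (Rn n) B = emeasure pair_intensity (A \<times> B)"
    by (rule LIMSEQ_unique[symmetric])
qed

text \<open>The second-order Campbell formula. Distinctness concerns indices, so coinciding points
  are counted as pairs too.\<close>

lemma nn_integral_distinct_pairs:
  assumes g: "g \<in> borel_measurable (Rn n \<Otimes>\<^sub>M Rn n)"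
  shows "(\<Sum>k. \<Sum>j. \<integral>\<^sup>+\<omega>. (if k \<noteq> j then g (T k \<omega>, T j \<omega>) else 0) \<partial>M) = ennreal (lam\<^sup>2) * (\<integral>\<^sup>+p. g p \<partial>(Rn n \<Otimes>\<^sub>M Rn n))"
proof -
  let ?I = "\<lambda>i. \<integral>\<^sup>+\<omega>. (if fst i \<noteq> snd i then g (T (fst i) \<omega>, T (snd i) \<omega>) else 0) \<partial>M"
  have "ennreal (lam\<^sup>2) * (\<integral>\<^sup>+p. g p \<partial>(Rn n \<Otimes>\<^sub>M Rn n)) = (ennreal (lam\<^sup>2) * ennreal (1 / lam\<^sup>2)) * (\<integral>\<^sup>+i. ?I i \<partial>count_space UNIV)"
    unfolding pair_intensity_eq nn_integral_pair_intensity[OF g] by (simp only: mult.assoc)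
  also have "ennreal (lam\<^sup>2) * ennreal (1 / lam\<^sup>2) = 1"
    using lam_pos by (simp add: ennreal_mult[symmetric])
  also have "(\<integral>\<^sup>+i. ?I i \<partial>count_space UNIV) = (\<integral>\<^sup>+k. \<integral>\<^sup>+j. ?I (k, j) \<partial>count_space UNIV \<partial>count_space UNIV)"
    by (rule nn_integral_fst_count_space[symmetric])
  finally show ?thesis by (simp add: nn_integral_count_space_nat cong del: if_weak_cong)
qed

end

section \<open>Expected numbers of atypical displacements and of confusable points\<close>

context displaced_points
begin

text \<open>A displacement is independent of the whole point sequence, so it may be frozen while the
  points are integrated out.\<close>

lemma
  assumes F: "F \<in> borel_measurable (Rn n \<Otimes>\<^sub>M point_seqs n)"
  shows nn_integral_displacement: "(\<integral>\<^sup>+\<omega>. F (D k \<omega>, \<lambda>k. T k \<omega>) \<partial>M) = (\<integral>\<^sup>+d. \<integral>\<^sup>+\<omega>. F (d, \<lambda>k. T k \<omega>) \<partial>M \<partial>Q)"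
    and nn_integral_displacement_measurable: "(\<lambda>d. \<integral>\<^sup>+\<omega>. F (d, \<lambda>k. T k \<omega>) \<partial>M) \<in> borel_measurable Q"
proof -
  let ?tau = "distr M (point_seqs n) (\<lambda>\<omega> k. T k \<omega>)"
  interpret tau: prob_space ?tau by (rule prob_space_distr) measurable
  let ?delta = "distr M (point_seqs n) (\<lambda>\<omega> k. D k \<omega>)"
  have law: "distr M (point_seqs n \<Otimes>\<^sub>M point_seqs n) (\<lambda>\<omega>. (\<lambda>k. D k \<omega>, \<lambda>k. T k \<omega>)) = ?delta \<Otimes>\<^sub>M ?tau"
    by (simp only: distr_displacements_points distr_displacements)
  have pair: "(\<lambda>\<omega>. (\<lambda>k. D k \<omega>, \<lambda>k. T k \<omega>)) \<in> M \<rightarrow>\<^sub>M point_seqs n \<Otimes>\<^sub>M point_seqs n" by measurable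
  have "(\<lambda>p. (fst p k, snd p)) \<in> point_seqs n \<Otimes>\<^sub>M point_seqs n \<rightarrow>\<^sub>M Rn n \<Otimes>\<^sub>M point_seqs n"
    by (intro measurable_Pair measurable_snd measurable_compose[OF measurable_fst component_measurable])
  from measurable_compose[OF this F] have Fk: "(\<lambda>p. F (fst p k, snd p)) \<in> borel_measurable (point_seqs n \<Otimes>\<^sub>M point_seqs n)" .
  then have Fk': "(\<lambda>p. F (fst p k, snd p)) \<in> borel_measurable (?delta \<Otimes>\<^sub>M ?tau)"
    by (simp cong: measurable_cong_sets)
  have Ft: "F \<in> borel_measurable (Rn n \<Otimes>\<^sub>M ?tau)" using F by (simp cong: measurable_cong_sets)
  have im: "(\<lambda>d. \<integral>\<^sup>+t. F (d, t) \<partial>?tau) \<in> borel_measurable (Rn n)"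
    by (rule tau.borel_measurable_nn_integral_fst[OF Ft])
  have pt: "(\<lambda>t. F (d, t)) \<in> borel_measurable (point_seqs n)" if "d \<in> space (Rn n)" for d
    by (rule measurable_compose[OF measurable_Pair1'[OF that] F])
  have inner: "(\<integral>\<^sup>+t. F (d, t) \<partial>?tau) = (\<integral>\<^sup>+\<omega>. F (d, \<lambda>k. T k \<omega>) \<partial>M)" if "d \<in> space (Rn n)" for d
    by (rule nn_integral_distr[OF points_measurable]) (simp add: pt[OF that])
  have "(\<integral>\<^sup>+\<omega>. F (D k \<omega>, \<lambda>k. T k \<omega>) \<partial>M) = (\<integral>\<^sup>+p. F (fst p k, snd p) \<partial>distr M (point_seqs n \<Otimes>\<^sub>M point_seqs n) (\<lambda>\<omega>. (\<lambda>k. D k \<omega>, \<lambda>k. T k \<omega>)))"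
    by (subst nn_integral_distr[OF pair]) (simp_all add: Fk)
  also have "\<dots> = (\<integral>\<^sup>+d. \<integral>\<^sup>+t. F (d k, t) \<partial>?tau \<partial>?delta)"
    unfolding law by (subst tau.nn_integral_fst[OF Fk', symmetric]) simp
  also have "\<dots> = (\<integral>\<^sup>+\<omega>. \<integral>\<^sup>+t. F (D k \<omega>, t) \<partial>?tau \<partial>M)"
    by (rule nn_integral_distr[OF displacements_measurable]) (simp add: measurable_compose[OF component_measurable im])
  also have "\<dots> = (\<integral>\<^sup>+d. \<integral>\<^sup>+t. F (d, t) \<partial>?tau \<partial>distr M (Rn n) (D k))"
    by (rule nn_integral_distr[OF D_measurable, symmetric]) (simp add: im)
  also have "\<dots> = (\<integral>\<^sup>+d. \<integral>\<^sup>+\<omega>. F (d, \<lambda>k. T k \<omega>) \<partial>M \<partial>Q)"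
    unfolding Q_eq[of k] by (intro nn_integral_cong inner) simp
  finally show "(\<integral>\<^sup>+\<omega>. F (D k \<omega>, \<lambda>k. T k \<omega>) \<partial>M) = (\<integral>\<^sup>+d. \<integral>\<^sup>+\<omega>. F (d, \<lambda>k. T k \<omega>) \<partial>M \<partial>Q)" .
  have "(\<lambda>d. \<integral>\<^sup>+\<omega>. F (d, \<lambda>k. T k \<omega>) \<partial>M) \<in> borel_measurable (Rn n)"
    using im by (simp cong: measurable_cong add: inner)
  then show "(\<lambda>d. \<integral>\<^sup>+\<omega>. F (d, \<lambda>k. T k \<omega>) \<partial>M) \<in> borel_measurable Q"
    by (simp cong: measurable_cong_sets add: sets_Q)
qed

text \<open>By independence the mean number of points in the unit cube, \<open>lam\<close>, is
  multiplied by the probability of an atypical displacement.\<close>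

lemma sum_atypical:
  assumes A[measurable]: "A \<in> sets (Rn n)"
  shows "(\<Sum>k. \<integral>\<^sup>+\<omega>. indicator (unit_cube n) (T k \<omega>) * indicator (space (Rn n) - A) (D k \<omega>) \<partial>M) = ennreal lam * emeasure Q (space (Rn n) - A)"
proof -
  have sA: "space (Rn n) - A \<in> sets Q" using A by (simp add: sets_Q)
  have "(\<integral>\<^sup>+\<omega>. indicator (unit_cube n) (T k \<omega>) * indicator (space (Rn n) - A) (D k \<omega>) \<partial>M) = 
     (\<integral>\<^sup>+\<omega>. indicator (unit_cube n) (T k \<omega>) \<partial>M) * emeasure Q (space (Rn n) - A)" for k
  proof -
    have [measurable]: "(\<lambda>p. snd p k) \<in> Rn n \<Otimes>\<^sub>M point_seqs n \<rightarrow>\<^sub>M Rn n"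
      by (rule measurable_compose[OF measurable_snd component_measurable])
    have "(\<lambda>p. indicator (unit_cube n) (snd p k) * indicator (space (Rn n) - A) (fst p) :: ennreal) \<in> borel_measurable (Rn n \<Otimes>\<^sub>M point_seqs n)"
      by measurable
    from nn_integral_displacement[OF this, of k]
    have "(\<integral>\<^sup>+\<omega>. indicator (unit_cube n) (T k \<omega>) * indicator (space (Rn n) - A) (D k \<omega>) \<partial>M) =
      (\<integral>\<^sup>+d. \<integral>\<^sup>+\<omega>. indicator (unit_cube n) (T k \<omega>) * indicator (space (Rn n) - A) d \<partial>M \<partial>Q)" by simp
    also have "\<dots> = (\<integral>\<^sup>+d. (\<integral>\<^sup>+\<omega>. indicator (unit_cube n) (T k \<omega>) \<partial>M) * indicator (space (Rn n) - A) d \<partial>Q)"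
      by (intro nn_integral_cong nn_integral_multc) measurable
    also have "\<dots> = (\<integral>\<^sup>+\<omega>. indicator (unit_cube n) (T k \<omega>) \<partial>M) * emeasure Q (space (Rn n) - A)"
      by (rule nn_integral_cmult_indicator[OF sA])
    finally show ?thesis .
  qed
  then have "(\<Sum>k. \<integral>\<^sup>+\<omega>. indicator (unit_cube n) (T k \<omega>) * indicator (space (Rn n) - A) (D k \<omega>) \<partial>M) = 
    (\<Sum>k. \<integral>\<^sup>+\<omega>. indicator (unit_cube n) (T k \<omega>) \<partial>M) * emeasure Q (space (Rn n) - A)" by (simp only: ennreal_suminf_multc)
  also have "(\<Sum>k. \<integral>\<^sup>+\<omega>. indicator (unit_cube n) (T k \<omega>) \<partial>M) = (\<integral>\<^sup>+\<omega>. point_count T (unit_cube n) \<omega> \<partial>M)"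
    unfolding point_count_def by (rule nn_integral_suminf[symmetric]) measurable
  also have "\<dots> = ennreal lam" by (subst nn_integral_count_mean) (auto simp: emeasure_unit_cube)
  finally show ?thesis .
qed

text \<open>For fixed \<open>x\<close> and \<open>d\<close> the confusable positions
  \<open>y\<close> are those with \<open>x + d - y\<close> in \<open>A\<close>, a reflected
  translate of \<open>A\<close> with the same volume. The result is therefore free of the law of the
  displacement.\<close>

lemma sum_confusable:
  assumes A[measurable]: "A \<in> sets (Rn n)"
  shows "(\<Sum>k. \<Sum>j. \<integral>\<^sup>+\<omega>. (if k \<noteq> j then indicator (unit_cube n) (T k \<omega>) * indicator A (vsub n (vadd n (T k \<omega>) (D k \<omega>)) (T j \<omega>)) else 0) \<partial>M) =
    ennreal (lam\<^sup>2) * emeasure (Rn n) A"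
proof -
  interpret Q: prob_space Q by (rule prob_space_Q)
  interpret R: finite_product_sigma_finite "\<lambda>_. lborel" "{1..n}" by standard simp
  let ?F = "\<lambda>k j d x y. (if k \<noteq> j then indicator (unit_cube n) x * indicator A (vsub n (vadd n x d) y) else 0) :: ennreal"
  have Fm: "(\<lambda>p. ?F k j (fst p) (snd p k) (snd p j)) \<in> borel_measurable (Rn n \<Otimes>\<^sub>M point_seqs n)" for k j
  proof -
    have [measurable]: "(\<lambda>p. snd p k) \<in> Rn n \<Otimes>\<^sub>M point_seqs n \<rightarrow>\<^sub>M Rn n" for k
      by (rule measurable_compose[OF measurable_snd component_measurable])
    show ?thesis by measurable
  qed
  let ?G = "\<lambda>k j d. \<integral>\<^sup>+\<omega>. ?F k j d (T k \<omega>) (T j \<omega>) \<partial>M"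
  have mQ: "?G k j \<in> borel_measurable Q" for k j
    using nn_integral_displacement_measurable[OF Fm[of k j]] by (simp only: fst_conv snd_conv)
  have dQ: "(\<integral>\<^sup>+\<omega>. ?F k j (D k \<omega>) (T k \<omega>) (T j \<omega>) \<partial>M) = (\<integral>\<^sup>+d. ?G k j d \<partial>Q)" for k j
    using nn_integral_displacement[OF Fm[of k j], of k] by (simp only: fst_conv snd_conv)
  have sQ: "(\<Sum>j. \<integral>\<^sup>+d. ?G k j d \<partial>Q) = (\<integral>\<^sup>+d. (\<Sum>j. ?G k j d) \<partial>Q)" for k
    by (rule nn_integral_suminf[symmetric]) (rule mQ)
  have "(\<Sum>k. \<Sum>j. \<integral>\<^sup>+\<omega>. ?F k j (D k \<omega>) (T k \<omega>) (T j \<omega>) \<partial>M) = (\<Sum>k. \<integral>\<^sup>+d. (\<Sum>j. ?G k j d) \<partial>Q)"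
    by (simp only: dQ sQ)
  also have "\<dots> = (\<integral>\<^sup>+d. (\<Sum>k. \<Sum>j. ?G k j d) \<partial>Q)"
    by (rule nn_integral_suminf[symmetric]) (rule borel_measurable_suminf_order[OF mQ])
  also have "\<dots> = (\<integral>\<^sup>+d. ennreal (lam\<^sup>2) * emeasure (Rn n) A \<partial>Q)"
  proof (rule nn_integral_cong)
    fix d assume "d \<in> space Q"
    then have d: "d \<in> space (Rn n)" using sets_eq_imp_space_eq[OF sets_Q] by simp
    let ?g = "\<lambda>p. indicator (unit_cube n) (fst p) * indicator A (vsub n (vadd n (fst p) d) (snd p)) :: ennreal"
    have g: "?g \<in> borel_measurable (Rn n \<Otimes>\<^sub>M Rn n)" using d by measurable
    have "(\<Sum>k. \<Sum>j. \<integral>\<^sup>+\<omega>. ?F k j d (T k \<omega>) (T j \<omega>) \<partial>M) = ennreal (lam\<^sup>2) * (\<integral>\<^sup>+p. ?g p \<partial>(Rn n \<Otimes>\<^sub>M Rn n))"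
      using nn_integral_distinct_pairs[OF g] by (simp only: fst_conv snd_conv cong del: if_weak_cong)
    also have "(\<integral>\<^sup>+p. ?g p \<partial>(Rn n \<Otimes>\<^sub>M Rn n)) = (\<integral>\<^sup>+x. \<integral>\<^sup>+y. ?g (x, y) \<partial>Rn n \<partial>Rn n)"
      by (rule R.nn_integral_fst[OF g, symmetric])
    also have "\<dots> = (\<integral>\<^sup>+x. emeasure (Rn n) A * indicator (unit_cube n) x \<partial>Rn n)"
    proof (rule nn_integral_cong)
      fix x
      have v[measurable]: "vsub n (vadd n x d) \<in> Rn n \<rightarrow>\<^sub>M Rn n"
        by (intro vsub_measurable measurable_const vadd_space measurable_ident_sets refl)
      have "(\<integral>\<^sup>+y. ?g (x, y) \<partial>Rn n) = indicator (unit_cube n) x * (\<integral>\<^sup>+y. indicator A (vsub n (vadd n x d) y) \<partial>Rn n)"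
        by (simp add: nn_integral_cmult)
      also have "(\<integral>\<^sup>+y. indicator A (vsub n (vadd n x d) y) \<partial>Rn n) = (\<integral>\<^sup>+y. indicator A y \<partial>distr (Rn n) (Rn n) (vsub n (vadd n x d)))"
        by (rule nn_integral_distr[OF v, symmetric]) (rule borel_measurable_indicator, simp)
      also have "\<dots> = emeasure (Rn n) A" unfolding distr_Rn_vsub by (rule nn_integral_indicator[OF A])
      finally show "(\<integral>\<^sup>+y. ?g (x, y) \<partial>Rn n) = emeasure (Rn n) A * indicator (unit_cube n) x" by (simp only: mult.commute)
    qed
    also have "\<dots> = emeasure (Rn n) A"
      by (subst nn_integral_cmult_indicator) (auto simp: emeasure_unit_cube)
    finally show "(\<Sum>k. \<Sum>j. \<integral>\<^sup>+\<omega>. ?F k j d (T k \<omega>) (T j \<omega>) \<partial>M) = ennreal (lam\<^sup>2) * emeasure (Rn n) A" .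
  qed
  also have "\<dots> = ennreal (lam\<^sup>2) * emeasure (Rn n) A" by (simp add: Q.emeasure_space_1)
  finally show ?thesis .
qed

text \<open>A union bound over the reasons for an error. The Palm factor \<open>1 / lam\<close>
  turns the first moment into a probability and leaves one factor \<open>lam\<close> of the two in
  the pair term.\<close>

lemma emeasure_palm_error:
  assumes A[measurable]: "A \<in> sets (Rn n)"
  shows "emeasure (palm n M lam T) {(\<omega>, k). \<omega> \<in> space M \<and> D k \<omega> \<notin> seen_from n (T k \<omega>) (region n A (\<lambda>k. T k \<omega>) k)} \<le>
    emeasure Q (space (Rn n) - A) + ennreal lam * emeasure (Rn n) A" (is "emeasure _ ?E \<le> _")
\<comment> \<open>Outside the sigma-algebra \<open>emeasure\<close> is 0 by convention, so the bound
  is trivial there.\<close>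
proof (cases "?E \<in> sets (palm n M lam T)")
  case True
  have sf: "sigma_finite_measure M" by unfold_locales
  let ?c = "ennreal (1 / lam)"
  let ?a = "\<lambda>k \<omega>. indicator (unit_cube n) (T k \<omega>) * indicator (space (Rn n) - A) (D k \<omega>) :: ennreal"
  let ?b = "\<lambda>k j \<omega>. (if k \<noteq> j then indicator (unit_cube n) (T k \<omega>) * indicator A (vsub n (vadd n (T k \<omega>) (D k \<omega>)) (T j \<omega>)) else 0) :: ennreal"
  let ?h = "\<lambda>k \<omega>. ?c * (?a k \<omega> + (\<Sum>j. ?b k j \<omega>))"
  have hm: "?h k \<in> borel_measurable M" and am: "?a k \<in> borel_measurable M" and bm: "?b k j \<in> borel_measurable M" for k j by measurable
  have dm: "(\<lambda>(\<omega>, k). ?c * indicator (unit_cube n) (T k \<omega>)) \<in> borel_measurable (M \<Otimes>\<^sub>M count_space UNIV)"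
    using measurable_pair_count_space[OF sf, of "\<lambda>k \<omega>. ?c * indicator (unit_cube n) (T k \<omega>)"] by (simp add: case_prod_unfold)
  have E: "?E \<in> sets (M \<Otimes>\<^sub>M count_space UNIV)" using True by (simp add: palm_def)
  have "emeasure (palm n M lam T) ?E = (\<integral>\<^sup>+w. (case w of (\<omega>, k) \<Rightarrow> ?c * indicator (unit_cube n) (T k \<omega>)) * indicator ?E w \<partial>(M \<Otimes>\<^sub>M count_space UNIV))"
    unfolding palm_def by (rule emeasure_density[OF dm E])
  also have "\<dots> \<le> (\<integral>\<^sup>+w. ?h (snd w) (fst w) \<partial>(M \<Otimes>\<^sub>M count_space UNIV))"
  proof (rule nn_integral_mono)
    fix w assume "w \<in> space (M \<Otimes>\<^sub>M count_space (UNIV :: nat set))"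
    obtain \<omega> k where w: "w = (\<omega>, k)" by force
    \<comment> \<open>Either the displacement is atypical, or \<open>region_error\<close> supplies
      an index \<open>j\<close> whose term in the sum is 1.\<close>
    have "indicator ?E w \<le> indicator (space (Rn n) - A) (D k \<omega>) + (\<Sum>j. (if k \<noteq> j then indicator A (vsub n (vadd n (T k \<omega>) (D k \<omega>)) (T j \<omega>)) else 0) :: ennreal)"
    proof (cases "w \<in> ?E \<and> D k \<omega> \<in> A")
      case True
      then have om: "\<omega> \<in> space M" and DA: "D k \<omega> \<in> A" and nin: "D k \<omega> \<notin> seen_from n (T k \<omega>) (region n A (\<lambda>k. T k \<omega>) k)" by (auto simp: w)
      have Ds: "D k \<omega> \<in> space (Rn n)" using measurable_space[OF D_measurable om] .
      have "vadd n (T k \<omega>) (D k \<omega>) \<notin> region n A (\<lambda>k. T k \<omega>) k" using nin Ds by (simp add: seen_from_def)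
      from region_error[OF Ds DA, of "\<lambda>k. T k \<omega>", OF this] obtain j where j: "j \<noteq> k" "vsub n (vadd n (T k \<omega>) (D k \<omega>)) (T j \<omega>) \<in> A" by blast
      let ?f = "\<lambda>j. (if k \<noteq> j then indicator A (vsub n (vadd n (T k \<omega>) (D k \<omega>)) (T j \<omega>)) else 0) :: ennreal"
      have "1 = sum ?f {j}" using j by simp
      also have "\<dots> \<le> (\<Sum>j. ?f j)" by (rule sum_le_suminf) auto
      finally show ?thesis by (simp add: indicator_def add_increasing)
    next
      case False
      then show ?thesis using measurable_space[OF D_measurable, of \<omega> k] by (auto simp: w indicator_def)
    qed
    then have "?c * indicator (unit_cube n) (T k \<omega>) * indicator ?E w \<le> ?c * indicator (unit_cube n) (T k \<omega>) * 
      (indicator (space (Rn n) - A) (D k \<omega>) + (\<Sum>j. (if k \<noteq> j then indicator A (vsub n (vadd n (T k \<omega>) (D k \<omega>)) (T j \<omega>)) else 0)))"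
      by (rule mult_left_mono) simp
    also have "\<dots> = ?h k \<omega>"
      by (simp only: distrib_left mult.assoc ennreal_suminf_cmult[symmetric] if_distrib[where f="\<lambda>x. _ * x"] mult_zero_right)
    finally show "(case w of (\<omega>, k) \<Rightarrow> ?c * indicator (unit_cube n) (T k \<omega>)) * indicator ?E w \<le> ?h (snd w) (fst w)"
      by (simp only: w prod.case fst_conv snd_conv)
  qed
  also have "\<dots> = (\<integral>\<^sup>+k. \<integral>\<^sup>+\<omega>. ?h k \<omega> \<partial>M \<partial>count_space UNIV)"
    by (rule nn_integral_pair_count_space[OF sf, of ?h, OF hm])
  also have "\<dots> = (\<Sum>k. \<integral>\<^sup>+\<omega>. ?h k \<omega> \<partial>M)"
    by (rule nn_integral_count_space_nat)
  also have "\<dots> = (\<Sum>k. ?c * ((\<integral>\<^sup>+\<omega>. ?a k \<omega> \<partial>M) + (\<Sum>j. \<integral>\<^sup>+\<omega>. ?b k j \<omega> \<partial>M)))"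
  proof (rule suminf_cong)
    fix k
    have sm: "(\<lambda>\<omega>. \<Sum>j. ?b k j \<omega>) \<in> borel_measurable M" by (rule borel_measurable_suminf_order[OF bm])
    show "(\<integral>\<^sup>+\<omega>. ?h k \<omega> \<partial>M) = ?c * ((\<integral>\<^sup>+\<omega>. ?a k \<omega> \<partial>M) + (\<Sum>j. \<integral>\<^sup>+\<omega>. ?b k j \<omega> \<partial>M))"
      unfolding nn_integral_cmult[OF borel_measurable_add[OF am sm]] nn_integral_add[OF am sm] nn_integral_suminf[OF bm] ..
  qed
  also have "\<dots> = ?c * ((\<Sum>k. \<integral>\<^sup>+\<omega>. ?a k \<omega> \<partial>M) + (\<Sum>k. \<Sum>j. \<integral>\<^sup>+\<omega>. ?b k j \<omega> \<partial>M))"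
    unfolding ennreal_suminf_cmult by (subst suminf_add) auto
  also have "\<dots> = ?c * (ennreal lam * emeasure Q (space (Rn n) - A) + ennreal (lam\<^sup>2) * emeasure (Rn n) A)"
    unfolding sum_atypical[OF A] sum_confusable[OF A] ..
  also have "\<dots> = (?c * ennreal lam) * emeasure Q (space (Rn n) - A) + (?c * ennreal (lam\<^sup>2)) * emeasure (Rn n) A"
    by (simp only: distrib_left mult.assoc)
  also have "?c * ennreal lam = 1" using lam_pos by (simp add: ennreal_mult[symmetric])
  also have "?c * ennreal (lam\<^sup>2) = ennreal lam" using lam_pos by (simp add: ennreal_mult[symmetric] power2_eq_square)
  finally show ?thesis by simp
qed (simp add: emeasure_notin_sets)

end

section \<open>The theorem\<close>

lemma path_law_measurable:
  assumes "\<And>l. l \<ge> 1 \<Longrightarrow> X l \<in> borel_measurable P"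
  shows "(\<lambda>\<omega>. \<lambda>l\<in>{1..}. X l \<omega>) \<in> P \<rightarrow>\<^sub>M PiM {1..} (\<lambda>_. borel :: real measure)"
  by (rule measurable_restrict) (use assms in auto)

lemma path_shift_measurable: "path_shift \<in> PiM {1..} (\<lambda>_. borel) \<rightarrow>\<^sub>M PiM {1..} (\<lambda>_. borel :: real measure)"
  unfolding path_shift_def[abs_def] by (rule measurable_restrict) (auto intro!: measurable_component_singleton)

lemma ergodic_map_path_law:
  assumes P: "prob_space P" and stat: "stationary_process P X" and erg: "ergodic_process P X"
  shows "ergodic_map (path_law P X) path_shift"
proof -
  let ?O = "PiM {1..} (\<lambda>_::nat. borel :: real measure)"
  have X: "(\<lambda>\<omega>. \<lambda>l\<in>{1..}. X l \<omega>) \<in> P \<rightarrow>\<^sub>M ?O"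
    using stat by (intro path_law_measurable) (auto simp: stationary_process_def)
  interpret P: prob_space P by fact
  interpret L: prob_space "path_law P X" unfolding path_law_def by (rule P.prob_space_distr[OF X])
  have sets: "sets (path_law P X) = sets ?O" by (simp add: path_law_def)
  have m: "path_shift \<in> path_law P X \<rightarrow>\<^sub>M path_law P X"
    using path_shift_measurable by (simp cong: measurable_cong_sets add: sets)
  have "distr (path_law P X) (path_law P X) path_shift = distr (path_law P X) ?O path_shift"
    by (rule distr_cong) (auto simp: sets)
  also have "\<dots> = distr P ?O (\<lambda>\<omega>. path_shift (\<lambda>l\<in>{1..}. X l \<omega>))"
    unfolding path_law_def by (subst distr_distr[OF path_shift_measurable X]) (simp add: comp_def)
  also have "(\<lambda>\<omega>. path_shift (\<lambda>l\<in>{1..}. X l \<omega>)) = (\<lambda>\<omega>. \<lambda>l\<in>{1..}. X (Suc l) \<omega>)"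
    by (auto simp: path_shift_def fun_eq_iff)
  also have "distr P ?O \<dots> = path_law P X" using stat by (simp add: stationary_process_def path_law_def)
  finally have "distr (path_law P X) (path_law P X) path_shift = path_law P X" .
  then show ?thesis using m erg by unfold_locales (auto simp: ergodic_process_def)
qed

lemma stationary_densities_path_law:
  assumes P: "prob_space P" and stat: "stationary_process P X" and erg: "ergodic_process P X"
    and fin: "\<And>n. n \<ge> 1 \<Longrightarrow> information_space.finite_entropy P (exp 1) (Rn n) (first_n n X) (f n)"
  shows "stationary_densities (path_law P X) f"
proof -
  let ?O = "PiM {1..} (\<lambda>_::nat. borel :: real measure)"
  have X: "(\<lambda>\<omega>. \<lambda>l\<in>{1..}. X l \<omega>) \<in> P \<rightarrow>\<^sub>M ?O"
    using stat by (intro path_law_measurable) (auto simp: stationary_process_def)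
  interpret P: prob_space P by fact
  interpret I: information_space P "exp 1" by unfold_locales simp
  interpret E: ergodic_map "path_law P X" path_shift by (rule ergodic_map_path_law[OF P stat erg])
  show ?thesis
  proof
    show "sets (path_law P X) = sets ?O" by (simp add: path_law_def)
    fix n :: nat assume n: "n \<ge> 1"
    note F = fin[OF n]
    have dist: "distributed P (Rn n) (first_n n X) (\<lambda>x. ennreal (f n x))" by (rule I.finite_entropy_distributed[OF F])
    have r: "(\<lambda>x. restrict x {1..n}) \<in> ?O \<rightarrow>\<^sub>M Rn n"
      using measurable_restrict_subset[of "{1..n}" "{1..}" "\<lambda>_. borel :: real measure"]
      by (simp cong: measurable_cong_sets add: sets_Rn)
    have "distr (path_law P X) (Rn n) (\<lambda>x. restrict x {1..n}) = distr P (Rn n) (\<lambda>\<omega>. restrict (\<lambda>l\<in>{1..}. X l \<omega>) {1..n})"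
      unfolding path_law_def by (subst distr_distr[OF r X]) (simp add: comp_def)
    also have "(\<lambda>\<omega>. restrict (\<lambda>l\<in>{1..}. X l \<omega>) {1..n}) = first_n n X"
      by (auto simp: first_n_def fun_eq_iff)
    also have "distr P (Rn n) \<dots> = density (Rn n) (\<lambda>x. ennreal (f n x))" by (rule distributed_distr_eq_density[OF dist])
    finally have law: "distr (path_law P X) (Rn n) (\<lambda>x. restrict x {1..n}) = density (Rn n) (\<lambda>x. ennreal (f n x))" .
    have "(\<lambda>x. restrict x {1..n}) \<in> path_law P X \<rightarrow>\<^sub>M Rn n"
      unfolding path_law_def measurable_distr_eq1 by (rule r)
    with law show "distributed (path_law P X) (Rn n) (\<lambda>x. restrict x {1..n}) (\<lambda>x. ennreal (f n x))"
      unfolding distributed_def using distributed_borel_measurable[OF dist] by blast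
    show "0 \<le> f n x" if "x \<in> space (Rn n)" for x by (rule I.finite_entropy_nn[OF F that])
    show "integrable (Rn n) (\<lambda>x. f n x * ln (f n x))"
      using I.finite_entropy_integrable[OF F] by (simp add: log_def)
  qed
qed

definition typical_set :: "nat \<Rightarrow> ((nat \<Rightarrow> real) \<Rightarrow> real) \<Rightarrow> real \<Rightarrow> (nat \<Rightarrow> real) set" where
  "typical_set n f a = {x \<in> space (Rn n). exp (- a) \<le> f x}"

text \<open>On the set the density is at least \<open>exp (- a)\<close>, and the set has probability
  at most 1.\<close>

lemma emeasure_typical_set:
  assumes P: "prob_space P" and d: "distributed P (Rn n) X (\<lambda>x. ennreal (f x))" and f: "f \<in> borel_measurable (Rn n)"
  shows "emeasure (Rn n) (typical_set n f a) \<le> ennreal (exp a)"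
proof -
  interpret P: prob_space P by fact
  have [measurable]: "X \<in> P \<rightarrow>\<^sub>M Rn n" by (rule distributed_measurable[OF d])
  have A: "typical_set n f a \<in> sets (Rn n)" unfolding typical_set_def using f by measurable
  have "ennreal (exp (- a)) * emeasure (Rn n) (typical_set n f a) = (\<integral>\<^sup>+x. ennreal (exp (- a)) * indicator (typical_set n f a) x \<partial>Rn n)"
    by (rule nn_integral_cmult_indicator[OF A, symmetric])
  also have "\<dots> \<le> (\<integral>\<^sup>+x. ennreal (f x) * indicator (typical_set n f a) x \<partial>Rn n)"
    by (intro nn_integral_mono) (auto simp: typical_set_def indicator_def intro!: ennreal_leI)
  also have "\<dots> = emeasure P (X -` typical_set n f a \<inter> space P)" by (rule distributed_emeasure[OF d A, symmetric])
  also have "\<dots> \<le> 1" by (rule P.measure_le_1)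
  finally have le: "ennreal (exp (- a)) * emeasure (Rn n) (typical_set n f a) \<le> 1" .
  have "emeasure (Rn n) (typical_set n f a) = (ennreal (exp a) * ennreal (exp (- a))) * emeasure (Rn n) (typical_set n f a)"
    by (simp add: ennreal_mult[symmetric] exp_add[symmetric])
  also have "\<dots> = ennreal (exp a) * (ennreal (exp (- a)) * emeasure (Rn n) (typical_set n f a))" by (simp only: mult.assoc)
  also have "\<dots> \<le> ennreal (exp a) * 1" by (rule mult_left_mono[OF le]) simp
  finally show ?thesis by simp
qed

theorem mainTheorem2:
  fixes P :: "'a measure" and X :: "nat \<Rightarrow> 'a \<Rightarrow> real"
    and f :: "nat \<Rightarrow> (nat \<Rightarrow> real) \<Rightarrow> real" and h c :: real
    and M :: "nat \<Rightarrow> 'w measure" and R lam :: "nat \<Rightarrow> real"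
    and T D :: "nat \<Rightarrow> nat \<Rightarrow> 'w \<Rightarrow> nat \<Rightarrow> real"
    and s :: "nat \<Rightarrow> nat"
  assumes "prob_space P"
    and "centered_process P X" and "stationary_process P X" and "ergodic_process P X"
    and "\<And>n. n \<ge> 1 \<Longrightarrow> information_space.finite_entropy P (exp 1) (Rn n) (first_n n X) (f n)"
    and "(\<lambda>n. prob_space.entropy P (exp 1) (Rn n) (first_n n X) / real n) \<longlonglongrightarrow> h"
    and "c = - h"
    and "\<And>n. n \<ge> 1 \<Longrightarrow> prob_space (M n)"
    and "\<And>n. n \<ge> 1 \<Longrightarrow> lam n = exp (real n * R n)"
    and "\<And>n. n \<ge> 1 \<Longrightarrow> poisson_process n (M n) (lam n) (T n)"
    and "\<And>n. n \<ge> 1 \<Longrightarrow> iid_displacements n (M n) (distr P (Rn n) (first_n n X)) (D n)"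
    and "\<And>n. n \<ge> 1 \<Longrightarrow> displacements_indep_points n (M n) (T n) (D n)"
    and "strict_mono s" and "\<And>k. s k \<ge> 1"
    and "limsup (\<lambda>k. ereal (R (s k))) < ereal c"
  shows "\<exists>C :: nat \<Rightarrow> nat \<Rightarrow> 'w \<Rightarrow> (nat \<Rightarrow> real) set.
      (\<forall>n\<ge>1. decoding_regions n (M n) (T n) (D n) (C n)) \<and>
      (\<lambda>k. error_probability (s k) (M (s k)) (lam (s k)) (T (s k)) (D (s k)) (C (s k))) \<longlonglongrightarrow> 0"
proof -
  interpret P: prob_space P by fact
  interpret I: information_space P "exp 1" by unfold_locales simp
  interpret S: stationary_densities "path_law P X" f
    by (rule stationary_densities_path_law) fact+
  let ?Q = "\<lambda>n. distr P (Rn n) (first_n n X)"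
  have dist: "distributed P (Rn n) (first_n n X) (\<lambda>x. ennreal (f n x))" if "n \<ge> 1" for n
    by (rule I.finite_entropy_distributed[OF assms(5)[OF that]])
  \<comment> \<open>For \<open>n = 0\<close>, where no density is assumed, both quotients are 0
    because they divide by 0.\<close>
  have ent: "prob_space.entropy P (exp 1) (Rn n) (first_n n X) / real n = S.diff_entropy n / real n" for n
  proof (cases "n = 0")
    case False
    then have n: "n \<ge> 1" by simp
    have "prob_space.entropy P (exp 1) (Rn n) (first_n n X) = - (\<integral>x. f n x * log (exp 1) (f n x) \<partial>Rn n)"
      by (rule I.entropy_distr[OF dist[OF n] I.finite_entropy_nn[OF assms(5)[OF n]]])
    then show ?thesis by (simp add: S.diff_entropy_def log_def)
  qed simp
  obtain r where r: "limsup (\<lambda>k. ereal (R (s k))) < ereal r" "r < - h"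
    using ereal_dense2[OF assms(15)] \<open>c = - h\<close> by auto
  \<comment> \<open>With \<open>d\<close> half the gap between \<open>r\<close> and
    \<open>- h\<close>, a rate below \<open>r\<close> makes \<open>R n + h + d\<close> smaller than
    \<open>- d\<close>: half of the gap enlarges the typical set, the other half is left as decay
    rate.\<close>
  define d where "d = (- h - r) / 2"
  have d: "d > 0" and rd: "r = - h - 2 * d" using r(2) by (auto simp: d_def field_simps)
  define A where "A n = typical_set n (f n) (real n * (h + d))" for n
  define p where "p n = measure (path_law P X) {x \<in> space (path_law P X). f n (restrict x {1..n}) < exp (- (real n * (h + d)))}" for n
  have p_lim: "p \<longlonglongrightarrow> 0"
    unfolding p_def using assms(6) d unfolding ent by (rule S.prob_density_small_tendsto_0)
  define C where "C n k \<omega> = region n (A n) (\<lambda>k. T n k \<omega>) k" for n k \<omega>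
  have A_sets: "A n \<in> sets (Rn n)" if "n \<ge> 1" for n
    unfolding A_def typical_set_def using S.density_measurable'[OF that] by measurable
  have DP: "displaced_points (M n) n (lam n) (T n) (D n) (?Q n)" if n: "n \<ge> 1" for n
  proof -
    interpret Mn: prob_space "M n" by (rule assms(8)[OF n])
    show ?thesis
      using assms(9-12)[OF n] by unfold_locales auto
  qed
  have dec: "decoding_regions n (M n) (T n) (D n) (C n)" if n: "n \<ge> 1" for n
    unfolding C_def by (rule displaced_points.decoding_regions_region[OF DP[OF n] A_sets[OF n]])
  have err: "error_probability n (M n) (lam n) (T n) (D n) (C n) \<le> p n + exp (real n * (R n + h + d))" if n: "n \<ge> 1" for n
  proof -
    interpret displaced_points "M n" n "lam n" "T n" "D n" "?Q n" by (rule DP[OF n])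
    \<comment> \<open>The first \<open>n\<close> variables and the restricted paths share the
      density \<open>f n\<close>, so the ergodic estimate on path space applies to the
      displacements.\<close>
    have atyp: "emeasure (?Q n) (space (Rn n) - A n) = ennreal (p n)"
    proof -
      have sets: "space (Rn n) - A n \<in> sets (Rn n)" using A_sets[OF n] by auto
      have "?Q n = distr (path_law P X) (Rn n) (\<lambda>x. restrict x {1..n})"
        using distributed_distr_eq_density[OF dist[OF n]] distributed_distr_eq_density[OF S.density[OF n]] by simp
      then have "emeasure (?Q n) (space (Rn n) - A n) = emeasure (path_law P X) ((\<lambda>x. restrict x {1..n}) -` (space (Rn n) - A n) \<inter> space (path_law P X))"
        by (simp only: emeasure_distr[OF S.prefix_measurable sets])
      also have "(\<lambda>x. restrict x {1..n}) -` (space (Rn n) - A n) \<inter> space (path_law P X) = 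
        {x \<in> space (path_law P X). f n (restrict x {1..n}) < exp (- (real n * (h + d)))}"
        using measurable_space[OF S.prefix_measurable] by (auto simp: A_def typical_set_def)
      finally show ?thesis by (simp add: p_def S.emeasure_eq_measure)
    qed
    have "ennreal (lam n) * emeasure (Rn n) (A n) \<le> ennreal (lam n) * ennreal (exp (real n * (h + d)))"
      unfolding A_def by (intro mult_left_mono emeasure_typical_set[OF assms(1) dist[OF n] S.density_measurable'[OF n]]) simp
    also have "\<dots> = ennreal (exp (real n * (R n + h + d)))"
      by (simp add: assms(9)[OF n] ennreal_mult[symmetric] exp_add[symmetric] algebra_simps)
    finally have vol: "ennreal (lam n) * emeasure (Rn n) (A n) \<le> ennreal (exp (real n * (R n + h + d)))" .
    have "emeasure (palm n (M n) (lam n) (T n)) {(\<omega>, k). \<omega> \<in> space (M n) \<and> D n k \<omega> \<notin> seen_from n (T n k \<omega>) (C n k \<omega>)} \<le>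
        emeasure (?Q n) (space (Rn n) - A n) + ennreal (lam n) * emeasure (Rn n) (A n)"
      unfolding C_def by (rule emeasure_palm_error[OF A_sets[OF n]])
    also have "\<dots> \<le> ennreal (p n) + ennreal (exp (real n * (R n + h + d)))" unfolding atyp by (rule add_left_mono[OF vol])
    also have "\<dots> = ennreal (p n + exp (real n * (R n + h + d)))" by (simp add: p_def)
    finally show ?thesis unfolding error_probability_def measure_def by (intro enn2real_leI) (auto simp: p_def)
  qed
  have s_lim: "filterlim s at_top sequentially" by (rule filterlim_subseq[OF assms(13)])
  have "(\<lambda>k. error_probability (s k) (M (s k)) (lam (s k)) (T (s k)) (D (s k)) (C (s k))) \<longlonglongrightarrow> 0"
  proof (rule tendsto_sandwich[OF _ _ tendsto_const])
    show "eventually (\<lambda>k. 0 \<le> error_probability (s k) (M (s k)) (lam (s k)) (T (s k)) (D (s k)) (C (s k))) sequentially"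
      by (simp add: error_probability_def)
    \<comment> \<open>The bound on the rate is available only along the subsequence and only
      eventually, while \<open>p\<close> and the exponential tend to 0 along all
      \<open>n\<close>.\<close>
    have "eventually (\<lambda>k. ereal (R (s k)) < ereal r) sequentially" using r(1) by (rule Limsup_lessD)
    then show "eventually (\<lambda>k. error_probability (s k) (M (s k)) (lam (s k)) (T (s k)) (D (s k)) (C (s k)) \<le> p (s k) + exp (- (real (s k) * d))) sequentially"
    proof eventually_elim
      case (elim k)
      have "real (s k) * (R (s k) + h + d) \<le> real (s k) * (- d)"
        using elim by (intro mult_left_mono) (auto simp: rd)
      then have "exp (real (s k) * (R (s k) + h + d)) \<le> exp (- (real (s k) * d))" by simp
      with err[OF assms(14)[of k]] show ?case by linarith
    qed
    have "(\<lambda>n. exp (- (real n * d))) \<longlonglongrightarrow> 0" using d by real_asymp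
    then have "(\<lambda>n. p n + exp (- (real n * d))) \<longlonglongrightarrow> 0" using tendsto_add[OF p_lim] by fastforce
    then show "(\<lambda>k. p (s k) + exp (- (real (s k) * d))) \<longlonglongrightarrow> 0" by (rule filterlim_compose[OF _ s_lim])
  qed
  with dec show ?thesis by blast
qed

end
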